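(* Assume (H1)–(H3) as written out in the context, and let $\lambda_*=\lambda_j(k_* )$ lie on an isolated arc of homoclinic essential spectrum (as defined in the context). Then there exist $C_1>0$ and $\eta>0$ such that for any $C>0$, for all $\varepsilon$ with $X^\varepsilon$ sufficiently large, $$|\tilde D^\varepsilon(\lambda,\gamma)-\tilde D^0(\lambda,\gamma)|\le C_1e^{-\eta X^\varepsilon/2}\qquad\text{for all }\lambda\in B(\lambda_*,C/X^\varepsilon)\text{ and all }\gamma\in\mathbb C\text{ with }|\gamma|=1,$$ where $\tilde D^\varepsilon$ and $\tilde D^0$ are the transitional periodic and transitional homoclinic Evans functions defined in the context.
   Context: Setting. For $\varepsilon\ge 0$ in a one-parameter family, consider first-order $N\times N$ systems $W'=A^\varepsilon(x,\lambda)W$, $\lambda\in\mathbb C$, where $A^\varepsilon$ is analytic in $\lambda$, $C^1$ in $x$, continuous in $\varepsilon$ for $\varepsilon>0$, and, for $\varepsilon>0$, periodic in $x$ with period $X^\varepsilon>0$. Hypotheses (for each $M>0$, with $C(M)>0$ and $\nu,\bar\theta>0$ independent of $\varepsilon$): (H1) $X^\varepsilon\to\infty$ as $\varepsilon\to0$. (H2) There is a matrix $A^0_\infty(\lambda)$, independent of $x$, with $|A^0(x,\lambda)-A^0_\infty(\lambda)|\le C(M)e^{-\nu|x|}$ for all $x\in\mathbb R$, $|\lambda|\le M$. (H3) $|A^\varepsilon(x,\lambda)-A^0(x,\lambda)|\le C(M)e^{-\bar\theta X^\varepsilon/2}$ for $|\lambda|\le M$, $|x|\le X^\varepsilon/2$.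 Domains of hyperbolicity. The set of $\lambda$ for which $A^0_\infty(\lambda)$ has a purely imaginary eigenvalue $ik$, $k\in\mathbb R$, is a finite union of curves $\lambda_j(k)$ (the homoclinic essential spectrum); the open connected components $\Lambda_r$ of its complement are the domains of hyperbolicity. Isolated arc. $\lambda_*=\lambda_j(k_* )$ lies on an isolated arc if it lies on a single curve $\lambda_j$ and $k_*$ is a nondegenerate root and the unique solution of $\lambda_j(k)=\lambda_*$: that is, $ik_*$ is a simple eigenvalue of $A^0_\infty(\lambda_* )$, all other eigenvalues of $A^0_\infty(\lambda_* )$ have nonzero real part, and, with $\mu_c(\lambda)$ the analytic eigenvalue of $A^0_\infty(\lambda)$ near $\lambda_*$ with $\mu_c(\lambda_* )=ik_*$, one has $\mu_c'(\lambda_* )\ne0$, the curve $\lambda_j$ near $k_*$ being given by $\mu_c(\lambda_j(k))=ik$. Near $\lambda_*$, $\lambda_j$ separates two domains of hyperbolicity $\Lambda_1$ and $\Lambda_2$, labelled so that $\Re\mu_c>0$ on $\Lambda_1$ and $\Re\mu_c<0$ on $\Lambda_2$ (near $\lambda_*$). Let $\Pi_c,\Pi_{ss},\Pi_{su}$ be the spectral projections of $A^0_\infty(\lambda)$, analytic near $\lambda_*$, which at $\lambda_*$ are the center, stable and unstable projections; put $n_1=\dim\operatorname{Range}\Pi_{ss}$. Conjugators. $P^0_\pm(x,\lambda)$ ($x\ge0$, resp. $x\le 0$) denote bounded, uniformly invertible matrix functions, analytic in $\lambda$ near $\lambda_*$, with $(P^0_\pm)'=A^0P^0_\pm-P^0_\pm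 A^0_\infty$ and $P^0_\pm-\mathrm{Id}=O(e^{-\bar\eta|x|})$ for some (any) $0<\bar\eta<\min(\bar\theta,\nu)$. (Such $P^0_\pm$ exist.) Homoclinic Evans functions. On a domain $\Lambda_r$, $D^0_r(\lambda)=\det(P^0_-R^-_\infty,P^0_+R^+_\infty)|_{x=0}/\det(R^-_\infty,R^+_\infty)$, where the columns of $R^-_\infty$, $R^+_\infty$ are any bases of the unstable and stable subspaces of $A^0_\infty(\lambda)$. Both $D^0_1$ and $D^0_2$ extend analytically to a neighborhood of $\lambda_*$: with $R^{su},R^c,R^{ss}$ bases of the ranges of $\Pi_{su},\Pi_c,\Pi_{ss}$, $$D^0_1=\frac{\det(P^0_-R^{su},P^0_-R^c,P^0_+R^{ss})|_{x=0}}{\det(R^{su},R^c,R^{ss})},\qquad D^0_2=\frac{\det(P^0_-R^{su},P^0_+R^c,P^0_+R^{ss})|_{x=0}}{\det(R^{su},R^c,R^{ss})}.$$ Periodic Evans functions. Let $\Psi^\varepsilon(x,\lambda)$ be the solution operator of $W'=A^\varepsilon W$ with $\Psi^\varepsilon(0,\lambda)=\mathrm{Id}$, and $$\tilde E^\varepsilon(\lambda,\gamma)=\det\big(\Psi^\varepsilon(0,\lambda)\Psi^\varepsilon(-X^\varepsilon/2,\lambda)^{-1}-\gamma\,\Psi^\varepsilon(0,\lambda)\Psi^\varepsilon(X^\varepsilon/2,\lambda)^{-1}\big).$$ Transitional Evans functions near $\lambda_*$: $$\tilde D^\varepsilon(\lambda,\gamma)=e^{-\operatorname{tr}(A^0_\infty\Pi_{su})X^\varepsilon/2}\,e^{\operatorname{tr}(A^0_\infty\Pi_{ss})X^\varepsilon/2}\,(-\gamma)^{-n_1}\,\tilde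 E^\varepsilon(\lambda,\gamma),$$ $$\tilde D^0(\lambda,\gamma)=e^{\mu_c(\lambda)X^\varepsilon/2}D^0_1(\lambda)-\gamma e^{-\mu_c(\lambda)X^\varepsilon/2}D^0_2(\lambda)$$ (the latter also depends on $\varepsilon$ through $X^\varepsilon$). $B(\lambda_*,\rho)$ is the open disk of radius $\rho$ about $\lambda_*$ in $\mathbb C$. *)

theory Defs
  imports "HOL-Analysis.Analysis" "HOL-Computational_Algebra.Polynomial"
begin

definition eigenvalue :: "complex^'n^'n \<Rightarrow> complex \<Rightarrow> bool" where
  "eigenvalue B \<mu> \<longleftrightarrow> (\<exists>v. v \<noteq> 0 \<and> B *v v = \<mu> *s v)"

definition charpoly :: "complex^'n^'n \<Rightarrow> complex poly" where
  "charpoly B = det (\<chi> i j. (if i = j then [:0, 1:] else 0) - [:B $ i $ j:])"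

text \<open>Simplicity is algebraic: a simple root of the characteristic polynomial.\<close>

definition simple_eigenvalue :: "complex^'n^'n \<Rightarrow> complex \<Rightarrow> bool" where
  "simple_eigenvalue B \<mu> \<longleftrightarrow> eigenvalue B \<mu> \<and> order \<mu> (charpoly B) = 1"

definition gen_eigenspace :: "complex^'n^'n \<Rightarrow> complex \<Rightarrow> (complex^'n) set" where
  "gen_eigenspace B \<mu> = {v. \<exists>k::nat. (((*v) (B - mat \<mu>)) ^^ k) v = 0}"

text \<open>The sum of the generalized eigenspaces of the eigenvalues in \<open>\<Omega>\<close>; the points of \<open>\<Omega>\<close> that
  are not eigenvalues contribute only the zero vector.\<close>

definition spectral_subspace :: "complex^'n^'n \<Rightarrow> complex set \<Rightarrow> (complex^'n) set" where
  "spectral_subspace B \<Omega> = vec.span (\<Union>\<mu>\<in>\<Omega>. gen_eigenspace B \<mu>)"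

definition is_spectral_projection :: "complex^'n^'n \<Rightarrow> complex set \<Rightarrow> complex^'n^'n \<Rightarrow> bool" where
  "is_spectral_projection B \<Omega> Q \<longleftrightarrow>
     Q ** Q = Q \<and>
     range ((*v) Q) = spectral_subspace B \<Omega> \<and>
     {v. Q *v v = 0} = spectral_subspace B (- \<Omega>)"

definition matrix_holomorphic_on :: "(complex \<Rightarrow> complex^'n^'n) \<Rightarrow> complex set \<Rightarrow> bool" where
  "matrix_holomorphic_on F U \<longleftrightarrow> (\<forall>i j. (\<lambda>z. F z $ i $ j) holomorphic_on U)"

text \<open>From here on \<open>z\<close> is the spectral parameter, and \<open>zs\<close> the base point on the arc of essential
  spectrum. The next definition describes an analytic family of spectral projections of \<open>B z\<close>
  that at \<open>zs\<close> is the one belonging to \<open>\<Omega>\<close>; this determines \<open>Q\<close> near \<open>zs\<close>. The spectral set for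
  \<open>z \<noteq> zs\<close> is left open because the eigenvalues that are purely imaginary at \<open>zs\<close> leave the
  imaginary axis.\<close>

definition analytic_spectral_projection ::
  "(complex \<Rightarrow> complex^'n^'n) \<Rightarrow> complex set \<Rightarrow> complex \<Rightarrow> complex set \<Rightarrow> (complex \<Rightarrow> complex^'n^'n) \<Rightarrow> bool"
  where
  "analytic_spectral_projection B U zs \<Omega> Q \<longleftrightarrow>
     matrix_holomorphic_on Q U \<and>
     (\<forall>z\<in>U. \<exists>\<Omega>'. is_spectral_projection (B z) \<Omega>' (Q z)) \<and>
     is_spectral_projection (B zs) \<Omega> (Q zs)"

text \<open>\<open>lam\<close> is the curve of essential spectrum through \<open>zs = lam ks\<close>; \<open>\<mu>c\<close> is the analytic eigenvalue
  of \<open>B z\<close> which equals \<open>\<i> * ks\<close> at \<open>zs\<close>.\<close>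

definition isolated_arc ::
  "(complex \<Rightarrow> complex^'n^'n) \<Rightarrow> complex set \<Rightarrow> (real \<Rightarrow> complex) \<Rightarrow> real \<Rightarrow> complex \<Rightarrow> (complex \<Rightarrow> complex) \<Rightarrow> bool"
  where
  "isolated_arc B U lam ks zs \<mu>c \<longleftrightarrow>
     lam ks = zs \<and>
     simple_eigenvalue (B zs) (\<i> * of_real ks) \<and>
     (\<forall>\<mu>. eigenvalue (B zs) \<mu> \<and> \<mu> \<noteq> \<i> * of_real ks \<longrightarrow> Re \<mu> \<noteq> 0) \<and>
     \<mu>c holomorphic_on U \<and>
     (\<forall>z\<in>U. eigenvalue (B z) (\<mu>c z)) \<and>
     \<mu>c zs = \<i> * of_real ks \<and>
     deriv \<mu>c zs \<noteq> 0 \<and>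
     isCont lam ks \<and>
     (\<forall>\<^sub>F k in nhds ks. \<mu>c (lam k) = \<i> * of_real k)"

text \<open>\<open>S\<close> is the half-line \<open>{0..}\<close> or \<open>{..0}\<close>; all bounds are uniform in \<open>x \<in> S\<close> and \<open>z \<in> U\<close>.\<close>

definition conjugator ::
  "(real \<Rightarrow> complex \<Rightarrow> complex^'n^'n) \<Rightarrow> (complex \<Rightarrow> complex^'n^'n) \<Rightarrow> complex set \<Rightarrow> real set \<Rightarrow> real
    \<Rightarrow> (real \<Rightarrow> complex \<Rightarrow> complex^'n^'n) \<Rightarrow> bool"
  where
  "conjugator A0 B U S \<eta> P \<longleftrightarrow>
     (\<forall>x\<in>S. matrix_holomorphic_on (P x) U) \<and>
     (\<exists>K. \<forall>x\<in>S. \<forall>z\<in>U. norm (P x z) \<le> K \<and> invertible (P x z) \<and> norm (matrix_inv (P x z)) \<le> K) \<and>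
     (\<forall>z\<in>U. \<forall>x\<in>S. ((\<lambda>y. P y z) has_vector_derivative
        (A0 x z ** P x z - P x z ** B z)) (at x within S)) \<and>
     (\<exists>K. \<forall>x\<in>S. \<forall>z\<in>U. norm (P x z - mat 1) \<le> K * exp (- \<eta> * \<bar>x\<bar>))"

definition solution_operator ::
  "(real \<Rightarrow> complex^'n^'n) \<Rightarrow> (real \<Rightarrow> complex^'n^'n) \<Rightarrow> bool" where
  "solution_operator A \<Psi> \<longleftrightarrow>
     \<Psi> 0 = mat 1 \<and> (\<forall>x. (\<Psi> has_vector_derivative (A x ** \<Psi> x)) (at x))"

text \<open>A basis of \<open>\<complex>\<^sup>N\<close> is stored as the columns of one square matrix \<open>R\<close>, and a basis of a subspace
  \<open>V\<close> as the columns of \<open>R\<close> with index in \<open>J\<close>.\<close>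

definition basis_columns :: "complex^'n^'n \<Rightarrow> 'n set \<Rightarrow> (complex^'n) set \<Rightarrow> bool" where
  "basis_columns R J V \<longleftrightarrow>
     inj_on (\<lambda>j. column j R) J \<and>
     vec.independent ((\<lambda>j. column j R) ` J) \<and>
     vec.span ((\<lambda>j. column j R) ` J) = V"

text \<open>\<open>det (Pm R\<^sub>J, Pp R\<^sub>J\<^sub>') / det (R\<^sub>J, R\<^sub>J\<^sub>')\<close>, where \<open>J'\<close> is the complement of \<open>J\<close>. Both
  determinants keep the column order of \<open>R\<close>, so this is the usual quotient, in which the columns are
  grouped. On a domain of hyperbolicity it is the homoclinic Evans function if the columns in
  \<open>J\<close> and \<open>J'\<close> are bases of the unstable and stable subspaces of the limiting matrix. At a point of an
  isolated arc the center column belongs to \<open>J\<close> for the extension from the side \<open>Re \<mu>c > 0\<close>, and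
  to \<open>J'\<close> for the extension from the side \<open>Re \<mu>c < 0\<close>.\<close>

definition homoclinic_evans ::
  "complex^'n^'n \<Rightarrow> complex^'n^'n \<Rightarrow> complex^'n^'n \<Rightarrow> 'n set \<Rightarrow> complex" where
  "homoclinic_evans Pm Pp R J =
     det (\<chi> i j. if j \<in> J then (Pm ** R) $ i $ j else (Pp ** R) $ i $ j) / det R"

definition periodic_evans :: "(real \<Rightarrow> complex^'n^'n) \<Rightarrow> real \<Rightarrow> complex \<Rightarrow> complex" where
  "periodic_evans \<Psi> X \<gamma> =
     det (\<Psi> 0 ** matrix_inv (\<Psi> (- X / 2)) - mat \<gamma> ** (\<Psi> 0 ** matrix_inv (\<Psi> (X / 2))))"

definition transitional_periodic_evans ::
  "complex^'n^'n \<Rightarrow> complex^'n^'n \<Rightarrow> complex^'n^'n \<Rightarrow> nat \<Rightarrow> (real \<Rightarrow> complex^'n^'n) \<Rightarrow> real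
    \<Rightarrow> complex \<Rightarrow> complex"
  where
  "transitional_periodic_evans B Qsu Qss n1 \<Psi> X \<gamma> =
     exp (- trace (B ** Qsu) * of_real X / 2) * exp (trace (B ** Qss) * of_real X / 2)
       * (- \<gamma>) powi (- int n1) * periodic_evans \<Psi> X \<gamma>"

definition transitional_homoclinic_evans ::
  "complex \<Rightarrow> complex \<Rightarrow> complex \<Rightarrow> real \<Rightarrow> complex \<Rightarrow> complex" where
  "transitional_homoclinic_evans \<mu> D1 D2 X \<gamma> =
     exp (\<mu> * of_real X / 2) * D1 - \<gamma> * exp (- \<mu> * of_real X / 2) * D2"

end

theory Submission
  imports Defs
begin

text \<open>On a half-line the conjugator turns \<open>W' = A\<^sup>\<epsilon> W\<close> into \<open>Z' = (B + \<Delta>) Z\<close> with \<open>B\<close> the limiting matrix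
  and \<open>\<Delta> = O(e\<^sup>-\<^sup>\<theta>\<^sup>L)\<close>, \<open>L = X/2\<close>. A second conjugation \<open>T = Id + O(e\<^sup>-\<^sup>\<theta>\<^sup>L\<^sup>/\<^sup>2)\<close> on \<open>[0, L]\<close> removes \<open>\<Delta>\<close>
  altogether; since \<open>L\<close> is finite it solves a linear two-point boundary value problem, whatever the spread
  of the spectrum of \<open>B\<close>. Hence the inverse solution operators at \<open>\<plusminus>L\<close> are \<open>M e\<^bsup>\<mp>LB\<^esup> G\<close> with \<open>M\<close> close to the
  conjugator at \<open>0\<close> and \<open>G\<close> close to the identity. The growing parts \<open>e\<^bsup>LB\<^esup> \<Pi>\<^sub>s\<^sub>u\<close> and \<open>e\<^bsup>-LB\<^esup> \<Pi>\<^sub>s\<^sub>s\<close>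
  factor out of the periodic determinant exactly, producing the trace exponentials, and the remaining factor
  differs from the one that defines the homoclinic functions by \<open>O(e\<^sup>-\<^sup>\<eta>\<^sup>L)\<close>. The estimate holds on a fixed
  disk where \<open>\<bar>Re \<mu>\<^sub>c\<bar>\<close> is small compared with \<open>\<eta>\<close>; the disk of radius \<open>C/X\<close> eventually lies in it,
  which is why \<open>C\<^sub>1\<close> and \<open>\<eta>\<close> do not depend on \<open>C\<close>.\<close>

section \<open>The Frobenius norm\<close>

text \<open>The obstacle to removing \<Delta> is that the conjugation equation T' = B T - T B +
  \<Delta> T has, in coordinates where B is almost diagonal, the exponents d_i - d_j. Some of them
  vanish, at least those with i = j, so there is no dichotomy. The weight e^{\<kappa> x} moves every
  exponent with nonnegative real part to real part at least \<kappa>, and \<kappa> is so small that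
  those with negative real part stay below -\<kappa>. The price is a factor e^{\<kappa> L} in the
  forcing, which is affordable because \<Delta> has size e^{-\<theta> L} on the entire interval and
  \<kappa> is at most \<theta>/2. Everything has to be uniform in lambda although eigenvalues may
  split near the base point. So the coordinates are fixed at the base point and B is merely almost
  diagonal in them. Relations between the projections hold exactly at the base point and only
  approximately nearby by continuity; they become exact again because an idempotent of norm below 1
  vanishes. The determinant bound costs the n-th power of e^{\<omega> L}, where \<omega> bounds the
  real part of the center eigenvalue; hence \<omega> is a fraction 1/n of the available
  rate.\<close>

lemma norm_vec_sq: "(norm (v :: 'a::real_normed_vector^'n))\<^sup>2 = (\<Sum>j\<in>UNIV. (norm (v $ j))\<^sup>2)"
  unfolding norm_vec_def L2_set_def by (rule real_sqrt_pow2) (simp add: sum_nonneg)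

lemma norm_matrix_sq:
  "(norm (A :: complex^'n^'m))\<^sup>2 = (\<Sum>i\<in>UNIV. \<Sum>j\<in>UNIV. (norm (A $ i $ j))\<^sup>2)"
  by (simp only: norm_vec_sq)

lemma norm_entry_le: "norm ((A :: complex^'n^'m) $ i $ j) \<le> norm A"
  by (rule order_trans[OF Finite_Cartesian_Product.norm_nth_le Finite_Cartesian_Product.norm_nth_le])

lemma norm_sum_mult_sq_le:
  fixes f g :: "'a \<Rightarrow> complex"
  shows "(norm (\<Sum>k\<in>K. f k * g k))\<^sup>2 \<le> (\<Sum>k\<in>K. (norm (f k))\<^sup>2) * (\<Sum>k\<in>K. (norm (g k))\<^sup>2)"
proof -
  have "norm (\<Sum>k\<in>K. f k * g k) \<le> (\<Sum>k\<in>K. norm (f k) * norm (g k))"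
    by (rule order_trans[OF norm_sum]) (simp add: norm_mult)
  also have "\<dots> \<le> L2_set (\<lambda>k. norm (f k)) K * L2_set (\<lambda>k. norm (g k)) K"
    using L2_set_mult_ineq[of "\<lambda>k. norm (f k)" "\<lambda>k. norm (g k)" K] by simp
  finally have "(norm (\<Sum>k\<in>K. f k * g k))\<^sup>2 \<le> (L2_set (\<lambda>k. norm (f k)) K * L2_set (\<lambda>k. norm (g k)) K)\<^sup>2"
    by (intro power_mono) auto
  then show ?thesis
    by (simp add: power_mult_distrib L2_set_def sum_nonneg)
qed

text \<open>Cauchy-Schwarz in each entry. The norm of the nested vector type is the Frobenius norm,
  for which \<open>mat 1\<close> has norm sqrt n and not 1; this is why \<open>norm (mat 1)\<close>
  survives in later constants.\<close>

lemma norm_matrix_mult_le: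
  fixes A :: "complex^'n^'m" and B :: "complex^'p^'n"
  shows "norm (A ** B) \<le> norm A * norm B"
proof -
  have "(norm (A ** B))\<^sup>2 = (\<Sum>i\<in>UNIV. \<Sum>j\<in>UNIV. (norm (\<Sum>k\<in>UNIV. A $ i $ k * B $ k $ j))\<^sup>2)"
    by (simp add: norm_matrix_sq matrix_matrix_mult_def)
  also have "\<dots> \<le> (\<Sum>i\<in>UNIV. \<Sum>j\<in>UNIV. (\<Sum>k\<in>UNIV. (norm (A $ i $ k))\<^sup>2) * (\<Sum>k\<in>UNIV. (norm (B $ k $ j))\<^sup>2))"
    by (intro sum_mono norm_sum_mult_sq_le)
  also have "\<dots> = (\<Sum>i\<in>UNIV. \<Sum>k\<in>UNIV. (norm (A $ i $ k))\<^sup>2) * (\<Sum>j\<in>UNIV. \<Sum>k\<in>UNIV. (norm (B $ k $ j))\<^sup>2)"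
    by (simp add: sum_product)
  also have "\<dots> = (norm A)\<^sup>2 * (norm B)\<^sup>2"
    unfolding norm_matrix_sq by (subst (2) sum.swap) simp
  finally have "(norm (A ** B))\<^sup>2 \<le> (norm A * norm B)\<^sup>2" by (simp add: power_mult_distrib)
  then show ?thesis by (rule power2_le_imp_le) simp
qed

lemma norm_matrix_vector_le:
  fixes A :: "complex^'n^'m"
  shows "norm (A *v x) \<le> norm A * norm x"
proof -
  have "(norm (A *v x))\<^sup>2 = (\<Sum>i\<in>UNIV. (norm (\<Sum>k\<in>UNIV. A $ i $ k * x $ k))\<^sup>2)"
    unfolding norm_vec_sq by (simp add: matrix_vector_mult_def)
  also have "\<dots> \<le> (\<Sum>i\<in>UNIV. (\<Sum>k\<in>UNIV. (norm (A $ i $ k))\<^sup>2) * (\<Sum>k\<in>UNIV. (norm (x $ k))\<^sup>2))"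
    by (intro sum_mono norm_sum_mult_sq_le)
  also have "\<dots> = (norm A)\<^sup>2 * (norm x)\<^sup>2"
    by (simp add: norm_matrix_sq norm_vec_sq[of x] sum_distrib_right)
  finally have "(norm (A *v x))\<^sup>2 \<le> (norm A * norm x)\<^sup>2" by (simp add: power_mult_distrib)
  then show ?thesis by (rule power2_le_imp_le) simp
qed

lemma norm_matrix_le_entries:
  fixes A :: "complex^'n^'m"
  assumes "\<And>i j. norm (A $ i $ j) \<le> m"
  shows "norm A \<le> of_nat (CARD('n) * CARD('m)) * m"
proof -
  have "norm A \<le> (\<Sum>i\<in>UNIV. norm (A $ i))" by (simp add: norm_vec_def L2_set_le_sum)
  also have "\<dots> \<le> (\<Sum>i\<in>UNIV. \<Sum>j\<in>UNIV. norm (A $ i $ j))"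
    by (intro sum_mono) (simp add: norm_vec_def L2_set_le_sum)
  also have "\<dots> \<le> (\<Sum>i::'m\<in>UNIV. \<Sum>j::'n\<in>UNIV. m)" by (intro sum_mono assms)
  also have "\<dots> = of_nat (CARD('n) * CARD('m)) * m" by simp
  finally show ?thesis .
qed

lemma norm_mult3_le:
  fixes A B C :: "complex^'n^'n"
  shows "norm (A ** B ** C) \<le> norm A * norm B * norm C"
  by (meson mult_right_mono norm_ge_zero norm_matrix_mult_le order_trans)

lemma mat_mult_entry [simp]: "(mat c ** (A :: complex^'n^'n)) $ i $ j = c * A $ i $ j"
  by (simp add: matrix_matrix_mult_def mat_def if_distrib if_distribR cong: if_cong)

lemma mult_mat_entry [simp]: "((A :: complex^'n^'n) ** mat c) $ i $ j = c * A $ i $ j"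
  by (simp add: matrix_matrix_mult_def mat_def if_distrib if_distribR mult.commute cong: if_cong)

lemma mat_commute: "(A :: complex^'n^'n) ** mat c = mat c ** A"
  by (simp add: vec_eq_iff)

lemma norm_mat_mult [simp]: "norm (mat c ** (A :: complex^'n^'n)) = norm c * norm A"
proof -
  have "(norm (mat c ** A))\<^sup>2 = (norm c * norm A)\<^sup>2"
    unfolding power_mult_distrib norm_matrix_sq
    by (simp add: norm_mult power_mult_distrib sum_distrib_left)
  then show ?thesis by (simp add: power2_eq_iff_nonneg)
qed

section \<open>Bilinearity, the product rule and entrywise calculus for matrix functions\<close>

lemma bounded_bilinear_matrix_mult:
  "bounded_bilinear ((**) :: complex^'n^'m \<Rightarrow> complex^'p^'n \<Rightarrow> complex^'p^'m)"
proof
  show "\<exists>K. \<forall>a b. norm ((a :: complex^'n^'m) ** (b :: complex^'p^'n)) \<le> norm a * norm b * K"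
    by (rule exI[of _ 1]) (simp add: norm_matrix_mult_le)
qed (simp_all add: matrix_matrix_mult_def vec_eq_iff distrib_right distrib_left sum.distrib scaleR_sum_right)

lemma bounded_bilinear_matrix_vector_mult:
  "bounded_bilinear ((*v) :: complex^'n^'m \<Rightarrow> complex^'n \<Rightarrow> complex^'m)"
proof
  show "\<exists>K. \<forall>a b. norm ((a :: complex^'n^'m) *v (b :: complex^'n)) \<le> norm a * norm b * K"
    by (rule exI[of _ 1]) (simp add: norm_matrix_vector_le)
qed (simp_all add: matrix_vector_mult_def vec_eq_iff distrib_right distrib_left sum.distrib scaleR_sum_right)

lemmas matrix_diff_left = bounded_bilinear.diff_left[OF bounded_bilinear_matrix_mult]
lemmas matrix_diff_right = bounded_bilinear.diff_right[OF bounded_bilinear_matrix_mult]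
lemmas matrix_add_left = bounded_bilinear.add_left[OF bounded_bilinear_matrix_mult]
lemmas matrix_add_right = bounded_bilinear.add_right[OF bounded_bilinear_matrix_mult]
lemmas matrix_minus_left = bounded_bilinear.minus_left[OF bounded_bilinear_matrix_mult]
lemmas matrix_minus_right = bounded_bilinear.minus_right[OF bounded_bilinear_matrix_mult]
lemmas matrix_distribs = matrix_diff_left matrix_diff_right matrix_add_left matrix_add_right
  matrix_minus_left matrix_minus_right
lemmas has_vector_derivative_matrix_mult =
  bounded_bilinear.has_vector_derivative[OF bounded_bilinear_matrix_mult]
lemmas has_vector_derivative_matrix_vector_mult =
  bounded_bilinear.has_vector_derivative[OF bounded_bilinear_matrix_vector_mult]
lemmas tendsto_matrix_mult = bounded_bilinear.tendsto[OF bounded_bilinear_matrix_mult]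

lemma has_vector_derivative_entry:
  "(F has_vector_derivative D) net \<Longrightarrow> ((\<lambda>x. (F x :: complex^'n^'m) $ i $ j) has_vector_derivative D $ i $ j) net"
  by (intro bounded_linear.has_vector_derivative[OF bounded_linear_vec_nth])

lemma has_vector_derivative_matrixI:
  fixes F :: "real \<Rightarrow> complex^'n^'m"
  assumes "\<And>i j. ((\<lambda>x. F x $ i $ j) has_vector_derivative D $ i $ j) (at x within S)"
  shows "(F has_vector_derivative D) (at x within S)"
proof -
  have "((\<lambda>y. (1 / norm (y - x)) *\<^sub>R (F y - (F x + (y - x) *\<^sub>R D))) \<longlongrightarrow> 0) (at x within S)"
    using assms unfolding has_vector_derivative_def has_derivative_within
    by (intro vec_tendstoI) simp
  then show ?thesis
    unfolding has_vector_derivative_def has_derivative_within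
    by (auto intro: bounded_linear_scaleR_left)
qed

section \<open>Inverses near the identity and perturbation of determinants\<close>

lemma invertible_matrix_inv:
  fixes A :: "'a::semiring_1^'n^'n"
  assumes "invertible A"
  shows "A ** matrix_inv A = mat 1" "matrix_inv A ** A = mat 1"
  using someI_ex[OF assms[unfolded invertible_def], folded matrix_inv_def] by auto

lemma matrix_inv_unique:
  fixes A :: "'a::field^'n^'n"
  assumes "A ** B = mat 1"
  shows "invertible A" "matrix_inv A = B"
proof -
  show inv: "invertible A" using assms invertible_right_inverse by blast
  have "matrix_inv A = matrix_inv A ** (A ** B)" by (simp add: assms)
  also have "\<dots> = B" by (simp add: matrix_mul_assoc invertible_matrix_inv[OF inv])
  finally show "matrix_inv A = B" .
qed

text \<open>A kernel vector satisfies v = -(G - 1) v and so has at most half its own norm. The same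
  absorption works for Y = G^{-1} - 1, which solves Y = -(G - 1) Y - (G - 1): half of the norm of Y
  moves to the left side.\<close>

lemma matrix_near_identity:
  fixes G :: "complex^'n^'n"
  assumes "norm (G - mat 1) \<le> 1/2"
  shows "invertible G" "norm (matrix_inv G - mat 1) \<le> 2 * norm (G - mat 1)"
proof -
  have "v = 0" if "G *v v = 0" for v
  proof -
    have "v = - ((G - mat 1) *v v)" using that by (simp add: matrix_vector_mult_diff_rdistrib)
    then have "norm v \<le> 1/2 * norm v"
      by (metis assms mult_right_mono norm_ge_zero norm_matrix_vector_le norm_minus_cancel order_trans)
    then show ?thesis by simp
  qed
  then show inv: "invertible G"
    by (simp add: invertible_left_inverse matrix_left_invertible_ker)
  define Y where "Y = matrix_inv G - mat 1"
  have "Y = - ((G - mat 1) ** Y) - (G - mat 1)"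
    using invertible_matrix_inv(1)[OF inv] unfolding Y_def by (simp add: matrix_distribs)
  then have "norm Y \<le> norm ((G - mat 1) ** Y) + norm (G - mat 1)"
    by (metis norm_minus_cancel norm_triangle_ineq4)
  also have "norm ((G - mat 1) ** Y) \<le> 1/2 * norm Y"
    by (meson assms mult_right_mono norm_ge_zero norm_matrix_mult_le order_trans)
  finally show "norm (matrix_inv G - mat 1) \<le> 2 * norm (G - mat 1)" unfolding Y_def by simp
qed

text \<open>Each summand of the Leibniz formula is a product of n entries. Divided by
  \<open>M\<close>, the entries lie in the unit disk, where two products differ by at most the sum
  of the differences of their factors. Scaling back gives \<open>M ^ (CARD('n) - 1)\<close>, and the
  factorial counts the permutations.\<close>

lemma det_diff_le:
  fixes A B :: "complex^'n^'n"
  assumes M: "M > 0" and A: "\<And>i j. norm (A $ i $ j) \<le> M" and B: "\<And>i j. norm (B $ i $ j) \<le> M"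
    and e: "\<And>i j. norm (A $ i $ j - B $ i $ j) \<le> e"
  shows "norm (det A - det B) \<le> fact CARD('n) * of_nat CARD('n) * M ^ (CARD('n) - 1) * e"
proof -
  have *: "norm (of_int (sign p) * (\<Prod>i\<in>UNIV. A $ i $ p i) - of_int (sign p) * (\<Prod>i\<in>UNIV. B $ i $ p i))
      \<le> of_nat CARD('n) * M ^ (CARD('n) - 1) * e" for p :: "'n \<Rightarrow> 'n"
  proof -
    have "norm ((\<Prod>i\<in>UNIV. A $ i $ p i / of_real M) - (\<Prod>i\<in>UNIV. B $ i $ p i / of_real M))
        \<le> (\<Sum>i\<in>UNIV. norm (A $ i $ p i / of_real M - B $ i $ p i / of_real M))"
      by (rule norm_prod_diff) (use A B M in \<open>auto simp: norm_divide\<close>)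
    also have "\<dots> \<le> (\<Sum>i::'n\<in>UNIV. e / M)"
      by (intro sum_mono) (use e M in \<open>auto simp: norm_divide divide_right_mono simp flip: diff_divide_distrib\<close>)
    also have "\<dots> = of_nat CARD('n) * e / M" by simp
    finally have "norm ((\<Prod>i\<in>UNIV. A $ i $ p i) - (\<Prod>i\<in>UNIV. B $ i $ p i)) / M ^ CARD('n) \<le> of_nat CARD('n) * e / M"
      using M by (simp add: prod_dividef norm_divide norm_power flip: diff_divide_distrib)
    then have "norm ((\<Prod>i\<in>UNIV. A $ i $ p i) - (\<Prod>i\<in>UNIV. B $ i $ p i)) \<le> of_nat CARD('n) * e / M * M ^ CARD('n)"
      using M by (simp add: pos_divide_le_eq)
    also have "\<dots> = of_nat CARD('n) * M ^ (CARD('n) - 1) * e"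
      using M by (cases "CARD('n)") auto
    finally have "norm ((\<Prod>i\<in>UNIV. A $ i $ p i) - (\<Prod>i\<in>UNIV. B $ i $ p i)) \<le> of_nat CARD('n) * M ^ (CARD('n) - 1) * e" .
    then show ?thesis
      by (simp add: norm_mult sign_def flip: right_diff_distrib)
  qed
  have "norm (det A - det B) \<le> (\<Sum>p | p permutes (UNIV :: 'n set). of_nat CARD('n) * M ^ (CARD('n) - 1) * e)"
    unfolding det_def sum_subtractf[symmetric] by (rule sum_norm_le) (rule *)
  also have "\<dots> = fact CARD('n) * of_nat CARD('n) * M ^ (CARD('n) - 1) * e"
    by (simp add: card_permutations[OF refl])
  finally show ?thesis .
qed

section \<open>The matrix exponential\<close>

definition mpow :: "complex^'n^'n \<Rightarrow> nat \<Rightarrow> complex^'n^'n" where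
  "mpow B k = (((**) B) ^^ k) (mat 1)"

lemma mpow_0 [simp]: "mpow B 0 = mat 1"
  and mpow_Suc: "mpow B (Suc k) = B ** mpow B k"
  by (simp_all add: mpow_def)

lemma norm_mpow_le: "norm (mpow B k) \<le> norm (mat 1 :: complex^'n^'n) * norm B ^ k"
  for B :: "complex^'n^'n"
proof (induction k)
  case (Suc k)
  have "norm (mpow B (Suc k)) \<le> norm B * norm (mpow B k)"
    unfolding mpow_Suc by (rule norm_matrix_mult_le)
  also have "\<dots> \<le> norm B * (norm (mat 1 :: complex^'n^'n) * norm B ^ k)"
    by (intro mult_left_mono Suc.IH) simp
  finally show ?case by (simp add: mult_ac)
qed simp

definition mexp :: "complex^'n^'n \<Rightarrow> real \<Rightarrow> complex^'n^'n" where
  "mexp B t = (\<chi> i j. \<Sum>k. mpow B k $ i $ j / fact k * of_real t ^ k)"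

text \<open>The argument is complex because the derivative of \<open>mexp\<close> is obtained from
  the complex power series and restricted to real times afterwards. The majorant is the exponential
  series of \<open>norm B * norm y\<close>.\<close>

lemma summable_mexp:
  fixes B :: "complex^'n^'n" and y :: complex
  shows "summable (\<lambda>k. mpow B k $ i $ j / fact k * y ^ k)"
proof (rule summable_comparison_test')
  show "summable (\<lambda>k. norm (mat 1 :: complex^'n^'n) * (inverse (fact k) *\<^sub>R (norm B * norm y) ^ k))"
    by (intro summable_mult summable_exp_generic)
  fix k :: nat
  have "norm (mpow B k $ i $ j / fact k * y ^ k) = norm (mpow B k $ i $ j) * (inverse (fact k) * norm y ^ k)"
    by (simp add: norm_mult norm_divide norm_power norm_inverse norm_fact divide_inverse)
  also have "\<dots> \<le> (norm (mat 1 :: complex^'n^'n) * norm B ^ k) * (inverse (fact k) * norm y ^ k)"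
    by (intro mult_right_mono order_trans[OF norm_entry_le norm_mpow_le]) simp
  finally show "norm (mpow B k $ i $ j / fact k * y ^ k)
      \<le> norm (mat 1 :: complex^'n^'n) * (inverse (fact k) *\<^sub>R (norm B * norm y) ^ k)"
    by (simp add: mult_ac power_mult_distrib)
qed

lemma mexp_0 [simp]: "mexp B 0 = mat 1"
proof -
  have "(\<Sum>k. mpow B k $ i $ j / fact k * of_real 0 ^ k) = mat 1 $ i $ j" for i j
    using suminf_finite[of "{0}" "\<lambda>k. mpow B k $ i $ j / fact k * of_real 0 ^ k"] by simp
  then show ?thesis by (simp add: mexp_def vec_eq_iff)
qed

lemma mexp_commute:
  fixes B C :: "complex^'n^'n"
  assumes "B ** C = C ** B"
  shows "mexp B t ** C = C ** mexp B t"
proof -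
  have *: "mpow B k ** C = C ** mpow B k" for k
    by (induction k) (simp_all add: mpow_Suc matrix_mul_assoc assms flip: matrix_mul_assoc[of B])
  have "(mexp B t ** C) $ i $ j = (C ** mexp B t) $ i $ j" for i j
  proof -
    have "(mexp B t ** C) $ i $ j = (\<Sum>l\<in>UNIV. (\<Sum>k. mpow B k $ i $ l / fact k * of_real t ^ k) * C $ l $ j)"
      by (simp add: mexp_def matrix_matrix_mult_def)
    also have "\<dots> = (\<Sum>l\<in>UNIV. (\<Sum>k. mpow B k $ i $ l / fact k * of_real t ^ k * C $ l $ j))"
      by (intro sum.cong refl suminf_mult2 summable_mexp)
    also have "\<dots> = (\<Sum>k. \<Sum>l\<in>UNIV. mpow B k $ i $ l / fact k * of_real t ^ k * C $ l $ j)"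
      by (intro suminf_sum[symmetric] summable_mult2 summable_mexp)
    also have "\<dots> = (\<Sum>k. (mpow B k ** C) $ i $ j / fact k * of_real t ^ k)"
      by (simp add: matrix_matrix_mult_def sum_distrib_right sum_distrib_left sum_divide_distrib mult_ac)
    also have "\<dots> = (\<Sum>k. (C ** mpow B k) $ i $ j / fact k * of_real t ^ k)" by (simp add: *)
    also have "\<dots> = (\<Sum>k. \<Sum>l\<in>UNIV. C $ i $ l * (mpow B k $ l $ j / fact k * of_real t ^ k))"
      by (simp add: matrix_matrix_mult_def sum_distrib_right sum_distrib_left sum_divide_distrib mult_ac)
    also have "\<dots> = (\<Sum>l\<in>UNIV. (\<Sum>k. C $ i $ l * (mpow B k $ l $ j / fact k * of_real t ^ k)))"
      by (intro suminf_sum summable_mult summable_mexp)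
    also have "\<dots> = (C ** mexp B t) $ i $ j"
      unfolding mexp_def matrix_matrix_mult_def by (simp only: suminf_mult[OF summable_mexp] vec_lambda_beta)
    finally show ?thesis .
  qed
  then show ?thesis by (simp add: vec_eq_iff)
qed

lemma mexp_has_vector_derivative:
  fixes B :: "complex^'n^'n"
  shows "(mexp B has_vector_derivative B ** mexp B t) (at t within S)"
proof (rule has_vector_derivative_matrixI)
  fix i j
  let ?c = "\<lambda>k. mpow B k $ i $ j / fact k"
  have "((\<lambda>y. \<Sum>k. ?c k * y ^ k) has_field_derivative (\<Sum>k. diffs ?c k * of_real t ^ k)) (at (of_real t))"
    by (rule termdiffs_strong_converges_everywhere[OF summable_mexp])
  then have "((\<lambda>y. \<Sum>k. ?c k * of_real y ^ k) has_vector_derivative (\<Sum>k. diffs ?c k * of_real t ^ k)) (at t within S)"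
    by (rule has_vector_derivative_real_field)
  moreover have "diffs ?c k = (\<Sum>l\<in>UNIV. B $ i $ l * (mpow B k $ l $ j / fact k))" for k
  proof -
    have "diffs ?c k = mpow B (Suc k) $ i $ j / fact k"
      unfolding diffs_def fact_Suc by (simp add: divide_simps del: of_nat_Suc)
    also have "\<dots> = (\<Sum>l\<in>UNIV. B $ i $ l * (mpow B k $ l $ j / fact k))"
      by (simp add: mpow_Suc matrix_matrix_mult_def sum_divide_distrib del: of_nat_Suc)
    finally show ?thesis .
  qed
  moreover have "(\<Sum>k. (\<Sum>l\<in>UNIV. B $ i $ l * (mpow B k $ l $ j / fact k)) * of_real t ^ k) = (B ** mexp B t) $ i $ j"
  proof -
    have "(\<Sum>k. (\<Sum>l\<in>UNIV. B $ i $ l * (mpow B k $ l $ j / fact k)) * of_real t ^ k)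
       = (\<Sum>k. (\<Sum>l\<in>UNIV. B $ i $ l * (mpow B k $ l $ j / fact k * of_real t ^ k)))"
      by (simp only: sum_distrib_right mult.assoc)
    also have "\<dots> = (\<Sum>l\<in>UNIV. (\<Sum>k. B $ i $ l * (mpow B k $ l $ j / fact k * of_real t ^ k)))"
      by (intro suminf_sum summable_mult summable_mexp)
    also have "\<dots> = (B ** mexp B t) $ i $ j"
      unfolding mexp_def matrix_matrix_mult_def by (simp only: suminf_mult[OF summable_mexp] vec_lambda_beta)
    finally show ?thesis .
  qed
  ultimately show "((\<lambda>x. mexp B x $ i $ j) has_vector_derivative (B ** mexp B t) $ i $ j) (at t within S)"
    by (simp add: mexp_def)
qed

lemma mexp_minus_has_vector_derivative:
  "((\<lambda>t. mexp B (- t)) has_vector_derivative - (B ** mexp B (- t))) (at t within S)"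
  for B :: "complex^'n^'n"
proof -
  have "((\<lambda>t. mexp B (- t)) has_vector_derivative (-1) *\<^sub>R (B ** mexp B (- t))) (at t within S)"
    using vector_diff_chain_within[of uminus "-1" t S "mexp B" "B ** mexp B (- t)"]
      mexp_has_vector_derivative[of B "- t" "uminus ` S"]
      has_vector_derivative_minus[OF has_vector_derivative_id]
    by (simp add: o_def)
  then show ?thesis by simp
qed

text \<open>The product e^{-tB} W(t) has zero derivative. The group law and the rules for similar
  matrices, eigenspaces and projections below all come from this uniqueness, by exhibiting a second
  solution of the same equation instead of rearranging series.\<close>

lemma linear_flow_unique:
  fixes B :: "complex^'n^'n"
  assumes "\<And>t. (W has_vector_derivative B ** W t) (at t)"
  shows "mexp B (- t) ** W t = W 0"
proof -
  have "((\<lambda>t. mexp B (- t) ** W t) has_vector_derivative 0) (at t)" for t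
    by (rule has_vector_derivative_eq_rhs,
        rule has_vector_derivative_matrix_mult[OF mexp_minus_has_vector_derivative assms])
      (simp add: matrix_mul_assoc matrix_distribs mexp_commute)
  then obtain c where "\<And>t. mexp B (- t) ** W t = c"
    using has_vector_derivative_zero_constant[of UNIV "\<lambda>t. mexp B (- t) ** W t"] by auto
  then show ?thesis by (metis minus_zero mexp_0 matrix_mul_lid)
qed

lemma mexp_minus_mult: "mexp B (- t) ** mexp B t = mat 1" for B :: "complex^'n^'n"
  using linear_flow_unique[of "mexp B" B t] mexp_has_vector_derivative[of B] by simp

lemma mexp_mult_minus: "mexp B t ** mexp B (- t) = mat 1" for B :: "complex^'n^'n"
  using mexp_minus_mult[of B "- t"] by simp

lemma mexp_unique:
  fixes B :: "complex^'n^'n"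
  assumes "\<And>t. (W has_vector_derivative B ** W t) (at t)"
  shows "W t = mexp B t ** W 0"
  using linear_flow_unique[OF assms, of t] mexp_mult_minus[of B t]
  by (metis matrix_mul_assoc matrix_mul_lid)

lemma mexp_add: "mexp B (s + t) = mexp B s ** mexp B t" for B :: "complex^'n^'n"
proof -
  have "((\<lambda>s. mexp B (s + t)) has_vector_derivative B ** mexp B (s + t)) (at s)" for s
    using vector_diff_chain_at[of "\<lambda>s. s + t" 1 s "mexp B" "B ** mexp B (s + t)"]
      mexp_has_vector_derivative[of B "s + t"]
      has_vector_derivative_add[OF has_vector_derivative_id has_vector_derivative_const]
    by (fastforce simp: o_def)
  from mexp_unique[OF this, of s] show ?thesis by simp
qed

lemma mexp_uminus: "mexp (- B) t = mexp B (- t)" for B :: "complex^'n^'n"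
proof -
  have "((\<lambda>t. mexp B (- t)) has_vector_derivative (- B) ** mexp B (- t)) (at t)" for t
    using mexp_minus_has_vector_derivative[of B t UNIV] by (simp add: matrix_minus_left)
  from mexp_unique[OF this, of t] show ?thesis by simp
qed

lemma mexp_similar:
  fixes B S S' :: "complex^'n^'n"
  assumes "S' ** S = mat 1"
  shows "mexp (S' ** B ** S) t = S' ** mexp B t ** S"
proof -
  have "S ** S' = mat 1" using assms matrix_left_right_inverse by blast
  then have eq: "S' ** B ** S ** (S' ** mexp B t ** S) = S' ** (B ** mexp B t) ** S" for t
    by (metis matrix_mul_assoc matrix_mul_lid)
  have "((\<lambda>t. S' ** mexp B t ** S) has_vector_derivative S' ** B ** S ** (S' ** mexp B t ** S)) (at t)" for t
    unfolding eq
    by (rule has_vector_derivative_eq_rhs,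
        rule has_vector_derivative_matrix_mult[OF has_vector_derivative_matrix_mult[OF has_vector_derivative_const
          mexp_has_vector_derivative] has_vector_derivative_const]) simp
  from mexp_unique[OF this, of t] show ?thesis by (simp add: assms)
qed

lemma mexp_mult_eigen:
  fixes B Q :: "complex^'n^'n"
  assumes "B ** Q = mat \<mu> ** Q"
  shows "mexp B t ** Q = mat (exp (\<mu> * of_real t)) ** Q"
proof -
  define W where "W t = mat (exp (\<mu> * of_real t)) ** Q" for t :: real
  have "(W has_vector_derivative B ** W t) (at t)" for t
  proof (rule has_vector_derivative_matrixI)
    fix i j
    have "B ** W t = mat (exp (\<mu> * of_real t)) ** (mat \<mu> ** Q)"
      unfolding W_def assms[symmetric] by (simp add: matrix_mul_assoc mat_commute)
    then have "(B ** W t) $ i $ j = \<mu> * exp (\<mu> * of_real t) * Q $ i $ j" by simp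
    moreover have "((\<lambda>t. exp (\<mu> * of_real t) * Q $ i $ j) has_vector_derivative
        \<mu> * exp (\<mu> * of_real t) * Q $ i $ j) (at t)"
      by (rule has_vector_derivative_real_field[where f = "\<lambda>t. exp (\<mu> * t) * Q $ i $ j"])
        (auto intro!: derivative_eq_intros)
    ultimately show "((\<lambda>t. W t $ i $ j) has_vector_derivative (B ** W t) $ i $ j) (at t)"
      by (simp add: W_def)
  qed
  from mexp_unique[OF this, of t] show ?thesis by (simp add: W_def)
qed

text \<open>A flow that acts only on the range of \<open>Q\<close> is again a matrix exponential,
  namely that of \<open>B ** Q\<close>. Its determinant is therefore e^{t tr(BQ)}, which is the
  origin of the trace exponentials in the transitional Evans function.\<close>

lemma mexp_mult_projection:
  fixes B Q :: "complex^'n^'n"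
  assumes "B ** Q = Q ** B" "Q ** Q = Q"
  shows "mexp (B ** Q) t = mexp B t ** Q + (mat 1 - Q)"
proof -
  have eq: "B ** Q ** (mexp B t ** Q + (mat 1 - Q)) = (B ** mexp B t) ** Q" for t
  proof -
    have "B ** Q ** (mexp B t ** Q) = B ** (mexp B t ** Q) ** Q"
      by (metis assms(1) mexp_commute matrix_mul_assoc)
    also have "\<dots> = B ** mexp B t ** Q" by (metis assms(2) matrix_mul_assoc)
    moreover have "B ** Q ** (mat 1 - Q) = 0"
      by (simp add: matrix_distribs flip: matrix_mul_assoc) (simp add: assms)
    ultimately show ?thesis by (simp add: matrix_distribs)
  qed
  have "((\<lambda>t. mexp B t ** Q + (mat 1 - Q)) has_vector_derivative B ** Q ** (mexp B t ** Q + (mat 1 - Q))) (at t)" for t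
    unfolding eq
    by (rule has_vector_derivative_eq_rhs,
        rule has_vector_derivative_add[OF has_vector_derivative_matrix_mult[OF mexp_has_vector_derivative
          has_vector_derivative_const] has_vector_derivative_const]) simp
  from mexp_unique[OF this, of t] show ?thesis by simp
qed

section \<open>The formulas of Jacobi and Liouville\<close>

lemma det_has_vector_derivative_identity:
  fixes W :: "real \<Rightarrow> complex^'n^'n"
  assumes W: "(W has_vector_derivative D) (at t)" "W t = mat 1"
  shows "((\<lambda>x. det (W x)) has_vector_derivative trace D) (at t)"
proof -
  have Wi: "((\<lambda>x. W x $ i $ j) has_vector_derivative D $ i $ j) (at t)" for i j
    by (rule has_vector_derivative_entry[OF W(1)])
  have "((\<lambda>x. \<Prod>i\<in>UNIV. W x $ i $ p i) has_vector_derivative (if p = id then trace D else 0)) (at t)"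
    if p: "p permutes UNIV" for p
  proof -
    have "((\<lambda>x. \<Prod>i\<in>UNIV. W x $ i $ p i) has_vector_derivative
        (\<Sum>i\<in>UNIV. D $ i $ p i * (\<Prod>j\<in>UNIV - {i}. W t $ j $ p j))) (at t)"
      using has_derivative_prod[of UNIV "\<lambda>i x. W x $ i $ p i" "\<lambda>i y. y *\<^sub>R D $ i $ p i" t UNIV] Wi
      unfolding has_vector_derivative_def by (simp add: scaleR_sum_right)
    moreover have "(\<Sum>i\<in>UNIV. D $ i $ p i * (\<Prod>j\<in>UNIV - {i}. W t $ j $ p j)) = (if p = id then trace D else 0)"
    proof (cases "p = id")
      case True
      then show ?thesis by (simp add: W(2) trace_def mat_def)
    next
      case False
      \<comment> \<open>A permutation other than the identity moves two different indices,
        \<open>k\<close> and \<open>p k\<close>. At least one of them differs from \<open>i\<close>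
        and leaves an off-diagonal entry of the identity in the product.\<close>
      have "(\<Prod>j\<in>UNIV - {i}. W t $ j $ p j) = 0" for i
      proof -
        obtain k where k: "p k \<noteq> k" using False by (metis eq_id_iff)
        then have "p (p k) \<noteq> p k" using p by (metis permutes_inverses(2))
        with k obtain j where "j \<noteq> i" "p j \<noteq> j" by metis
        then show ?thesis by (intro prod_zero) (auto simp: W(2) mat_def intro!: bexI[of _ j])
      qed
      then show ?thesis using False by (simp del: prod_zero_iff)
    qed
    ultimately show ?thesis by simp
  qed
  then have "((\<lambda>x. det (W x)) has_vector_derivative
      (\<Sum>p | p permutes (UNIV :: 'n set). of_int (sign p) * (if p = id then trace D else 0))) (at t)"
    unfolding det_def
    by (intro has_vector_derivative_sum has_vector_derivative_mult_right) simp
  moreover have "(\<Sum>p | p permutes (UNIV :: 'n set). of_int (sign p) * (if p = id then trace D else 0)) = trace D"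
    by (subst sum.remove[where x = id]) (auto simp: finite_permutations permutes_id sign_id intro!: sum.neutral)
  ultimately show ?thesis by simp
qed

text \<open>Writing \<open>mexp B x\<close> as \<open>mexp B (x - t) ** mexp B t\<close> moves the
  differentiation to the identity, where the derivative of the determinant is the trace. Multiplying
  by the inverse scalar exponential then gives a constant.\<close>

lemma det_mexp:
  fixes B :: "complex^'n^'n"
  shows "det (mexp B t) = exp (trace B * of_real t)"
proof -
  have d: "((\<lambda>x. det (mexp B x)) has_vector_derivative trace B * det (mexp B t)) (at t)" for t
  proof -
    have "((\<lambda>h. det (mexp B h)) has_vector_derivative trace B) (at 0)"
      by (rule det_has_vector_derivative_identity)
        (use mexp_has_vector_derivative[of B 0 UNIV] in simp_all)
    then have "((\<lambda>x. det (mexp B (x - t))) has_vector_derivative trace B) (at t)"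
      using vector_diff_chain_at[of "\<lambda>x. x - t" 1 t "\<lambda>h. det (mexp B h)" "trace B"]
        has_vector_derivative_diff[OF has_vector_derivative_id has_vector_derivative_const]
      by (fastforce simp: o_def)
    then have "((\<lambda>x. det (mexp B (x - t)) * det (mexp B t)) has_vector_derivative trace B * det (mexp B t)) (at t)"
      by (rule has_vector_derivative_mult_left)
    then show ?thesis by (simp flip: det_mul mexp_add)
  qed
  have e: "((\<lambda>x. exp (- trace B * of_real x)) has_vector_derivative - trace B * exp (- trace B * of_real t)) (at t)" for t :: real
    by (rule has_vector_derivative_real_field[where f = "\<lambda>t. exp (- trace B * t)"])
      (auto intro!: derivative_eq_intros)
  have "((\<lambda>x. exp (- trace B * of_real x) * det (mexp B x)) has_vector_derivative 0) (at t)" for t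
    by (rule has_vector_derivative_eq_rhs, rule has_vector_derivative_mult[OF e d]) simp
  then obtain c where c: "\<And>t. exp (- trace B * of_real t) * det (mexp B t) = c"
    using has_vector_derivative_zero_constant[of UNIV "\<lambda>x. exp (- trace B * of_real x) * det (mexp B x)"] by auto
  from c[of 0] c[of t] have "exp (- trace B * of_real t) * det (mexp B t) = 1" by simp
  then have "exp (trace B * of_real t) * exp (- trace B * of_real t) * det (mexp B t) = exp (trace B * of_real t)"
    by (simp add: mult.assoc)
  then show ?thesis by (simp flip: exp_add)
qed

section \<open>Conjugation to the constant-coefficient system\<close>

text \<open>Variation of constants in differential form: for fixed x, g(s) = e^{a (x - s)} v(s) runs
  from 0 to v(x) and has derivative e^{a (x - s)} f(s), so a mean value inequality replaces the
  integral.\<close>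

lemma scalar_ode_forward_bound:
  fixes v f :: "real \<Rightarrow> complex"
  assumes v: "\<And>x. x \<in> {0..L} \<Longrightarrow> (v has_vector_derivative a * v x + f x) (at x within {0..L})"
    and f: "\<And>x. x \<in> {0..L} \<Longrightarrow> norm (f x) \<le> F"
    and a: "Re a \<le> - \<kappa>" "\<kappa> > 0" and v0: "v 0 = 0" and x: "x \<in> {0..L}"
  shows "norm (v x) \<le> F / \<kappa>"
proof -
  have F: "F \<ge> 0" using f[OF x] norm_ge_zero order_trans by blast
  show ?thesis
  proof (cases "x = 0")
    case True then show ?thesis using v0 F a by simp
  next
    case False
    then have x0: "0 < x" "x \<le> L" using x by auto
    define g where "g s = exp (a * of_real (x - s)) * v s" for s
    \<comment> \<open>An antiderivative of F e^{Re a (x - s)}, the bound for the derivative of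
      \<open>g\<close>. Its increase over the interval is at most F / (- Re a), however large x
      is.\<close>
    define \<phi> where "\<phi> s = F / (- Re a) * exp (Re a * (x - s))" for s
    have g: "(g has_vector_derivative exp (a * of_real (x - s)) * f s) (at s within {0..L})"
      if "s \<in> {0..L}" for s
    proof -
      have "((\<lambda>s. exp (a * of_real (x - s))) has_vector_derivative - a * exp (a * of_real (x - s))) (at s within {0..L})"
      proof -
        have "((\<lambda>s. exp (a * (of_real x - s))) has_field_derivative - a * exp (a * of_real (x - s))) (at (of_real s))"
          by (auto intro!: derivative_eq_intros)
        from has_vector_derivative_real_field[OF this] show ?thesis by simp
      qed
      from has_vector_derivative_mult[OF this v[OF that]] show ?thesis
        unfolding g_def by (rule has_vector_derivative_eq_rhs) (simp add: algebra_simps)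
    qed
    have cg: "continuous_on {0..x} g"
    proof (rule continuous_on_vector_derivative)
      show "(g has_vector_derivative exp (a * of_real (x - s)) * f s) (at s within {0..x})" if "s \<in> {0..x}" for s
        using that x0 by (intro has_vector_derivative_within_subset[OF g]) auto
    qed
    have p: "(\<phi> has_vector_derivative F * exp (Re a * (x - s))) (at s)" for s
      unfolding \<phi>_def has_real_derivative_iff_has_vector_derivative[symmetric]
      using a by (auto intro!: derivative_eq_intros simp: field_simps)
    have "norm (g x - g 0) \<le> \<phi> x - \<phi> 0"
    proof (rule differentiable_bound_general[OF x0(1) cg])
      show "continuous_on {0..x} \<phi>"
        by (intro continuous_on_vector_derivative[where f' = "\<lambda>s. F * exp (Re a * (x - s))"])
          (auto intro: has_vector_derivative_at_within p)
      show "(g has_vector_derivative exp (a * of_real (x - s)) * f s) (at s)" if "0 < s" "s < x" for s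
        using g[of s] that x0 at_within_Icc_at[of 0 s L] by auto
      show "norm (exp (a * of_real (x - s)) * f s) \<le> F * exp (Re a * (x - s))" if "0 < s" "s < x" for s
        using f[of s] that x0 by (simp add: norm_mult mult.commute[of F])
    qed (rule p)
    then have "norm (v x) \<le> F / (- Re a) - F / (- Re a) * exp (Re a * x)"
      by (simp add: g_def \<phi>_def v0)
    also have "\<dots> \<le> F / (- Re a)" using F a by (simp add: divide_nonneg_neg divide_nonpos_neg)
    also have "\<dots> \<le> F / \<kappa>" using F a by (intro frac_le) auto
    finally show ?thesis .
  qed
qed

text \<open>The reflection s -> L - s changes the sign of the exponent, so growth controlled from
  the right end becomes decay controlled from the left end.\<close>

lemma scalar_ode_backward_bound:
  fixes v f :: "real \<Rightarrow> complex"
  assumes v: "\<And>x. x \<in> {0..L} \<Longrightarrow> (v has_vector_derivative a * v x + f x) (at x within {0..L})"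
    and f: "\<And>x. x \<in> {0..L} \<Longrightarrow> norm (f x) \<le> F"
    and a: "Re a \<ge> \<kappa>" "\<kappa> > 0" and vL: "v L = 0" and x: "x \<in> {0..L}"
  shows "norm (v x) \<le> F / \<kappa>"
proof -
  have im: "(\<lambda>s. L - s) ` {0..L} = {0..L}" by (auto simp: image_iff intro!: bexI[of _ "L - _"])
  have "((\<lambda>s. v (L - s)) has_vector_derivative (- a) * v (L - s) + (- f (L - s))) (at s within {0..L})"
    if "s \<in> {0..L}" for s
  proof -
    have "((\<lambda>s. L - s) has_vector_derivative 0 - 1) (at s within {0..L})"
      by (intro has_vector_derivative_diff has_vector_derivative_const has_vector_derivative_id)
    from vector_diff_chain_within[OF this, of v "a * v (L - s) + f (L - s)"] v[of "L - s"] that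
    show ?thesis by (simp add: im o_def)
  qed
  from scalar_ode_forward_bound[OF this, of F \<kappa> "L - x"] f a vL x show ?thesis by simp
qed

text \<open>The weight \<open>e\<^sup>\<kappa>\<^sup>x\<close> has turned the exponents \<open>d i - d j\<close> of the entries into \<open>\<kappa> + d i - d j\<close>, whose
  real parts stay away from \<open>0\<close>. Entries with growing exponent are controlled from the right end point, the
  others from the left one.\<close>

lemma matrix_ode_apriori_bound:
  fixes B :: "complex^'n^'n" and V \<Delta> F :: "real \<Rightarrow> complex^'n^'n"
  assumes \<kappa>: "\<kappa> > 0" and L: "L \<ge> 0"
    and gap: "\<And>i j. Re (d i - d j) \<ge> 0 \<or> Re (d i - d j) \<le> - 2 * \<kappa>"
    and B: "\<And>i j. norm (B $ i $ j - (if i = j then d i else 0)) \<le> \<delta>"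
    and \<Delta>: "\<And>x i j. x \<in> {0..L} \<Longrightarrow> norm (\<Delta> x $ i $ j) \<le> h"
    and F: "\<And>x i j. x \<in> {0..L} \<Longrightarrow> norm (F x $ i $ j) \<le> H"
    and small: "of_nat CARD('n) * (2 * \<delta> + h) \<le> \<kappa> / 2"
    and V: "\<And>x. x \<in> {0..L} \<Longrightarrow> (V has_vector_derivative
      (\<kappa> *\<^sub>R V x + (B ** V x - V x ** B) + \<Delta> x ** V x + F x)) (at x within {0..L})"
    and bc: "\<And>i j. Re (d i - d j) \<ge> 0 \<Longrightarrow> V L $ i $ j = 0"
      "\<And>i j. \<not> Re (d i - d j) \<ge> 0 \<Longrightarrow> V 0 $ i $ j = 0"
    and x: "x \<in> {0..L}"
  shows "norm (V x $ i $ j) \<le> 2 * H / \<kappa>"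
proof -
  \<comment> \<open>All entries at all points share one supremum \<open>m\<close>. It is finite
    since \<open>V\<close> is continuous on a compact interval, and this finiteness is what allows
    it to be absorbed at the end.\<close>
  define S where "S = (\<lambda>(x, i, j). norm (V x $ i $ j)) ` ({0..L} \<times> UNIV \<times> UNIV)"
  define m where "m = Sup S"
  have cont: "continuous_on {0..L} V" by (rule continuous_on_vector_derivative[OF V])
  have "compact (V ` {0..L})" by (intro compact_continuous_image cont) simp
  then obtain b where b: "\<And>x. x \<in> {0..L} \<Longrightarrow> norm (V x) \<le> b"
    using compact_imp_bounded bounded_iff by (metis imageI)
  have bdd: "bdd_above S"
    unfolding S_def by (rule bdd_aboveI[of _ b]) (auto intro: order_trans[OF norm_entry_le b])
  have ne: "S \<noteq> {}" using L by (auto simp: S_def)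
  have m: "norm (V x $ i $ j) \<le> m" if "x \<in> {0..L}" for x i j
    unfolding m_def by (rule cSup_upper[OF _ bdd]) (use that in \<open>auto simp: S_def intro!: image_eqI[of _ _ "(x, i, j)"]\<close>)
  have m0: "m \<ge> 0" using m[OF x] norm_ge_zero order_trans by blast
  define D where "D = (\<chi> i j. if i = j then d i else 0)"
  define N where "N = B - D"
  have N: "norm (N $ i $ j) \<le> \<delta>" for i j using B[of i j] by (simp add: N_def D_def)
  \<comment> \<open>The commutator with the diagonal part acts on each entry separately, so the
    system decouples into scalar equations with exponents \<kappa> + d_i - d_j; the remainder
    \<open>N\<close> and the perturbation join the forcing \<open>G\<close>.\<close>
  have D: "(D ** M - M ** D) $ i $ j = (d i - d j) * M $ i $ j" for M :: "complex^'n^'n" and i j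
    by (simp add: D_def matrix_matrix_mult_def if_distrib if_distribR algebra_simps cong: if_cong)
  have prod: "norm ((M ** M') $ i $ j) \<le> of_nat CARD('n) * (p * q)"
    if "\<And>i j. norm (M $ i $ j) \<le> p" "\<And>i j. norm (M' $ i $ j) \<le> q" for M M' :: "complex^'n^'n" and i j p q
  proof -
    have p: "p \<ge> 0" using that(1) norm_ge_zero order_trans by blast
    have "norm ((M ** M') $ i $ j) \<le> (\<Sum>k\<in>UNIV. norm (M $ i $ k * M' $ k $ j))"
      by (simp add: matrix_matrix_mult_def norm_sum)
    also have "\<dots> \<le> (\<Sum>k::'n\<in>UNIV. p * q)"
      by (intro sum_mono) (auto simp: norm_mult p intro!: mult_mono that)
    finally show ?thesis by simp
  qed
  define G where "G x = (N ** V x - V x ** N) + \<Delta> x ** V x + F x" for x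
  have G: "norm (G x $ i $ j) \<le> \<kappa> / 2 * m + H" if x: "x \<in> {0..L}" for x i j
  proof -
    have "norm (G x $ i $ j) \<le> norm ((N ** V x) $ i $ j) + norm ((V x ** N) $ i $ j)
        + norm ((\<Delta> x ** V x) $ i $ j) + norm (F x $ i $ j)"
      unfolding G_def by (smt (verit) norm_triangle_ineq norm_triangle_ineq4 vector_add_component vector_minus_component)
    also have "\<dots> \<le> of_nat CARD('n) * (\<delta> * m) + of_nat CARD('n) * (m * \<delta>) + of_nat CARD('n) * (h * m) + H"
      by (intro add_mono prod N m[OF x] \<Delta>[OF x] F[OF x])
    also have "\<dots> = of_nat CARD('n) * (2 * \<delta> + h) * m + H" by (simp add: algebra_simps)
    also have "\<dots> \<le> \<kappa> / 2 * m + H" by (intro add_right_mono mult_right_mono small m0)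
    finally show ?thesis .
  qed
  have Vij: "((\<lambda>x. V x $ i $ j) has_vector_derivative (of_real \<kappa> + (d i - d j)) * V x $ i $ j + G x $ i $ j) (at x within {0..L})"
    if "x \<in> {0..L}" for x i j
  proof -
    have "B ** V x - V x ** B = (D ** V x - V x ** D) + (N ** V x - V x ** N)"
      by (simp add: N_def matrix_distribs)
    then have "(\<kappa> *\<^sub>R V x + (B ** V x - V x ** B) + \<Delta> x ** V x + F x) $ i $ j
       = \<kappa> *\<^sub>R V x $ i $ j + (D ** V x - V x ** D) $ i $ j + G x $ i $ j"
      by (simp add: G_def)
    also have "\<dots> = (of_real \<kappa> + (d i - d j)) * V x $ i $ j + G x $ i $ j"
      by (simp only: D) (simp add: scaleR_conv_of_real algebra_simps)
    finally show ?thesis using has_vector_derivative_entry[OF V[OF that], of i j] by simp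
  qed
  have step: "norm (V x $ i $ j) \<le> m / 2 + H / \<kappa>" if x: "x \<in> {0..L}" for x i j
  proof -
    have "norm (V x $ i $ j) \<le> (\<kappa> / 2 * m + H) / \<kappa>"
    proof (cases "Re (d i - d j) \<ge> 0")
      case True
      show ?thesis
        by (rule scalar_ode_backward_bound[OF Vij G _ \<kappa> _ x]) (use True bc in auto)
    next
      case False
      then have "Re (d i - d j) \<le> - 2 * \<kappa>" using gap by blast
      then show ?thesis
        by (intro scalar_ode_forward_bound[OF Vij G _ \<kappa> _ x]) (use False bc in auto)
    qed
    then show ?thesis using \<kappa> by (simp add: field_simps)
  qed
  \<comment> \<open>The smallness condition limits the feedback of \<open>m\<close> through the
    forcing to \<kappa>/2 times \<open>m\<close>; division by the gap \<kappa> leaves one half,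
    which is absorbed.\<close>
  have "m \<le> m / 2 + H / \<kappa>"
    unfolding m_def by (rule cSup_least[OF ne]) (use step in \<open>auto simp: S_def m_def\<close>)
  then have "m \<le> 2 * H / \<kappa>" by simp
  with m[OF x, of i j] show ?thesis by linarith
qed

text \<open>The candidates for the conjugation are \<open>\<Phi> x ** T ** mexp B (- x)\<close>, so
  the only unknown is the constant matrix \<open>T\<close>. The two-point boundary conditions are
  linear in \<open>T\<close>, hence solvability is a question of finite-dimensional linear algebra
  and uniqueness suffices.\<close>

lemma conjugation_near_diagonal:
  fixes B :: "complex^'n^'n" and \<Phi> \<Delta> :: "real \<Rightarrow> complex^'n^'n"
  assumes \<kappa>: "\<kappa> > 0" and L: "L \<ge> 0"
    and gap: "\<And>i j. Re (d i - d j) \<ge> 0 \<or> Re (d i - d j) \<le> - 2 * \<kappa>"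
    and B: "\<And>i j. norm (B $ i $ j - (if i = j then d i else 0)) \<le> \<delta>"
    and \<Delta>: "\<And>x i j. x \<in> {0..L} \<Longrightarrow> norm (\<Delta> x $ i $ j) \<le> h"
    and small: "of_nat CARD('n) * (2 * \<delta> + h) \<le> \<kappa> / 2"
    and \<Phi>: "\<And>x. x \<in> {0..L} \<Longrightarrow> (\<Phi> has_vector_derivative (B + \<Delta> x) ** \<Phi> x) (at x within {0..L})"
      "\<Phi> 0 = mat 1"
  obtains T0 TL where "\<Phi> L ** T0 = TL ** mexp B L"
    "\<And>i j. norm ((T0 - mat 1) $ i $ j) \<le> 2 * (exp (\<kappa> * L) * h) / \<kappa>"
    "\<And>i j. norm ((TL - mat 1) $ i $ j) \<le> 2 * (exp (\<kappa> * L) * h) / \<kappa>"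
proof -
  \<comment> \<open>With \<open>s = 1\<close> this is the deviation of the conjugation from the
    identity, with forcing \<open>\<Delta>\<close>; with \<open>s = 0\<close> it is the homogeneous
    problem. Treating both at once lets one a priori bound give uniqueness and the estimate.\<close>
  define Y where "Y T s x = \<Phi> x ** T ** mexp B (- x) - mat s" for T :: "complex^'n^'n" and s x
  define V where "V T s x = exp (\<kappa> * x) *\<^sub>R Y T s x" for T :: "complex^'n^'n" and s x
  define F where "F s x = exp (\<kappa> * x) *\<^sub>R (mat s ** \<Delta> x)" for s x
  have V: "(V T s has_vector_derivative
      (\<kappa> *\<^sub>R V T s x + (B ** V T s x - V T s x ** B) + \<Delta> x ** V T s x + F s x)) (at x within {0..L})"
    if x: "x \<in> {0..L}" for T s x
  proof -
    let ?W = "\<Phi> x ** T ** mexp B (- x)"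
    have e: "((\<lambda>x. exp (\<kappa> * x)) has_field_derivative \<kappa> * exp (\<kappa> * x)) (at x within {0..L})"
      by (auto intro!: derivative_eq_intros)
    have 1: "((\<lambda>x. \<Phi> x ** T) has_vector_derivative (B + \<Delta> x) ** \<Phi> x ** T) (at x within {0..L})"
      using has_vector_derivative_matrix_mult[OF \<Phi>(1)[OF x] has_vector_derivative_const[of T]] by simp
    have 2: "((\<lambda>x. \<Phi> x ** T ** mexp B (- x)) has_vector_derivative
        (B + \<Delta> x) ** ?W - ?W ** B) (at x within {0..L})"
      by (rule has_vector_derivative_eq_rhs[OF has_vector_derivative_matrix_mult[OF 1 mexp_minus_has_vector_derivative]])
        (simp add: matrix_minus_right mexp_commute flip: matrix_mul_assoc)
    have Wd: "(B + \<Delta> x) ** ?W - ?W ** B = (B ** Y T s x - Y T s x ** B) + \<Delta> x ** Y T s x + mat s ** \<Delta> x"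
      by (simp add: Y_def matrix_distribs mat_commute)
    have 3: "(Y T s has_vector_derivative
        (B ** Y T s x - Y T s x ** B) + \<Delta> x ** Y T s x + mat s ** \<Delta> x) (at x within {0..L})"
      using has_vector_derivative_diff[OF 2 has_vector_derivative_const[of "mat s"]]
      unfolding Y_def[of T s, abs_def] Wd[unfolded Y_def] by simp
    show ?thesis unfolding V_def[of T s, abs_def]
      by (rule has_vector_derivative_eq_rhs[OF has_vector_derivative_scaleR[OF e 3]])
        (simp add: V_def F_def matrix_scalar_ac scalar_matrix_assoc[symmetric] scaleR_right_distrib scaleR_right_diff_distrib)
  qed
  have F: "norm (F s x $ i $ j) \<le> exp (\<kappa> * L) * (norm s * h)" if "x \<in> {0..L}" for s x i j
    using that \<kappa> \<Delta>[OF that, of i j] unfolding F_def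
    by (auto simp: norm_mult intro!: mult_mono mult_left_mono)
  \<comment> \<open>\<open>Lop\<close> evaluates the boundary conditions; by the a priori bound it is injective, hence onto.\<close>
  define Lop where "Lop T = (\<chi> i j. if Re (d i - d j) \<ge> 0 then (\<Phi> L ** T ** mexp B (- L)) $ i $ j else T $ i $ j)"
    for T
  have bnd: "norm (V T s x $ i $ j) \<le> 2 * (exp (\<kappa> * L) * (norm s * h)) / \<kappa>"
    if T: "Lop T = mat s" and x: "x \<in> {0..L}" for T s x i j
  proof (rule matrix_ode_apriori_bound[OF \<kappa> L gap B \<Delta> F small V _ _ x])
    fix i j
    show "V T s L $ i $ j = 0" if "Re (d i - d j) \<ge> 0"
      using arg_cong[OF T, of "\<lambda>M. M $ i $ j"] that by (simp add: Lop_def V_def Y_def)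
    show "V T s 0 $ i $ j = 0" if "\<not> Re (d i - d j) \<ge> 0"
      using arg_cong[OF T, of "\<lambda>M. M $ i $ j"] that by (simp add: Lop_def V_def Y_def \<Phi>)
  qed
  have lin: "linear Lop"
    by (rule linearI) (auto simp: Lop_def vec_eq_iff matrix_distribs matrix_scalar_ac scalar_matrix_assoc[symmetric])
  have "inj Lop"
    unfolding linear_injective_0[OF lin]
  proof (intro allI impI)
    fix T assume "Lop T = 0"
    then have "norm (V T 0 0 $ i $ j) \<le> 0" for i j using bnd[of T 0 0 i j] L by simp
    then show "T = 0" by (simp add: V_def Y_def \<Phi> vec_eq_iff)
  qed
  then have "surj Lop" by (rule linear_injective_imp_surjective[OF lin]) (rule refl)
  then obtain T where T: "Lop T = mat 1" by (metis surjD)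
  show thesis
  proof (rule that)
    show "\<Phi> L ** T = \<Phi> L ** T ** mexp B (- L) ** mexp B L"
      by (simp add: mexp_minus_mult flip: matrix_mul_assoc)
    show "norm ((T - mat 1) $ i $ j) \<le> 2 * (exp (\<kappa> * L) * h) / \<kappa>" for i j
      using bnd[OF T, of 0 i j] L by (simp add: V_def Y_def \<Phi>)
    show "norm ((\<Phi> L ** T ** mexp B (- L) - mat 1) $ i $ j) \<le> 2 * (exp (\<kappa> * L) * h) / \<kappa>" for i j
    proof -
      \<comment> \<open>At the right end the weight e^{\<kappa> L} is at least 1, so it may be
        dropped.\<close>
      have "norm (Y T 1 L $ i $ j) \<le> exp (\<kappa> * L) * norm (Y T 1 L $ i $ j)"
        using L \<kappa> by (simp add: mult_le_cancel_right1)
      also have "\<dots> \<le> 2 * (exp (\<kappa> * L) * h) / \<kappa>" using bnd[OF T, of L i j] L by (simp add: V_def)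
      finally show ?thesis by (simp add: Y_def)
    qed
  qed
qed

text \<open>From Q(y) - Q(x) = -Q(y) (P(y) - P(x)) Q(x) for the inverse Q. The uniform bound
  \<open>K\<close> gives continuity of Q first; the difference quotient then splits into the
  remainder of P, sandwiched between bounded factors, and a term with the factor Q(y) -
  Q(x).\<close>

lemma has_vector_derivative_matrix_inv:
  fixes P :: "real \<Rightarrow> complex^'n^'n"
  assumes P: "(P has_vector_derivative D) (at x within S)" and x: "x \<in> S"
    and inv: "\<And>y. y \<in> S \<Longrightarrow> invertible (P y)" and K: "\<And>y. y \<in> S \<Longrightarrow> norm (matrix_inv (P y)) \<le> K"
  shows "((\<lambda>y. matrix_inv (P y)) has_vector_derivative - (matrix_inv (P x) ** D ** matrix_inv (P x))) (at x within S)"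
proof -
  define Q where "Q y = matrix_inv (P y)" for y
  define R where "R y = (1 / norm (y - x)) *\<^sub>R (P y - (P x + (y - x) *\<^sub>R D))" for y
  have QP: "Q y ** P y = mat 1" "P y ** Q y = mat 1" if "y \<in> S" for y
    using invertible_matrix_inv[OF inv[OF that]] by (simp_all add: Q_def)
  have R: "(R \<longlongrightarrow> 0) (at x within S)"
    using P by (simp add: has_vector_derivative_def has_derivative_within R_def[abs_def])
  have diff: "Q y - Q x = - (Q y ** (P y - P x) ** Q x)" if "y \<in> S" for y
    using QP[OF that] QP[OF x] by (simp add: matrix_distribs flip: matrix_mul_assoc)
  have K0: "K \<ge> 0" using K[OF x] norm_ge_zero order_trans by blast
  have est: "norm ((1 / norm (y - x)) *\<^sub>R (Q y - (Q x + (y - x) *\<^sub>R - (Q x ** D ** Q x))))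
      \<le> K * norm (R y) * norm (Q x) + (K * norm (P y - P x) * norm (Q x)) * norm (D ** Q x)"
    if y: "y \<in> S" "y \<noteq> x" for y
  proof -
    have "Q y - (Q x + (y - x) *\<^sub>R - (Q x ** D ** Q x))
        = - (Q y ** (P y - P x - (y - x) *\<^sub>R D) ** Q x) - (y - x) *\<^sub>R ((Q y - Q x) ** D ** Q x)"
      using diff[OF y(1)]
      by (simp add: matrix_distribs matrix_scalar_ac scalar_matrix_assoc[symmetric] algebra_simps)
    also have "(1 / norm (y - x)) *\<^sub>R \<dots>
       = - (Q y ** R y ** Q x) - ((y - x) / norm (y - x)) *\<^sub>R ((Q y - Q x) ** (D ** Q x))"
    proof -
      have "Q y ** R y ** Q x = (1 / norm (y - x)) *\<^sub>R (Q y ** (P y - P x - (y - x) *\<^sub>R D) ** Q x)"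
        by (simp add: R_def matrix_scalar_ac scalar_matrix_assoc[symmetric] diff_diff_eq del: real_norm_def)
      then show ?thesis by (simp add: scaleR_right_diff_distrib matrix_mul_assoc)
    qed
    finally have "norm ((1 / norm (y - x)) *\<^sub>R (Q y - (Q x + (y - x) *\<^sub>R - (Q x ** D ** Q x))))
      \<le> norm (Q y ** R y ** Q x) + norm (((y - x) / norm (y - x)) *\<^sub>R ((Q y - Q x) ** (D ** Q x)))"
      by (metis norm_minus_cancel norm_triangle_ineq4)
    also have "norm (((y - x) / norm (y - x)) *\<^sub>R ((Q y - Q x) ** (D ** Q x))) = norm ((Q y - Q x) ** (D ** Q x))"
      using y by simp
    also have "norm (Q y ** R y ** Q x) \<le> K * norm (R y) * norm (Q x)"
      by (rule order_trans[OF norm_mult3_le]) (use K[OF y(1)] in \<open>auto simp: Q_def intro!: mult_right_mono\<close>)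
    also have "norm ((Q y - Q x) ** (D ** Q x)) \<le> norm (Q y - Q x) * norm (D ** Q x)"
      by (rule norm_matrix_mult_le)
    also have "\<dots> \<le> (K * norm (P y - P x) * norm (Q x)) * norm (D ** Q x)"
    proof (rule mult_right_mono)
      have "norm (Q y - Q x) = norm (Q y ** (P y - P x) ** Q x)" by (simp add: diff[OF y(1)])
      also have "\<dots> \<le> norm (Q y) * norm (P y - P x) * norm (Q x)" by (rule norm_mult3_le)
      also have "\<dots> \<le> K * norm (P y - P x) * norm (Q x)"
        using K[OF y(1)] by (auto simp: Q_def intro!: mult_right_mono)
      finally show "norm (Q y - Q x) \<le> K * norm (P y - P x) * norm (Q x)" .
    qed simp
    finally show ?thesis by simp
  qed
  have "((\<lambda>y. P y - P x) \<longlongrightarrow> 0) (at x within S)"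
    using has_vector_derivative_continuous[OF P] by (simp add: continuous_within LIM_zero)
  then have "((\<lambda>y. K * norm (R y) * norm (Q x) + (K * norm (P y - P x) * norm (Q x)) * norm (D ** Q x)) \<longlongrightarrow>
      K * 0 * norm (Q x) + (K * 0 * norm (Q x)) * norm (D ** Q x)) (at x within S)"
    by (intro tendsto_intros tendsto_norm_zero R)
  then have lim: "((\<lambda>y. K * norm (R y) * norm (Q x) + (K * norm (P y - P x) * norm (Q x)) * norm (D ** Q x)) \<longlongrightarrow> 0) (at x within S)"
    by simp
  have "\<forall>\<^sub>F y in at x within S. norm ((1 / norm (y - x)) *\<^sub>R (Q y - (Q x + (y - x) *\<^sub>R - (Q x ** D ** Q x))))
      \<le> K * norm (R y) * norm (Q x) + (K * norm (P y - P x) * norm (Q x)) * norm (D ** Q x)"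
    unfolding eventually_at_filter using est by (intro always_eventually) blast
  then have "((\<lambda>y. (1 / norm (y - x)) *\<^sub>R (Q y - (Q x + (y - x) *\<^sub>R - (Q x ** D ** Q x)))) \<longlongrightarrow> 0) (at x within S)"
    by (rule Lim_null_comparison[OF _ lim])
  then show ?thesis
    unfolding has_vector_derivative_def has_derivative_within Q_def
    by (intro conjI bounded_linear_scaleR_left)
qed

text \<open>The matrix P^{-1} \<Psi> P(0) solves the system with coefficient B + P^{-1} (A - A0) P,
  to which the second conjugation applies in the coordinates \<open>S\<close>. The result is
  asymmetric: \<open>M\<close> is close to P(0), which need not be near the identity, whereas
  \<open>G\<close> involves P(L)^{-1} and is near the identity because the conjugator has converged
  at L.\<close>

lemma conjugation_half_line:
  fixes B S S' :: "complex^'n^'n" and P A0 A \<Psi> :: "real \<Rightarrow> complex^'n^'n" and d :: "'n \<Rightarrow> complex"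
  assumes SS: "S' ** S = mat 1" and c: "norm S * norm S' \<le> c"
    and \<kappa>: "\<kappa> > 0" and L: "L \<ge> 0"
    and gap: "\<And>i j. Re (d i - d j) \<ge> 0 \<or> Re (d i - d j) \<le> - 2 * \<kappa>"
    and B: "\<And>i j. norm ((S' ** B ** S) $ i $ j - (if i = j then d i else 0)) \<le> \<delta>"
    and P: "\<And>x. x \<in> {0..L} \<Longrightarrow> (P has_vector_derivative A0 x ** P x - P x ** B) (at x within {0..L})"
    and K: "\<And>x. x \<in> {0..L} \<Longrightarrow> norm (P x) \<le> K \<and> invertible (P x) \<and> norm (matrix_inv (P x)) \<le> K"
    and p: "norm (P L - mat 1) \<le> p"
    and A: "\<And>x. x \<in> {0..L} \<Longrightarrow> norm (A x - A0 x) \<le> h"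
    and \<Psi>: "\<And>x. x \<in> {0..L} \<Longrightarrow> (\<Psi> has_vector_derivative A x ** \<Psi> x) (at x within {0..L})" "\<Psi> 0 = mat 1"
    and small: "of_nat CARD('n) * (2 * \<delta> + c * K\<^sup>2 * h) \<le> \<kappa> / 2"
    and \<tau>: "c * (of_nat (CARD('n) * CARD('n)) * (2 * (exp (\<kappa> * L) * (c * K\<^sup>2 * h)) / \<kappa>)) \<le> \<tau>" "\<tau> \<le> 1/2"
  obtains M G where "matrix_inv (\<Psi> L) = M ** mexp B (- L) ** G"
    "norm (M - P 0) \<le> K * \<tau>" "norm (G - mat 1) \<le> K * (2 * \<tau> + p)"
proof -
  have SS': "S ** S' = mat 1" using SS matrix_left_right_inverse by blast
  have L0: "0 \<in> {0..L}" "L \<in> {0..L}" using L by auto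
  have K0: "K \<ge> 0" using K[OF L0(1)] norm_ge_zero order_trans by blast
  have c0: "c \<ge> 0" by (rule order_trans[OF mult_nonneg_nonneg[OF norm_ge_zero norm_ge_zero] c])
  define Q where "Q x = matrix_inv (P x)" for x
  have QP: "Q x ** P x = mat 1" "P x ** Q x = mat 1" if "x \<in> {0..L}" for x
    using invertible_matrix_inv K[OF that] by (auto simp: Q_def)
  define \<Phi> where "\<Phi> x = Q x ** \<Psi> x ** P 0" for x
  define \<Delta> where "\<Delta> x = Q x ** (A x - A0 x) ** P x" for x
  have \<Phi>: "(\<Phi> has_vector_derivative (B + \<Delta> x) ** \<Phi> x) (at x within {0..L})" if x: "x \<in> {0..L}" for x
  proof -
    have "(Q has_vector_derivative - (Q x ** (A0 x ** P x - P x ** B) ** Q x)) (at x within {0..L})"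
      unfolding Q_def[abs_def]
      by (rule has_vector_derivative_matrix_inv[OF P[OF x] x, where K = K]) (use K in auto)
    also have "- (Q x ** (A0 x ** P x - P x ** B) ** Q x) = B ** Q x - Q x ** A0 x"
      using QP[OF x] by (simp add: matrix_distribs matrix_mul_assoc) (simp flip: matrix_mul_assoc)
    finally have Q': "(Q has_vector_derivative B ** Q x - Q x ** A0 x) (at x within {0..L})" .
    have "(\<Phi> has_vector_derivative (Q x ** (A x ** \<Psi> x) + (B ** Q x - Q x ** A0 x) ** \<Psi> x) ** P 0) (at x within {0..L})"
      unfolding \<Phi>_def[abs_def]
      using has_vector_derivative_matrix_mult[OF has_vector_derivative_matrix_mult[OF Q' \<Psi>(1)[OF x]]
          has_vector_derivative_const[of "P 0"]] by simp
    moreover have "(Q x ** (A x ** \<Psi> x) + (B ** Q x - Q x ** A0 x) ** \<Psi> x) ** P 0 = (B + \<Delta> x) ** \<Phi> x"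
    proof -
      have "\<Delta> x ** \<Phi> x = Q x ** (A x - A0 x) ** (P x ** Q x) ** \<Psi> x ** P 0"
        by (simp add: \<Delta>_def \<Phi>_def matrix_mul_assoc)
      then show ?thesis by (simp add: QP[OF x] \<Phi>_def matrix_distribs matrix_mul_assoc)
    qed
    ultimately show ?thesis by simp
  qed
  have \<Phi>0: "\<Phi> 0 = mat 1" using QP[OF L0(1)] by (simp add: \<Phi>_def \<Psi>)
  have \<Delta>: "norm (\<Delta> x) \<le> K\<^sup>2 * h" if x: "x \<in> {0..L}" for x
  proof -
    have "norm (\<Delta> x) \<le> norm (Q x) * norm (A x - A0 x) * norm (P x)"
      unfolding \<Delta>_def by (rule norm_mult3_le)
    also have "\<dots> \<le> K * h * K"
      using K[OF x] A[OF x] K0 order_trans[OF norm_ge_zero A[OF x]] by (intro mult_mono) (auto simp: Q_def)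
    finally show ?thesis by (simp add: power2_eq_square mult_ac)
  qed
  have conj_norm: "norm (S' ** M ** S) \<le> c * norm M" "norm (S ** M ** S') \<le> c * norm M" for M
    by (rule order_trans[OF norm_mult3_le], use mult_right_mono[OF c, of "norm M"] in \<open>simp add: mult_ac\<close>)+
  obtain T0 TL where T: "S' ** \<Phi> L ** S ** T0 = TL ** mexp (S' ** B ** S) L"
    "\<And>i j. norm ((T0 - mat 1) $ i $ j) \<le> 2 * (exp (\<kappa> * L) * (c * K\<^sup>2 * h)) / \<kappa>"
    "\<And>i j. norm ((TL - mat 1) $ i $ j) \<le> 2 * (exp (\<kappa> * L) * (c * K\<^sup>2 * h)) / \<kappa>"
  proof (rule conjugation_near_diagonal[where \<Phi> = "\<lambda>x. S' ** \<Phi> x ** S" and \<Delta> = "\<lambda>x. S' ** \<Delta> x ** S", OF \<kappa> L gap B _ small])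
    show "norm ((S' ** \<Delta> x ** S) $ i $ j) \<le> c * K\<^sup>2 * h" if "x \<in> {0..L}" for x i j
      using order_trans[OF order_trans[OF norm_entry_le conj_norm(1)] mult_left_mono[OF \<Delta>[OF that] c0]]
      by (simp only: mult.assoc)
    show "((\<lambda>x. S' ** \<Phi> x ** S) has_vector_derivative (S' ** B ** S + S' ** \<Delta> x ** S) ** (S' ** \<Phi> x ** S)) (at x within {0..L})"
      if x: "x \<in> {0..L}" for x
    proof -
      have "(S' ** B ** S + S' ** \<Delta> x ** S) ** (S' ** \<Phi> x ** S) = S' ** (B + \<Delta> x) ** (S ** S') ** \<Phi> x ** S"
        by (simp add: matrix_distribs matrix_mul_assoc)
      also have "\<dots> = S' ** ((B + \<Delta> x) ** \<Phi> x) ** S" by (simp add: SS' matrix_mul_assoc)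
      finally show ?thesis
        using has_vector_derivative_matrix_mult[OF has_vector_derivative_matrix_mult[OF
              has_vector_derivative_const[of S'] \<Phi>[OF x]] has_vector_derivative_const[of S]] by simp
    qed
    show "S' ** \<Phi> 0 ** S = mat 1" by (simp add: \<Phi>0 SS)
  qed (rule that)
  define U0 where "U0 = S ** T0 ** S'"
  define UL where "UL = S ** TL ** S'"
  \<comment> \<open>The factor n^2 in \<tau> sums the entry bounds into a norm, and one more
    \<open>c\<close> pays for the return from the coordinates \<open>S\<close>.\<close>
  have U_norm: "norm (S ** T ** S' - mat 1) \<le> \<tau>"
    if "\<And>i j. norm ((T - mat 1) $ i $ j) \<le> 2 * (exp (\<kappa> * L) * (c * K\<^sup>2 * h)) / \<kappa>" for T
  proof -
    have "S ** T ** S' - mat 1 = S ** (T - mat 1) ** S'" by (simp add: matrix_distribs SS')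
    also have "norm \<dots> \<le> c * norm (T - mat 1)" by (rule conj_norm)
    also have "\<dots> \<le> c * (of_nat (CARD('n) * CARD('n)) * (2 * (exp (\<kappa> * L) * (c * K\<^sup>2 * h)) / \<kappa>))"
      by (intro mult_left_mono norm_matrix_le_entries that c0)
    finally show ?thesis using \<tau> by simp
  qed
  have U: "norm (U0 - mat 1) \<le> \<tau>" "norm (UL - mat 1) \<le> \<tau>"
    unfolding U0_def UL_def by (intro U_norm T)+
  have invU: "invertible U0" "invertible UL" using matrix_near_identity(1) U \<tau> by force+
  have "\<Phi> L ** U0 = S ** (S' ** \<Phi> L ** S ** T0) ** S'"
    by (simp add: U0_def matrix_mul_assoc SS')
  also have "\<dots> = S ** (TL ** (S' ** mexp B L ** S)) ** S'"
    using T(1) by (simp add: mexp_similar[OF SS])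
  also have "\<dots> = UL ** mexp B L ** (S ** S')" by (simp add: UL_def matrix_mul_assoc)
  finally have \<Phi>U: "\<Phi> L ** U0 = UL ** mexp B L" by (simp add: SS')
  \<comment> \<open>Since \<Psi>(L) P(0) = P(L) \<Phi>(L) and \<Phi>(L) U0 = UL e^{LB}, one has
    \<Psi>(L) M = P(L) UL e^{LB}. Inverting the right side gives \<open>G\<close> as (P(L)
    UL)^{-1}.\<close>
  define M where "M = P 0 ** U0"
  define G where "G = matrix_inv UL ** Q L"
  have "\<Psi> L ** M = P L ** (\<Phi> L ** U0)"
    by (simp add: M_def \<Phi>_def matrix_mul_assoc QP[OF L0(2)])
  then have "\<Psi> L ** (M ** mexp B (- L) ** G) = P L ** UL ** (mexp B L ** mexp B (- L)) ** G"
    by (simp add: \<Phi>U matrix_mul_assoc)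
  also have "\<dots> = P L ** (UL ** matrix_inv UL) ** Q L"
    by (simp add: mexp_mult_minus G_def matrix_mul_assoc)
  also have "\<dots> = mat 1" by (simp add: invertible_matrix_inv[OF invU(2)] QP[OF L0(2)])
  finally have 1: "matrix_inv (\<Psi> L) = M ** mexp B (- L) ** G" by (rule matrix_inv_unique)
  have "M - P 0 = P 0 ** (U0 - mat 1)" by (simp add: M_def matrix_distribs)
  also have "norm \<dots> \<le> norm (P 0) * norm (U0 - mat 1)" by (rule norm_matrix_mult_le)
  also have "\<dots> \<le> K * \<tau>" using K[OF L0(1)] U K0 by (intro mult_mono) auto
  finally have 2: "norm (M - P 0) \<le> K * \<tau>" .
  have "G - mat 1 = (matrix_inv UL - mat 1) ** Q L + Q L ** (mat 1 - P L)"
    by (simp add: G_def matrix_distribs QP[OF L0(2)])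
  also have "norm \<dots> \<le> norm (matrix_inv UL - mat 1) * norm (Q L) + norm (Q L) * norm (mat 1 - P L)"
    by (intro norm_triangle_mono norm_matrix_mult_le)
  also have "\<dots> \<le> (2 * \<tau>) * K + K * p"
    using matrix_near_identity(2)[of UL] U(2) order_trans[OF norm_ge_zero U(2)] \<tau> K[OF L0(2)] K0 p
    by (intro add_mono mult_mono) (auto simp: Q_def norm_minus_commute)
  finally have 3: "norm (G - mat 1) \<le> K * (2 * \<tau> + p)" by (simp add: algebra_simps)
  show thesis by (rule that[OF 1 2 3])
qed

section \<open>Spectral subspaces and projections\<close>

lemma gen_eigenspaceI:
  "((*v) (B - mat \<mu>) ^^ k) v = 0 \<Longrightarrow> v \<in> gen_eigenspace B \<mu>" for B :: "complex^'n^'n"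
  by (auto simp: gen_eigenspace_def)

lemma gen_eigenspace_invariant:
  fixes B M :: "complex^'n^'n"
  assumes "M ** B = B ** M" "v \<in> gen_eigenspace B \<mu>"
  shows "M *v v \<in> gen_eigenspace B \<mu>"
proof -
  have c: "(B - mat \<mu>) *v (M *v w) = M *v ((B - mat \<mu>) *v w)" for w
    by (simp add: matrix_vector_mul_assoc matrix_distribs assms(1) mat_commute)
  have "((*v) (B - mat \<mu>) ^^ k) (M *v w) = M *v ((*v) (B - mat \<mu>) ^^ k) w" for k w
    by (induction k) (simp_all add: c)
  moreover obtain k where "((*v) (B - mat \<mu>) ^^ k) v = 0" using assms(2) by (auto simp: gen_eigenspace_def)
  ultimately show ?thesis by (metis gen_eigenspaceI matrix_vector_mult_0_right)
qed

lemma spectral_subspace_invariant: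
  fixes B M :: "complex^'n^'n"
  assumes "M ** B = B ** M" "v \<in> spectral_subspace B \<Omega>"
  shows "M *v v \<in> spectral_subspace B \<Omega>"
proof -
  have "M *v v \<in> (*v) M ` vec.span (\<Union>\<mu>\<in>\<Omega>. gen_eigenspace B \<mu>)"
    using assms(2) by (simp add: spectral_subspace_def)
  also have "\<dots> = vec.span ((*v) M ` (\<Union>\<mu>\<in>\<Omega>. gen_eigenspace B \<mu>))"
    by (simp add: vec.linear_span_image[OF matrix_vector_mul_linear_gen])
  also have "\<dots> \<subseteq> spectral_subspace B \<Omega>"
    unfolding spectral_subspace_def
    by (rule vec.span_mono) (auto dest: gen_eigenspace_invariant[OF assms(1)])
  finally show ?thesis .
qed

lemma spectral_projection_range:
  assumes "is_spectral_projection B \<Omega> Q" "v \<in> spectral_subspace B \<Omega>"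
  shows "Q *v v = v"
  using assms unfolding is_spectral_projection_def
  by (metis imageE matrix_vector_mul_assoc)

lemma spectral_projection_kernel:
  assumes "is_spectral_projection B \<Omega> Q" "v \<in> spectral_subspace B (- \<Omega>)"
  shows "Q *v v = 0"
  using assms unfolding is_spectral_projection_def by blast

lemma spectral_projection_split:
  fixes B :: "complex^'n^'n"
  assumes "is_spectral_projection B \<Omega> Q"
  shows "Q *v v \<in> spectral_subspace B \<Omega>" "v - Q *v v \<in> spectral_subspace B (- \<Omega>)"
proof -
  show "Q *v v \<in> spectral_subspace B \<Omega>" using assms unfolding is_spectral_projection_def by blast
  have "Q *v (v - Q *v v) = 0"
    using assms by (simp add: is_spectral_projection_def matrix_vector_mult_diff_distrib matrix_vector_mul_assoc)
  then show "v - Q *v v \<in> spectral_subspace B (- \<Omega>)"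
    using assms unfolding is_spectral_projection_def by blast
qed

text \<open>A matrix commuting with \<open>B\<close> leaves every generalized eigenspace invariant,
  hence both the range and the kernel of \<open>Q\<close>.\<close>

lemma spectral_projection_commutes:
  fixes B M :: "complex^'n^'n"
  assumes Q: "is_spectral_projection B \<Omega> Q" and M: "M ** B = B ** M"
  shows "M ** Q = Q ** M"
proof -
  have "(M ** Q) *v v = (Q ** M) *v v" for v
  proof -
    have "Q *v (M *v (Q *v v)) = M *v (Q *v v)"
      by (intro spectral_projection_range[OF Q] spectral_subspace_invariant[OF M] spectral_projection_split[OF Q])
    moreover have "Q *v (M *v (v - Q *v v)) = 0"
      by (intro spectral_projection_kernel[OF Q] spectral_subspace_invariant[OF M] spectral_projection_split[OF Q])
    ultimately show ?thesis
      by (simp add: matrix_vector_mult_diff_distrib matrix_vector_mul_assoc[symmetric])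
  qed
  then show ?thesis by (simp add: matrix_eq)
qed

lemma spectral_projection_commutes_self:
  fixes B :: "complex^'n^'n"
  assumes "is_spectral_projection B \<Omega> Q"
  shows "B ** Q = Q ** B"
  by (rule spectral_projection_commutes[OF assms]) simp

lemma spectral_projections_commute:
  fixes B :: "complex^'n^'n"
  assumes "is_spectral_projection B \<Omega> Q" "is_spectral_projection B \<Omega>' Q'"
  shows "Q ** Q' = Q' ** Q"
  by (rule spectral_projection_commutes[OF assms(2)])
    (simp add: spectral_projection_commutes_self[OF assms(1)])

text \<open>Range and kernel of a spectral projection are sums of generalized eigenspaces and
  together span everything. So the existence of a single spectral projection already supplies the
  completeness of the generalized eigenvectors.\<close>

lemma spectral_projection_span:
  fixes B :: "complex^'n^'n"
  assumes "is_spectral_projection B \<Omega> Q"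
  shows "vec.span (\<Union>\<mu>. gen_eigenspace B \<mu>) = UNIV"
proof -
  have "v \<in> vec.span (\<Union>\<mu>. gen_eigenspace B \<mu>)" for v
  proof -
    have "spectral_subspace B \<Omega>' \<subseteq> vec.span (\<Union>\<mu>. gen_eigenspace B \<mu>)" for \<Omega>'
      unfolding spectral_subspace_def by (rule vec.span_mono) auto
    with spectral_projection_split[OF assms, of v]
    have "Q *v v + (v - Q *v v) \<in> vec.span (\<Union>\<mu>. gen_eigenspace B \<mu>)"
      by (intro vec.span_add) auto
    then show ?thesis by simp
  qed
  then show ?thesis by auto
qed

section \<open>Triangular and almost diagonal form\<close>

lemma gen_eigenspace_step:
  fixes B :: "complex^'n^'n"
  assumes V: "vec.subspace V" "V \<noteq> UNIV" and span: "vec.span (\<Union>\<mu>. gen_eigenspace B \<mu>) = UNIV"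
  obtains \<mu> v where "v \<in> gen_eigenspace B \<mu>" "v \<notin> V" "(B - mat \<mu>) *v v \<in> V"
proof -
  have "\<not> (\<Union>\<mu>. gen_eigenspace B \<mu>) \<subseteq> V" using V span vec.span_minimal by blast
  then obtain \<mu> w where w: "w \<in> gen_eigenspace B \<mu>" "w \<notin> V" by auto
  let ?N = "(*v) (B - mat \<mu>)"
  obtain k where k: "(?N ^^ k) w = 0" using w by (auto simp: gen_eigenspace_def)
  \<comment> \<open>Iterating B - \<mu> on \<open>w\<close> eventually gives 0 and so enters
    \<open>V\<close>. The last iterate outside \<open>V\<close>, the one with exponent m - 1, is the
    wanted vector; it remains in the generalized eigenspace.\<close>
  define m where "m = (LEAST m. (?N ^^ m) w \<in> V)"
  have m: "(?N ^^ m) w \<in> V"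
    unfolding m_def by (rule LeastI[of _ k]) (simp add: k vec.subspace_0[OF V(1)])
  then have "m \<noteq> 0" using w(2) by (cases m) auto
  then obtain l where l: "m = Suc l" by (cases m) auto
  have "(?N ^^ l) w \<notin> V" using not_less_Least[of l "\<lambda>m. (?N ^^ m) w \<in> V"] l by (simp add: m_def[symmetric])
  moreover have "?N ((?N ^^ l) w) \<in> V" using m l by simp
  moreover have "(?N ^^ k) ((?N ^^ l) w) = 0"
  proof -
    have "(?N ^^ k) ((?N ^^ l) w) = (?N ^^ l) ((?N ^^ k) w)"
      by (metis add.commute comp_apply funpow_add)
    moreover have "(?N ^^ l) 0 = 0" for l by (induction l) simp_all
    ultimately show ?thesis by (simp add: k)
  qed
  ultimately show thesis using that gen_eigenspaceI by metis
qed

text \<open>Repeated extension by one vector. Triangularity alone would follow from a flag of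
  invariant subspaces; membership of every \<open>f j\<close> in a generalized eigenspace is carried
  along so that spectral projections become diagonal in the resulting basis.\<close>

lemma gen_eigenspace_flag:
  fixes B :: "complex^'n^'n"
  assumes span: "vec.span (\<Union>\<mu>. gen_eigenspace B \<mu>) = UNIV" and "k \<le> CARD('n)"
  shows "\<exists>f \<mu>. inj_on f {..<k} \<and> vec.independent (f ` {..<k}) \<and>
    (\<forall>j<k. f j \<in> gen_eigenspace B (\<mu> j) \<and> (B - mat (\<mu> j)) *v f j \<in> vec.span (f ` {..<j}))"
  using \<open>k \<le> CARD('n)\<close>
proof (induction k)
  case 0
  show ?case by (simp add: vec.independent_empty)
next
  case (Suc k)
  then obtain f \<mu> where f: "inj_on f {..<k}" "vec.independent (f ` {..<k})"
    "\<And>j. j < k \<Longrightarrow> f j \<in> gen_eigenspace B (\<mu> j) \<and> (B - mat (\<mu> j)) *v f j \<in> vec.span (f ` {..<j})"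
    by auto
  have "vec.dim (vec.span (f ` {..<k})) = k"
    using vec.dim_eq_card_independent[OF f(2)] f(1) by (simp add: card_image)
  then have "vec.span (f ` {..<k}) \<noteq> UNIV" using Suc.prems vec_dim_card[where 'a=complex and 'n='n] by (metis Suc_n_not_le_n)
  then obtain m v where v: "v \<in> gen_eigenspace B m" "v \<notin> vec.span (f ` {..<k})"
    "(B - mat m) *v v \<in> vec.span (f ` {..<k})"
    using gen_eigenspace_step[OF vec.subspace_span _ span] by metis
  let ?f = "f(k := v)" and ?\<mu> = "\<mu>(k := m)"
  have im: "?f ` {..<j} = f ` {..<j}" if "j \<le> k" for j using that by (auto simp: image_iff)
  have vf: "v \<notin> f ` {..<k}" using v(2) vec.span_base[of v] by metis
  have "inj_on ?f {..<k}" by (rule inj_on_fun_updI[OF f(1) vf])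
  then have "inj_on ?f {..<Suc k}" using vf im[of k] by (simp add: lessThan_Suc)
  moreover have "vec.independent (?f ` {..<Suc k})"
  proof -
    have "?f ` {..<Suc k} = insert v (f ` {..<k})" using im[of k] unfolding lessThan_Suc image_insert by simp
    then show ?thesis using vec.independent_insertI[OF v(2) f(2)] by simp
  qed
  moreover have "?f j \<in> gen_eigenspace B (?\<mu> j) \<and> (B - mat (?\<mu> j)) *v ?f j \<in> vec.span (?f ` {..<j})"
    if "j < Suc k" for j
    using that f(3)[of j] v im[of j] by (cases "j = k") auto
  ultimately show ?case by blast
qed

lemma column_mult: "column j (A ** B) = A *v column j B" for A B :: "complex^'n^'n"
  by (simp add: vec_eq_iff column_def matrix_matrix_mult_def matrix_vector_mult_def)

lemma matrix_eq_columnsI: "(\<And>j. column j A = column j B) \<Longrightarrow> A = B" for A B :: "complex^'n^'n"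
  by (simp add: vec_eq_iff column_def)

text \<open>The index type has no order, so the rank \<open>r\<close> along the flag expresses what
  upper triangular means. Column \<open>j\<close> is read off from (B - d_j) f_j, whose coordinates
  live only on strictly smaller ranks.\<close>

lemma triangularization:
  fixes B :: "complex^'n^'n"
  assumes span: "vec.span (\<Union>\<mu>. gen_eigenspace B \<mu>) = UNIV"
  obtains S S' :: "complex^'n^'n" and d and r :: "'n \<Rightarrow> nat" where "S' ** S = mat 1"
    "\<And>j. column j S \<in> gen_eigenspace B (d j)"
    "\<And>i j. \<not> r i < r j \<Longrightarrow> (S' ** B ** S) $ i $ j = (if i = j then d i else 0)"
proof -
  obtain f \<mu> where f: "inj_on f {..<CARD('n)}" "vec.independent (f ` {..<CARD('n)})"
    "\<And>j. j < CARD('n) \<Longrightarrow> f j \<in> gen_eigenspace B (\<mu> j) \<and> (B - mat (\<mu> j)) *v f j \<in> vec.span (f ` {..<j})"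
    using gen_eigenspace_flag[OF span order_refl] by auto
  obtain r :: "'n \<Rightarrow> nat" where r: "bij_betw r UNIV {..<CARD('n)}"
    using finite_same_card_bij[of "UNIV :: 'n set" "{..<CARD('n)}"] by auto
  define S where "S = (\<chi> i j. f (r j) $ i)"
  have col: "column j S = f (r j)" for j by (simp add: S_def column_def)
  have rlt: "r j < CARD('n)" for j using bij_betwE[OF r] by auto
  have rinj: "r i = r j \<longleftrightarrow> i = j" for i j using bij_betw_imp_inj_on[OF r] by (auto simp: inj_on_def)
  have "invertible S"
    unfolding invertible_left_inverse matrix_left_invertible_independent_columns
  proof (intro allI impI)
    fix c :: "'n \<Rightarrow> complex" and i assume c: "(\<Sum>i\<in>UNIV. c i *s column i S) = 0"
    have bij: "bij_betw (\<lambda>j. column j S) UNIV (f ` {..<CARD('n)})"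
      unfolding col using bij_betw_trans[OF r inj_on_imp_bij_betw[OF f(1)]] by (simp add: o_def)
    define u where "u x = c (inv_into UNIV (\<lambda>j. column j S) x)" for x
    have u: "u (column j S) = c j" for j
      using bij_betw_inv_into_left[OF bij, of j] by (simp add: u_def)
    have "(\<Sum>x\<in>f ` {..<CARD('n)}. u x *s x) = 0"
      using c sum.reindex_bij_betw[OF bij, of "\<lambda>x. u x *s x"] by (simp add: u)
    moreover have "column i S \<in> f ` {..<CARD('n)}" using rlt col by auto
    ultimately have "u (column i S) = 0"
      by (intro vec.independentD[OF f(2) finite_imageI[OF finite_lessThan] order_refl])
    then show "c i = 0" by (simp add: u)
  qed
  define S' where "S' = matrix_inv S"
  have S'S: "S' ** S = mat 1" using invertible_matrix_inv[OF \<open>invertible S\<close>] by (simp add: S'_def)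
  show thesis
  proof (rule that[of S' S "\<lambda>j. \<mu> (r j)" r])
    show "S' ** S = mat 1" by (rule S'S)
    show "column j S \<in> gen_eigenspace B (\<mu> (r j))" for j using f(3)[OF rlt, of j] by (simp add: col)
    fix i j assume ij: "\<not> r i < r j"
    have S'f: "(S' *v f (r l)) $ m = (if m = l then 1 else 0)" for l m
      using arg_cong[OF S'S, of "\<lambda>M. M $ m $ l"] column_mult[of l S' S] unfolding col[symmetric]
      by (simp add: column_def vec_eq_iff mat_def)
    have "(S' *v v) $ i = 0" if "v \<in> vec.span (f ` {..<r j})" for v
      using that
    proof (rule vec.span_induct)
      show "vec.subspace {v. (S' *v v) $ i = 0}"
        by (auto simp: vec.subspace_def matrix_vector_right_distrib vector_scalar_commute)
      fix v assume "v \<in> f ` {..<r j}"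
      then obtain k where k: "v = f k" "k < r j" by auto
      then have "k \<in> r ` UNIV" using rlt[of j] r by (simp add: bij_betw_def)
      then obtain l where "k = r l" by auto
      then show "(S' *v v) $ i = 0" using S'f[of l i] k ij by auto
    qed
    then have "(S' *v ((B - mat (\<mu> (r j))) *v f (r j))) $ i = 0" using f(3)[OF rlt] by blast
    moreover have "(S' ** B ** S) $ i $ j = (S' *v (B *v f (r j))) $ i"
      using column_mult[of j "S' ** B" S] by (simp add: column_def vec_eq_iff matrix_vector_mul_assoc flip: col)
    moreover have "mat c *v v = c *s v" for c and v :: "complex^'n"
      by (simp add: vec_eq_iff matrix_vector_mult_def mat_def if_distrib if_distribR cong: if_cong)
    ultimately show "(S' ** B ** S) $ i $ j = (if i = j then \<mu> (r i) else 0)"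
      using S'f[of j i]
      by (simp add: matrix_vector_mult_diff_rdistrib matrix_vector_mult_diff_distrib vector_scalar_commute)
  qed
qed

text \<open>The diagonal \<open>d\<close> is chosen before \<open>\<delta>\<close>, because the spectral gaps of \<open>d\<close> decide how small
  \<open>\<delta>\<close> has to be; the off-diagonal part is shrunk by scaling the basis vectors geometrically.\<close>

lemma near_diagonalization:
  fixes B :: "complex^'n^'n"
  assumes span: "vec.span (\<Union>\<mu>. gen_eigenspace B \<mu>) = UNIV"
  obtains d where "\<And>\<delta>. \<delta> > 0 \<Longrightarrow> \<exists>S S' :: complex^'n^'n. S' ** S = mat 1 \<and> (\<forall>j. column j S \<in> gen_eigenspace B (d j)) \<and>
    (\<forall>i j. norm ((S' ** B ** S) $ i $ j - (if i = j then d i else 0)) \<le> \<delta>)"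
proof -
  obtain S S' :: "complex^'n^'n" and d and r :: "'n \<Rightarrow> nat" where S: "S' ** S = mat 1"
    "\<And>j. column j S \<in> gen_eigenspace B (d j)"
    "\<And>i j. \<not> r i < r j \<Longrightarrow> (S' ** B ** S) $ i $ j = (if i = j then d i else 0)"
    by (rule triangularization[OF span], rule that)
  show thesis
  proof (rule that[of d])
    fix \<delta> :: real assume \<delta>: "\<delta> > 0"
    let ?T = "S' ** B ** S"
    define m where "m = norm ?T + 1"
    have m: "m > 0" by (simp add: m_def add_nonneg_pos)
    \<comment> \<open>Scaling basis vector \<open>j\<close> by s^{r_j} multiplies entry (i, j) by
      s^{r_j - r_i}, which is at most \<open>s\<close> where r_i < r_j. As \<open>m\<close> exceeds
      every entry of the triangular matrix, s m \<le> \<delta> suffices.\<close>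
    define s where "s = min 1 (\<delta> / m)"
    have s: "0 < s" "s \<le> 1" "s * m \<le> \<delta>" using \<delta> m by (auto simp: s_def min_def field_simps)
    define D where "D = (\<chi> i j. if i = j then complex_of_real (s ^ r i) else 0)"
    define D' where "D' = (\<chi> i j. if i = j then complex_of_real (1 / s ^ r i) else 0)"
    have DM: "(D' ** M) $ i $ j = of_real (1 / s ^ r i) * M $ i $ j"
      and MD: "(M ** D) $ i $ j = of_real (s ^ r j) * M $ i $ j" for M :: "complex^'n^'n" and i j
      by (simp_all add: D_def D'_def matrix_matrix_mult_def if_distrib if_distribR mult.commute cong: if_cong)
    have DD: "D' ** D = mat 1" using s by (simp add: vec_eq_iff DM) (simp add: D_def mat_def)
    have "(D' ** S') ** (S ** D) = D' ** (S' ** S) ** D" by (simp add: matrix_mul_assoc)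
    then have "(D' ** S') ** (S ** D) = mat 1" by (simp add: S DD)
    moreover have "column j (S ** D) \<in> gen_eigenspace B (d j)" for j
    proof -
      have "column j (S ** D) = mat (of_real (s ^ r j)) *v column j S"
        by (simp add: vec_eq_iff column_def MD matrix_vector_mult_def mat_def if_distrib if_distribR cong: if_cong)
      then show ?thesis using gen_eigenspace_invariant[OF mat_commute[symmetric] S(2)] by simp
    qed
    moreover have "norm (((D' ** S') ** B ** (S ** D)) $ i $ j - (if i = j then d i else 0)) \<le> \<delta>" for i j
    proof -
      have "((D' ** S') ** B ** (S ** D)) $ i $ j = of_real (s ^ r j / s ^ r i) * ?T $ i $ j"
        using MD[of "D' ** ?T" i j] DM[of ?T i j] by (simp add: matrix_mul_assoc)
      moreover have "norm (of_real (s ^ r j / s ^ r i) * ?T $ i $ j) \<le> \<delta>" if "r i < r j"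
      proof -
        obtain k where "r j = Suc (r i + k)" using \<open>r i < r j\<close> less_iff_Suc_add[of "r i" "r j"] by auto
        then have "s ^ r j / s ^ r i = s * s ^ k" using s by (simp add: power_add)
        also have "\<dots> \<le> s * 1" using s by (intro mult_left_mono power_le_one) auto
        finally have "\<bar>s ^ r j / s ^ r i\<bar> \<le> s" using s by simp
        then have "norm (of_real (s ^ r j / s ^ r i) * ?T $ i $ j) \<le> s * m"
          unfolding norm_mult norm_of_real using norm_entry_le[of ?T i j] s
          by (intro mult_mono) (auto simp: m_def)
        then show ?thesis using s by simp
      qed
      ultimately show ?thesis using S(3)[of i j] \<delta> s by (cases "r i < r j") auto
    qed
    ultimately show "\<exists>S S' :: complex^'n^'n. S' ** S = mat 1 \<and> (\<forall>j. column j S \<in> gen_eigenspace B (d j)) \<and>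
        (\<forall>i j. norm ((S' ** B ** S) $ i $ j - (if i = j then d i else 0)) \<le> \<delta>)" by blast
  qed
qed

lemma gen_eigenspace_imp_eigenvalue:
  fixes B :: "complex^'n^'n"
  assumes "v \<in> gen_eigenspace B \<mu>" "v \<noteq> 0"
  shows "eigenvalue B \<mu>"
proof (rule ccontr)
  assume *: "\<not> eigenvalue B \<mu>"
  have mv: "mat c *v w = c *s w" for c and w :: "complex^'n"
    by (simp add: vec_eq_iff matrix_vector_mult_def mat_def if_distrib if_distribR cong: if_cong)
  have "(B - mat \<mu>) *v w \<noteq> 0" if "w \<noteq> 0" for w
    using * that by (auto simp: eigenvalue_def matrix_vector_mult_diff_rdistrib mv)
  then have "((*v) (B - mat \<mu>) ^^ k) v \<noteq> 0" for k using assms(2) by (induction k) auto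
  then show False using assms(1) by (auto simp: gen_eigenspace_def)
qed

text \<open>\<open>Q\<close> fixes or kills each column of \<open>S\<close>, depending on where its
  eigenvalue lies. Thus \<open>Q\<close> is exactly diagonal in coordinates in which
  \<open>B\<close> itself may only be almost diagonal.\<close>

lemma spectral_projection_diagonal:
  fixes B S S' :: "complex^'n^'n"
  assumes Q: "is_spectral_projection B \<Omega> Q" and S: "S' ** S = mat 1"
    and col: "\<And>j. column j S \<in> gen_eigenspace B (d j)"
  shows "S' ** Q ** S = (\<chi> i j. if i = j \<and> d i \<in> \<Omega> then 1 else 0)"
proof (rule matrix_eq_columnsI)
  fix j
  have sub: "column j S \<in> spectral_subspace B \<Omega>'" if "d j \<in> \<Omega>'" for \<Omega>'
    unfolding spectral_subspace_def using col that by (intro vec.span_base) auto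
  have "Q *v column j S = (if d j \<in> \<Omega> then column j S else 0)"
    using spectral_projection_range[OF Q sub] spectral_projection_kernel[OF Q sub] by simp
  then have "column j (S' ** Q ** S) = (if d j \<in> \<Omega> then column j (S' ** S) else 0)"
    by (simp add: column_mult flip: matrix_vector_mul_assoc)
  then show "column j (S' ** Q ** S) = column j (\<chi> i j. if i = j \<and> d i \<in> \<Omega> then 1 else 0)"
    by (auto simp: S vec_eq_iff column_def mat_def)
qed

section \<open>The characteristic polynomial and algebraic multiplicity\<close>

lemma poly_charpoly: "poly (charpoly B) x = det (mat x - B)"
  by (auto simp: charpoly_def det_def poly_sum poly_prod mat_def intro!: sum.cong prod.cong)

text \<open>The determinant is invariant under similarity and continuous. The matrices
  \<open>S\<close> may degenerate as \<delta> tends to 0, but the conjugated matrices converge to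
  the diagonal one while their determinant stays \<open>det B\<close>.\<close>

lemma det_near_diagonal:
  fixes d :: "'n::finite \<Rightarrow> complex" and B :: "complex^'n^'n"
  assumes "\<And>\<delta>. \<delta> > 0 \<Longrightarrow> \<exists>S S' :: complex^'n^'n. S' ** S = mat 1 \<and>
    (\<forall>i j. norm ((S' ** B ** S) $ i $ j - (if i = j then d i else 0)) \<le> \<delta>)"
  shows "det B = (\<Prod>i\<in>UNIV. d i)"
proof (rule ccontr)
  define D where "D = (\<chi> i j. if i = j then d i else 0)"
  assume "det B \<noteq> (\<Prod>i\<in>UNIV. d i)"
  moreover have "det D = (\<Prod>i\<in>UNIV. d i)" by (subst det_diagonal) (auto simp: D_def)
  ultimately have pos: "norm (det B - det D) > 0" by simp
  define M where "M = norm D + 1"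
  define C where "C = fact CARD('n) * of_nat CARD('n) * M ^ (CARD('n) - 1)"
  have M: "M > 0" by (simp add: M_def add_nonneg_pos)
  have C: "C > 0" using M by (simp add: C_def)
  define \<delta> where "\<delta> = min 1 (norm (det B - det D) / (2 * C))"
  have \<delta>: "\<delta> > 0" "\<delta> \<le> 1" using pos C by (auto simp: \<delta>_def)
  obtain S S' :: "complex^'n^'n" where S: "S' ** S = mat 1"
    "\<And>i j. norm ((S' ** B ** S) $ i $ j - D $ i $ j) \<le> \<delta>" using assms[OF \<delta>(1)] by (auto simp: D_def)
  have "det S' * det S = 1" using arg_cong[OF S(1), of det] by (simp add: det_mul)
  then have "det (S' ** B ** S) = det B" by (simp add: det_mul mult_ac)
  moreover have "norm (det (S' ** B ** S) - det D) \<le> C * \<delta>"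
    unfolding C_def
  proof (rule det_diff_le[OF M _ _ S(2)])
    show D: "norm (D $ i $ j) \<le> M" for i j using norm_entry_le[of D i j] by (simp add: M_def)
    show "norm ((S' ** B ** S) $ i $ j) \<le> M" for i j
      using norm_triangle_sub[of "(S' ** B ** S) $ i $ j" "D $ i $ j"] S(2)[of i j] \<delta> norm_entry_le[of D i j]
      by (simp add: M_def)
  qed
  ultimately have "norm (det B - det D) \<le> C * \<delta>" by simp
  also have "\<dots> \<le> C * (norm (det B - det D) / (2 * C))" using C by (intro mult_left_mono) (auto simp: \<delta>_def)
  also have "\<dots> = norm (det B - det D) / 2" using C by simp
  finally show False using pos by simp
qed

lemma order_prod_linear:
  fixes d :: "'a \<Rightarrow> complex"
  assumes "finite I"
  shows "order a (\<Prod>i\<in>I. [:- d i, 1:]) = card {i\<in>I. d i = a}"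
  using assms
proof (induction I rule: finite_induct)
  case (insert j I)
  have "order a [:- d j, 1:] = (if d j = a then 1 else 0)"
    using order_power_n_n[of a 1] by (auto intro!: order_0I)
  moreover have "{i\<in>insert j I. d i = a} = (if d j = a then insert j {i\<in>I. d i = a} else {i\<in>I. d i = a})"
    by auto
  moreover have nz: "[:- d j, 1:] * (\<Prod>i\<in>I. [:- d i, 1:]) \<noteq> 0" using insert by (subst mult_eq_0_iff) (simp add: prod_zero_iff)
  ultimately show ?case using insert order_mult[OF nz, of a] by (auto simp del: mult_pCons_left)
qed simp

text \<open>Almost diagonalizing \<open>B\<close> also almost diagonalizes \<open>mat x - B\<close>,
  so the characteristic polynomial is the product of the x - d_i. This translates algebraic
  simplicity of an eigenvalue into a single index on the diagonal.\<close>

lemma order_charpoly: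
  fixes d :: "'n::finite \<Rightarrow> complex" and B :: "complex^'n^'n"
  assumes nd: "\<And>\<delta>. \<delta> > 0 \<Longrightarrow> \<exists>S S' :: complex^'n^'n. S' ** S = mat 1 \<and>
    (\<forall>i j. norm ((S' ** B ** S) $ i $ j - (if i = j then d i else 0)) \<le> \<delta>)"
  shows "order a (charpoly B) = card {i. d i = a}"
proof -
  have "poly (charpoly B) x = poly (\<Prod>i\<in>UNIV. [:- d i, 1:]) x" for x
  proof -
    have "det (mat x - B) = (\<Prod>i\<in>UNIV. x - d i)"
    proof (rule det_near_diagonal)
      fix \<delta> :: real assume "\<delta> > 0"
      then obtain S S' :: "complex^'n^'n" where S: "S' ** S = mat 1"
        "\<And>i j. norm ((S' ** B ** S) $ i $ j - (if i = j then d i else 0)) \<le> \<delta>" using nd by metis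
      have eq: "S' ** (mat x - B) ** S = mat x - S' ** B ** S"
      proof -
        have "S' ** mat x ** S = mat x ** (S' ** S)" by (simp add: mat_commute matrix_mul_assoc)
        then show ?thesis by (simp add: matrix_distribs S)
      qed
      have "norm ((S' ** (mat x - B) ** S) $ i $ j - (if i = j then x - d i else 0)) \<le> \<delta>" for i j
        unfolding eq using S(2)[of i j] by (auto simp: mat_def norm_minus_commute)
      then show "\<exists>S S' :: complex^'n^'n. S' ** S = mat 1 \<and>
          (\<forall>i j. norm ((S' ** (mat x - B) ** S) $ i $ j - (if i = j then x - d i else 0)) \<le> \<delta>)"
        using S(1) by blast
    qed
    then show ?thesis by (simp add: poly_charpoly poly_prod)
  qed
  then have "charpoly B = (\<Prod>i\<in>UNIV. [:- d i, 1:])" unfolding poly_eq_poly_eq_iff[symmetric] by blast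
  then show ?thesis by (simp add: order_prod_linear)
qed

section \<open>Exponential dichotomy near the base point\<close>

lemma inner_vec_complex: "u \<bullet> w = (\<Sum>i\<in>UNIV. u $ i \<bullet> w $ i)" for u w :: "complex^'n"
  by (simp add: inner_vec_def)

text \<open>A vector in the range of \<open>Q\<close> has only small components outside
  \<open>I\<close>, because the rows of \<open>Q\<close> with such an index have entries of size
  \<epsilon>. There the diagonal contributes up to b' instead of -b, which explains the factor b +
  b'; this loss and the defect \<delta> together use up half of b.\<close>

lemma near_diagonal_dissipative:
  fixes B Q :: "complex^'n^'n" and d :: "'n \<Rightarrow> complex"
  assumes B: "\<And>i j. norm (B $ i $ j - (if i = j then d i else 0)) \<le> \<delta>"
    and Q: "\<And>i j. norm (Q $ i $ j - (if i = j \<and> i \<in> I then 1 else 0)) \<le> \<epsilon>"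
    and d: "\<And>i. i \<in> I \<Longrightarrow> Re (d i) \<le> - b" "\<And>i. Re (d i) \<le> b'"
    and small: "(b + b') * (of_nat CARD('n) ^ 2 * \<epsilon>\<^sup>2) + of_nat CARD('n) ^ 2 * \<delta> \<le> b / 2"
    and b: "b \<ge> 0" "b' \<ge> 0" and u: "Q *v u = u"
  shows "u \<bullet> (B *v u) \<le> - b / 2 * (norm u)\<^sup>2"
proof -
  define D where "D = (\<chi> i j. if i = j then d i else 0)"
  have e0: "\<epsilon> \<ge> 0" by (rule order_trans[OF norm_ge_zero Q])
  have Du: "(D *v u) $ i = d i * u $ i" for i
    by (simp add: D_def matrix_vector_mult_def if_distrib if_distribR cong: if_cong)
  have out: "(norm (u $ i))\<^sup>2 \<le> of_nat CARD('n) * \<epsilon>\<^sup>2 * (norm u)\<^sup>2" if "i \<notin> I" for i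
  proof -
    have "u $ i = (\<Sum>j\<in>UNIV. Q $ i $ j * u $ j)" using arg_cong[OF u, of "\<lambda>v. v $ i"]
      by (simp add: matrix_vector_mult_def)
    then have "(norm (u $ i))\<^sup>2 \<le> (\<Sum>j\<in>UNIV. (norm (Q $ i $ j))\<^sup>2) * (\<Sum>j\<in>UNIV. (norm (u $ j))\<^sup>2)"
      by (metis norm_sum_mult_sq_le)
    also have "\<dots> \<le> (\<Sum>j::'n\<in>UNIV. \<epsilon>\<^sup>2) * (\<Sum>j\<in>UNIV. (norm (u $ j))\<^sup>2)"
      using Q[of i] that by (intro mult_right_mono sum_mono power_mono sum_nonneg) auto
    finally show ?thesis by (simp add: norm_vec_sq[of u])
  qed
  have entry: "Re (d i) * (norm (u $ i))\<^sup>2 \<le> - b * (norm (u $ i))\<^sup>2 + (b + b') * (of_nat CARD('n) * \<epsilon>\<^sup>2 * (norm u)\<^sup>2)" for i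
  proof (cases "i \<in> I")
    case True
    then show ?thesis using mult_right_mono[OF d(1)[OF True], of "(norm (u $ i))\<^sup>2"] b
      by (smt (verit) mult_nonneg_nonneg of_nat_0_le_iff zero_le_power2)
  next
    case False
    have "Re (d i) * (norm (u $ i))\<^sup>2 \<le> b' * (norm (u $ i))\<^sup>2" by (intro mult_right_mono d) simp
    also have "\<dots> = - b * (norm (u $ i))\<^sup>2 + (b + b') * (norm (u $ i))\<^sup>2" by (simp add: algebra_simps)
    also have "\<dots> \<le> - b * (norm (u $ i))\<^sup>2 + (b + b') * (of_nat CARD('n) * \<epsilon>\<^sup>2 * (norm u)\<^sup>2)"
      using b by (intro add_left_mono mult_left_mono out[OF False]) simp
    finally show ?thesis .
  qed
  have "u \<bullet> (D *v u) = (\<Sum>i\<in>UNIV. Re (d i) * (norm (u $ i))\<^sup>2)"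
    unfolding inner_vec_complex Du by (intro sum.cong refl) (simp add: inner_complex_def cmod_power2 algebra_simps power2_eq_square[of "Re _"] power2_eq_square[of "Im _"])
  also have "\<dots> \<le> (\<Sum>i\<in>UNIV. - b * (norm (u $ i))\<^sup>2 + (b + b') * (of_nat CARD('n) * \<epsilon>\<^sup>2 * (norm u)\<^sup>2))"
    by (intro sum_mono entry)
  also have "\<dots> = - b * (norm u)\<^sup>2 + (b + b') * (of_nat CARD('n) ^ 2 * \<epsilon>\<^sup>2) * (norm u)\<^sup>2"
    unfolding sum.distrib sum_distrib_left[symmetric] norm_vec_sq[of u, symmetric]
    by (simp add: power2_eq_square)
  finally have 1: "u \<bullet> (D *v u) \<le> - b * (norm u)\<^sup>2 + (b + b') * (of_nat CARD('n) ^ 2 * \<epsilon>\<^sup>2) * (norm u)\<^sup>2" .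
  have "norm (B - D) \<le> of_nat (CARD('n) * CARD('n)) * \<delta>"
    by (rule norm_matrix_le_entries) (use B in \<open>simp add: D_def\<close>)
  then have N: "norm (B - D) \<le> of_nat CARD('n) ^ 2 * \<delta>" by (simp add: power2_eq_square)
  have "u \<bullet> ((B - D) *v u) \<le> norm u * norm ((B - D) *v u)" by (rule norm_cauchy_schwarz)
  also have "\<dots> \<le> norm u * (of_nat CARD('n) ^ 2 * \<delta> * norm u)"
    by (intro mult_left_mono order_trans[OF norm_matrix_vector_le] mult_right_mono N) simp_all
  finally have 2: "u \<bullet> ((B - D) *v u) \<le> of_nat CARD('n) ^ 2 * \<delta> * (norm u)\<^sup>2"
    by (simp add: power2_eq_square mult_ac)
  have "u \<bullet> (B *v u) = u \<bullet> (D *v u) + u \<bullet> ((B - D) *v u)"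
    by (simp add: matrix_vector_mult_diff_rdistrib inner_diff_right)
  also have "\<dots> \<le> - b * (norm u)\<^sup>2 + ((b + b') * (of_nat CARD('n) ^ 2 * \<epsilon>\<^sup>2) + of_nat CARD('n) ^ 2 * \<delta>) * (norm u)\<^sup>2"
    using 1 2 by (simp add: algebra_simps)
  also have "\<dots> \<le> - b * (norm u)\<^sup>2 + b / 2 * (norm u)\<^sup>2"
    by (intro add_left_mono mult_right_mono small) simp
  finally show ?thesis by (simp add: algebra_simps)
qed

lemma norm_matrix_columns: "(norm A)\<^sup>2 = (\<Sum>j\<in>UNIV. (norm (column j A))\<^sup>2)" for A :: "complex^'n^'n"
  unfolding norm_matrix_sq by (subst sum.swap) (simp only: norm_vec_sq[where 'a = complex] column_def vec_lambda_beta)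

text \<open>On the range of \<open>Q\<close>, which the flow preserves, e^{bs} times the squared
  norm is nonincreasing. The energy argument leaves only \<open>norm Q\<close> as constant and is
  therefore uniform over all nearby matrices, whatever their Jordan structure.\<close>

lemma mexp_decay_near_diagonal:
  fixes B Q :: "complex^'n^'n" and d :: "'n \<Rightarrow> complex"
  assumes B: "\<And>i j. norm (B $ i $ j - (if i = j then d i else 0)) \<le> \<delta>"
    and Q: "\<And>i j. norm (Q $ i $ j - (if i = j \<and> i \<in> I then 1 else 0)) \<le> \<epsilon>"
    and d: "\<And>i. i \<in> I \<Longrightarrow> Re (d i) \<le> - b" "\<And>i. Re (d i) \<le> b'"
    and small: "(b + b') * (of_nat CARD('n) ^ 2 * \<epsilon>\<^sup>2) + of_nat CARD('n) ^ 2 * \<delta> \<le> b / 2"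
    and b: "b \<ge> 0" "b' \<ge> 0" and QQ: "Q ** Q = Q" and BQ: "B ** Q = Q ** B" and t: "t \<ge> 0"
  shows "norm (mexp B t ** Q) \<le> exp (- b / 2 * t) * norm Q"
proof -
  have vec: "norm (mexp B t *v w) \<le> exp (- b / 2 * t) * norm w" if w: "Q *v w = w" for w
  proof -
    define u where "u s = mexp B s *v w" for s
    define q where "q s = exp (b * s) * (u s \<bullet> u s)" for s
    have u: "(u has_vector_derivative B *v u s) (at s)" for s
      unfolding u_def[abs_def]
      using has_vector_derivative_matrix_vector_mult[OF mexp_has_vector_derivative has_vector_derivative_const[of w], of B s UNIV]
      by (simp add: matrix_vector_mul_assoc)
    have Qu: "Q *v u s = u s" for s
      by (simp add: u_def matrix_vector_mul_assoc mexp_commute[OF BQ, symmetric]) (simp add: w flip: matrix_vector_mul_assoc)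
    have "(q has_real_derivative exp (b * s) * (b * (norm (u s))\<^sup>2 + 2 * (u s \<bullet> (B *v u s)))) (at s)" for s
    proof -
      have "((\<lambda>s. u s \<bullet> u s) has_vector_derivative u s \<bullet> (B *v u s) + (B *v u s) \<bullet> u s) (at s)"
        by (rule bounded_bilinear.has_vector_derivative[OF bounded_bilinear_inner u u])
      then have "((\<lambda>s. u s \<bullet> u s) has_real_derivative 2 * (u s \<bullet> (B *v u s))) (at s)"
        by (simp add: has_real_derivative_iff_has_vector_derivative inner_commute)
      then show ?thesis unfolding q_def[abs_def]
        by (auto intro!: derivative_eq_intros simp: algebra_simps power2_norm_eq_inner)
    qed
    moreover have "exp (b * s) * (b * (norm (u s))\<^sup>2 + 2 * (u s \<bullet> (B *v u s))) \<le> 0" for s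
      using near_diagonal_dissipative[OF B Q d small b Qu, of s] by (simp add: mult_nonneg_nonpos)
    ultimately have "q t \<le> q 0" using t by (intro DERIV_nonpos_imp_nonincreasing[of 0 t q]) blast+
    then have "exp (b * t) * (norm (u t))\<^sup>2 \<le> (norm w)\<^sup>2"
      by (simp add: q_def u_def power2_norm_eq_inner)
    then have "(exp (b / 2 * t) * norm (u t))\<^sup>2 \<le> (norm w)\<^sup>2"
      by (simp add: power_mult_distrib exp_double[symmetric])
    then have "exp (b / 2 * t) * norm (u t) \<le> norm w" by (rule power2_le_imp_le) simp
    then have "exp (- b / 2 * t) * (exp (b / 2 * t) * norm (u t)) \<le> exp (- b / 2 * t) * norm w"
      by (rule mult_left_mono) simp
    then show ?thesis by (simp add: u_def mult.assoc[symmetric] flip: exp_add)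
  qed
  have "(norm (mexp B t ** Q))\<^sup>2 = (\<Sum>j\<in>UNIV. (norm (mexp B t *v column j Q))\<^sup>2)"
    by (simp add: norm_matrix_columns column_mult)
  also have "\<dots> \<le> (\<Sum>j\<in>UNIV. (exp (- b / 2 * t) * norm (column j Q))\<^sup>2)"
    by (intro sum_mono power_mono vec) (simp_all add: QQ flip: column_mult)
  also have "\<dots> = (exp (- b / 2 * t) * norm Q)\<^sup>2"
    by (simp add: power_mult_distrib norm_matrix_columns[of Q] flip: sum_distrib_left)
  finally show ?thesis by (rule power2_le_imp_le) simp
qed

lemma mexp_decay_similar:
  fixes B Q S S' :: "complex^'n^'n" and d :: "'n \<Rightarrow> complex"
  assumes SS: "S' ** S = mat 1"
    and B: "\<And>i j. norm ((S' ** B ** S) $ i $ j - (if i = j then d i else 0)) \<le> \<delta>"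
    and Q: "\<And>i j. norm ((S' ** Q ** S) $ i $ j - (if i = j \<and> i \<in> I then 1 else 0)) \<le> \<epsilon>"
    and d: "\<And>i. i \<in> I \<Longrightarrow> Re (d i) \<le> - b" "\<And>i. Re (d i) \<le> b'"
    and small: "(b + b') * (of_nat CARD('n) ^ 2 * \<epsilon>\<^sup>2) + of_nat CARD('n) ^ 2 * \<delta> \<le> b / 2"
    and b: "b \<ge> 0" "b' \<ge> 0" and QQ: "Q ** Q = Q" and BQ: "B ** Q = Q ** B" and t: "t \<ge> 0"
  shows "norm (mexp B t ** Q) \<le> (norm S * norm S')\<^sup>2 * norm Q * exp (- b / 2 * t)"
proof -
  have SS': "S ** S' = mat 1" using SS matrix_left_right_inverse by blast
  have conj: "(S' ** M ** S) ** (S' ** M' ** S) = S' ** (M ** M') ** S" for M M'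
  proof -
    have "(S' ** M ** S) ** (S' ** M' ** S) = S' ** M ** (S ** S') ** M' ** S" by (simp add: matrix_mul_assoc)
    then show ?thesis by (simp add: SS' matrix_mul_assoc)
  qed
  have "mexp B t ** Q = S ** (S' ** (mexp B t ** Q) ** S) ** S'"
    by (metis SS' matrix_mul_assoc matrix_mul_lid matrix_mul_rid)
  also have "\<dots> = S ** (mexp (S' ** B ** S) t ** (S' ** Q ** S)) ** S'"
    by (simp add: mexp_similar[OF SS] conj)
  also have "norm \<dots> \<le> norm S * norm (mexp (S' ** B ** S) t ** (S' ** Q ** S)) * norm S'"
    by (rule norm_mult3_le)
  also have "\<dots> \<le> norm S * (exp (- b / 2 * t) * norm (S' ** Q ** S)) * norm S'"
    by (intro mult_right_mono mult_left_mono mexp_decay_near_diagonal[OF B Q d small b _ _ t])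
      (simp_all add: conj QQ BQ)
  also have "\<dots> \<le> norm S * (exp (- b / 2 * t) * (norm S' * norm Q * norm S)) * norm S'"
    by (intro mult_right_mono mult_left_mono norm_mult3_le) simp_all
  finally show ?thesis by (simp add: power2_eq_square mult_ac)
qed

text \<open>A nonzero idempotent satisfies norm M \<le> (norm M)^2, so it cannot be small. This is
  the device that turns approximate relations near the base point into exact ones.\<close>

lemma projection_norm_less_1:
  fixes M :: "complex^'n^'n"
  assumes "M ** M = M" "norm M < 1"
  shows "M = 0"
proof (rule ccontr)
  assume "M \<noteq> 0"
  moreover have "norm M \<le> norm M * norm M" using norm_matrix_mult_le[of M M] assms by simp
  ultimately show False using assms(2) by simp
qed

lemma finite_min_nonzero_abs:
  fixes x :: "'a::finite \<Rightarrow> real"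
  obtains m where "m > 0" "\<And>i. x i = 0 \<or> \<bar>x i\<bar> \<ge> m"
proof -
  let ?Z = "insert 1 ((\<lambda>i. \<bar>x i\<bar>) ` {i. x i \<noteq> 0})"
  have "Min ?Z > 0" by (subst Min_gr_iff) auto
  moreover have "x i = 0 \<or> \<bar>x i\<bar> \<ge> Min ?Z" for i
    by (cases "x i = 0") (auto intro!: Min_le)
  ultimately show thesis using that by blast
qed

lemma mat_mult_vec: "mat c *v v = c *s v" for c :: complex and v :: "complex^'n"
  by (simp add: vec_eq_iff matrix_vector_mult_def mat_def if_distrib if_distribR cong: if_cong)

text \<open>Otherwise \<open>Q *v v\<close> would be an eigenvector in the range of
  \<open>Q\<close>, evolving like e^{\<mu> t}, too slowly for decay at rate \<beta>.\<close>

lemma eigenvector_not_in_decaying_range: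
  fixes B Q :: "complex^'n^'n"
  assumes decay: "\<And>t. t \<ge> 0 \<Longrightarrow> norm (mexp B t ** Q) \<le> K * exp (- \<beta> * t)"
    and \<beta>: "\<beta> > 0" "Re \<mu> \<ge> - \<beta> / 2" and BQ: "B ** Q = Q ** B" and QQ: "Q ** Q = Q"
    and v: "B *v v = \<mu> *s v"
  shows "Q *v v = 0"
proof (rule ccontr)
  assume nz: "Q *v v \<noteq> 0"
  \<comment> \<open>A square matrix with all columns equal to this vector, so that the rules for
    \<open>mexp\<close> and the Frobenius norm apply directly.\<close>
  define M where "M = (\<chi> i j::'n. (Q *v v) $ i)"
  have col: "column j M = Q *v v" for j by (simp add: M_def column_def vec_eq_iff)
  have "B *v (Q *v v) = \<mu> *s (Q *v v)"
    by (simp add: matrix_vector_mul_assoc BQ) (simp add: v vector_scalar_commute flip: matrix_vector_mul_assoc)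
  then have BM: "B ** M = mat \<mu> ** M" by (intro matrix_eq_columnsI) (simp add: column_mult col mat_mult_vec)
  have QM: "Q ** M = M" by (intro matrix_eq_columnsI) (simp add: column_mult col matrix_vector_mul_assoc QQ)
  have M: "norm M > 0" using nz by (auto simp: M_def vec_eq_iff)
  have K: "K \<ge> 0" using order_trans[OF norm_ge_zero decay[of 0]] by simp
  \<comment> \<open>Chosen so that (Re \<mu> + \<beta>) t is at least \<beta> t / 2 = K; decay would
    force the exponential of this number to be at most K, against e^x \<ge> 1 + x.\<close>
  define t where "t = 2 * K / \<beta>"
  have t: "t \<ge> 0" using K \<beta> by (simp add: t_def)
  have "exp (Re \<mu> * t) * norm M = norm (mexp B t ** Q ** M)"
    by (simp add: QM mexp_mult_eigen[OF BM] flip: matrix_mul_assoc)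
  also have "\<dots> \<le> norm (mexp B t ** Q) * norm M" by (rule norm_matrix_mult_le)
  also have "\<dots> \<le> K * exp (- \<beta> * t) * norm M" by (intro mult_right_mono decay t) simp
  finally have "exp (Re \<mu> * t) \<le> K * exp (- \<beta> * t)" using M by simp
  then have "exp (Re \<mu> * t) * exp (\<beta> * t) \<le> K * (exp (- \<beta> * t) * exp (\<beta> * t))"
    by (simp add: mult.assoc[symmetric])
  then have "exp ((Re \<mu> + \<beta>) * t) \<le> K" by (simp add: algebra_simps flip: exp_add)
  moreover have "K \<le> (Re \<mu> + \<beta>) * t"
  proof -
    have "K = \<beta> / 2 * t" using \<beta> by (simp add: t_def)
    also have "\<dots> \<le> (Re \<mu> + \<beta>) * t" using \<beta> t by (intro mult_right_mono) auto
    finally show ?thesis .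
  qed
  ultimately show False using exp_ge_add_one_self[of "(Re \<mu> + \<beta>) * t"] by linarith
qed

section \<open>Persistence of the spectral splitting near the base point\<close>

lemma matrix_holomorphic_tendsto:
  assumes "matrix_holomorphic_on F U" "open U" "z \<in> U"
  shows "(F \<longlongrightarrow> F z) (nhds z)"
proof -
  have "((\<lambda>z. F z $ i $ j) \<longlongrightarrow> F z $ i $ j) (nhds z)" for i j
  proof -
    have "continuous_on U (\<lambda>z. F z $ i $ j)"
      using assms(1) by (simp add: matrix_holomorphic_on_def holomorphic_on_imp_continuous_on)
    then have "isCont (\<lambda>z. F z $ i $ j) z" using assms by (simp add: continuous_on_eq_continuous_at)
    then show ?thesis unfolding isCont_def using tendsto_at_iff_tendsto_nhds by blast
  qed
  then show ?thesis by (intro vec_tendstoI)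
qed

lemma eventually_entry_near:
  fixes F :: "'a \<Rightarrow> complex^'n^'n"
  assumes "(F \<longlongrightarrow> M) net" "\<epsilon> > 0"
  shows "\<forall>\<^sub>F z in net. \<forall>i j. norm (F z $ i $ j - M $ i $ j) \<le> \<epsilon>"
  using tendstoD[OF assms]
proof eventually_elim
  case (elim z)
  show ?case
  proof (intro allI)
    fix i j
    show "norm (F z $ i $ j - M $ i $ j) \<le> \<epsilon>"
      using norm_entry_le[of "F z - M" i j] elim by (simp add: dist_norm)
  qed
qed

text \<open>Only algebraic relations are recorded: away from the base point the spectral sets of the
  projections are merely known to exist, and the determinant computation never refers to
  them.\<close>

definition spectral_splitting ::
  "complex^'n^'n \<Rightarrow> complex^'n^'n \<Rightarrow> complex^'n^'n \<Rightarrow> complex^'n^'n \<Rightarrow> bool" where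
  "spectral_splitting B Q1 Q2 Q3 \<longleftrightarrow> Q1 + Q2 + Q3 = mat 1 \<and>
    Q1 ** Q1 = Q1 \<and> Q2 ** Q2 = Q2 \<and> Q3 ** Q3 = Q3 \<and>
    Q1 ** Q2 = 0 \<and> Q2 ** Q1 = 0 \<and> Q1 ** Q3 = 0 \<and> Q3 ** Q1 = 0 \<and> Q2 ** Q3 = 0 \<and> Q3 ** Q2 = 0 \<and>
    B ** Q1 = Q1 ** B \<and> B ** Q2 = Q2 ** B \<and> B ** Q3 = Q3 ** B"

lemma spectral_projection_idem: "is_spectral_projection B \<Omega> Q \<Longrightarrow> Q ** Q = Q"
  by (simp add: is_spectral_projection_def)

text \<open>Spectral projections of the same matrix commute, so their products are idempotent and
  vanish when small. After that the complement of their sum is idempotent and small as well.\<close>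

lemma spectral_splittingI:
  fixes B :: "complex^'n^'n"
  assumes Q: "is_spectral_projection B \<Omega>1 Q1" "is_spectral_projection B \<Omega>2 Q2" "is_spectral_projection B \<Omega>3 Q3"
    and small: "norm (Q1 ** Q2) < 1" "norm (Q1 ** Q3) < 1" "norm (Q2 ** Q3) < 1" "norm (mat 1 - (Q1 + Q2 + Q3)) < 1"
  shows "spectral_splitting B Q1 Q2 Q3"
proof -
  have zero: "P ** P' = 0 \<and> P' ** P = 0"
    if "is_spectral_projection B \<Omega> P" "is_spectral_projection B \<Omega>' P'" "norm (P ** P') < 1" for P P' \<Omega> \<Omega>'
  proof -
    have c: "P ** P' = P' ** P" by (rule spectral_projections_commute[OF that(1,2)])
    have "(P ** P') ** (P ** P') = P ** (P' ** P) ** P'" by (simp add: matrix_mul_assoc)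
    also have "\<dots> = (P ** P) ** (P' ** P')" unfolding c[symmetric] by (simp add: matrix_mul_assoc)
    also have "\<dots> = P ** P'" by (simp add: spectral_projection_idem[OF that(1)] spectral_projection_idem[OF that(2)])
    finally have "P ** P' = 0" by (rule projection_norm_less_1[OF _ that(3)])
    with c show ?thesis by simp
  qed
  note z = zero[OF Q(1,2) small(1)] zero[OF Q(1,3) small(2)] zero[OF Q(2,3) small(3)]
  note i = Q[THEN spectral_projection_idem]
  have "(mat 1 - (Q1 + Q2 + Q3)) ** (mat 1 - (Q1 + Q2 + Q3)) = mat 1 - (Q1 + Q2 + Q3)"
    by (simp add: matrix_distribs z i)
  from projection_norm_less_1[OF this small(4)] have "Q1 + Q2 + Q3 = mat 1" by simp
  then show ?thesis
    using z i Q[THEN spectral_projection_commutes_self] by (simp add: spectral_splitting_def)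
qed

lemma analytic_spectral_projectionD:
  assumes "analytic_spectral_projection B U zs \<Omega> Q"
  shows "matrix_holomorphic_on Q U" "z \<in> U \<Longrightarrow> \<exists>\<Omega>'. is_spectral_projection (B z) \<Omega>' (Q z)"
    "is_spectral_projection (B zs) \<Omega> (Q zs)"
  using assms by (auto simp: analytic_spectral_projection_def)

lemma card_basis_columns: "basis_columns R J V \<Longrightarrow> card J = vec.dim V"
  unfolding basis_columns_def
  by (metis card_image vec.dim_eq_card_independent vec.dim_span)

text \<open>Simplicity leaves exactly one index \<open>k\<close> with d_k = \<mu>, and each d_j is
  an eigenvalue, so no other d_j is purely imaginary. In the coordinates \<open>S\<close> the
  projection has a single nonzero entry, at (k, k).\<close>

lemma center_dimension:
  fixes B Q S S' :: "complex^'n^'n" and d :: "'n \<Rightarrow> complex"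
  assumes Q: "is_spectral_projection B {z. Re z = 0} Q"
    and nd: "\<And>\<delta>. \<delta> > 0 \<Longrightarrow> \<exists>S S' :: complex^'n^'n. S' ** S = mat 1 \<and> (\<forall>j. column j S \<in> gen_eigenspace B (d j)) \<and>
    (\<forall>i j. norm ((S' ** B ** S) $ i $ j - (if i = j then d i else 0)) \<le> \<delta>)"
    and simple: "simple_eigenvalue B \<mu>" and Re: "Re \<mu> = 0"
    and only: "\<And>\<nu>. eigenvalue B \<nu> \<Longrightarrow> \<nu> \<noteq> \<mu> \<Longrightarrow> Re \<nu> \<noteq> 0"
  shows "vec.dim (range ((*v) Q)) = 1"
proof -
  have "order \<mu> (charpoly B) = card {i. d i = \<mu>}"
    by (rule order_charpoly) (use nd in blast)
  then have "card {i. d i = \<mu>} = 1" using simple by (simp add: simple_eigenvalue_def)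
  then obtain k where k: "{i. d i = \<mu>} = {k}" by (rule card_1_singletonE)
  obtain S S' :: "complex^'n^'n" where S: "S' ** S = mat 1" "\<And>j. column j S \<in> gen_eigenspace B (d j)"
    using nd[of 1] by auto
  have SS': "S ** S' = mat 1" using S(1) matrix_left_right_inverse by blast
  have Sj: "S' *v column j S = column j (mat 1)" for j by (simp add: S(1) flip: column_mult)
  have "column j (mat 1 :: complex^'n^'n) $ j = 1" for j by (simp add: column_def mat_def)
  then have nz: "column j S \<noteq> 0" for j
    using Sj[of j] by (metis matrix_vector_mult_0_right zero_index zero_neq_one)
  have dk: "d j = \<mu> \<longleftrightarrow> j = k" for j using k by auto
  have dj: "Re (d j) = 0 \<longleftrightarrow> j = k" for j
    using only[OF gen_eigenspace_imp_eigenvalue[OF S(2) nz], of j] dk[of j] Re by auto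
  have rep: "Q *v v = (S' *v v) $ k *s column k S" for v
  proof -
    have "Q *v v = S *v ((S' ** Q ** S) *v (S' *v v))"
      by (simp add: matrix_vector_mul_assoc matrix_mul_assoc SS') (simp add: SS' flip: matrix_mul_assoc)
    also have "(S' ** Q ** S) *v (S' *v v) = (\<chi> i. if i = k then (S' *v v) $ k else 0)"
      unfolding spectral_projection_diagonal[OF Q S]
    proof -
      have "(\<Sum>j\<in>UNIV. (if i = j \<and> P then 1 else 0) * w j) = (if P then w i else 0)" for i :: 'n and P and w :: "'n \<Rightarrow> complex"
        by (cases P) (simp_all add: mult_delta_left)
      then show "(\<chi> i j. if i = j \<and> d i \<in> {z. Re z = 0} then 1 else 0) *v (S' *v v) = (\<chi> i. if i = k then (S' *v v) $ k else 0)"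
        by (simp add: vec_eq_iff matrix_vector_mult_def[of _ "S' *v v"] dj)
    qed
    also have "S *v \<dots> = (S' *v v) $ k *s column k S"
      by (simp add: vec_eq_iff matrix_vector_mult_def[of S] column_def if_distrib if_distribR mult.commute cong: if_cong)
    finally show ?thesis .
  qed
  have "Q *v column k S = column k S"
    using rep[of "column k S"] by (simp add: Sj) (simp add: column_def mat_def)
  then have "column k S \<in> range ((*v) Q)" by (metis rangeI)
  then have "{column k S} \<subseteq> range ((*v) Q)" by simp
  moreover have "range ((*v) Q) \<subseteq> vec.span {column k S}"
    using rep vec.span_base vec.span_scale by (auto simp: vec.span_singleton)
  moreover have "vec.independent {column k S}" using nz by simp
  ultimately show ?thesis using vec.basis_card_eq_dim[of "{column k S}" "range ((*v) Q)"] by simp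
qed

text \<open>Links the analytic eigenvalue to the center projection away from the base point. An
  eigenvector for a nearly imaginary eigenvalue has no component in the two ranges of exponential
  decay, hence lies in the one-dimensional range of \<open>Q2\<close> and spans it.\<close>

lemma center_eigenvalue:
  fixes B Q1 Q2 Q3 :: "complex^'n^'n"
  assumes split: "spectral_splitting B Q1 Q2 Q3"
    and dim: "vec.dim (range ((*v) Q2)) = 1"
    and d3: "\<And>t. t \<ge> 0 \<Longrightarrow> norm (mexp B t ** Q3) \<le> K * exp (- \<beta> * t)"
    and d1: "\<And>t. t \<ge> 0 \<Longrightarrow> norm (mexp B (- t) ** Q1) \<le> K * exp (- \<beta> * t)"
    and \<beta>: "\<beta> > 0" "\<bar>Re \<mu>\<bar> \<le> \<beta> / 2" and ev: "eigenvalue B \<mu>"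
  shows "B ** Q2 = mat \<mu> ** Q2"
proof -
  note s = split[unfolded spectral_splitting_def]
  obtain v where v: "v \<noteq> 0" "B *v v = \<mu> *s v" using ev by (auto simp: eigenvalue_def)
  have "Q3 *v v = 0"
    by (rule eigenvector_not_in_decaying_range[OF d3 _ _ _ _ v(2)]) (use s \<beta> in auto)
  moreover have "Q1 *v v = 0"
  proof (rule eigenvector_not_in_decaying_range[of "- B"])
    show "norm (mexp (- B) t ** Q1) \<le> K * exp (- \<beta> * t)" if "t \<ge> 0" for t using d1[OF that] by (simp add: mexp_uminus)
    show "- B *v v = (- \<mu>) *s v" using v(2) by (simp add: vec_eq_iff matrix_vector_mult_def sum_negf)
  qed (use s \<beta> in \<open>auto simp: matrix_minus_left matrix_minus_right\<close>)
  moreover have "v = Q1 *v v + Q2 *v v + Q3 *v v"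
    using s by (metis matrix_vector_mul_lid matrix_vector_mult_add_rdistrib)
  ultimately have Qv: "Q2 *v v = v" by simp
  have "{v} \<subseteq> range ((*v) Q2)" using Qv by (metis empty_subsetI insert_subset rangeI)
  moreover have "vec.independent {v}" using v by simp
  ultimately have span: "range ((*v) Q2) \<subseteq> vec.span {v}"
    using dim by (intro vec.card_ge_dim_independent) auto
  have "B *v (Q2 *v w) = \<mu> *s (Q2 *v w)" for w
  proof -
    obtain k where "Q2 *v w = k *s v" using span by (auto simp: vec.span_singleton)
    then show ?thesis by (simp add: vector_scalar_commute v mult.commute)
  qed
  then show ?thesis
    by (simp add: matrix_eq mat_mult_vec flip: matrix_vector_mul_assoc)
qed

text \<open>The order of quantifiers matters: coordinates, gaps, \<delta>, the rate \<beta> and the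
  bound \<open>K\<close> are fixed first, and only the neighborhood depends on \<omega>. So \<omega>
  can later be chosen in terms of \<beta>.\<close>

lemma isolated_arc_local_structure:
  fixes Ainf Qsu Qc Qss :: "complex \<Rightarrow> complex^'n^'n"
  assumes U: "open U" "zs \<in> U"
    and arc: "isolated_arc Ainf U lam ks zs \<mu>c"
    and Qc: "analytic_spectral_projection Ainf U zs {z. Re z = 0} Qc"
    and Qss: "analytic_spectral_projection Ainf U zs {z. Re z < 0} Qss"
    and Qsu: "analytic_spectral_projection Ainf U zs {z. Re z > 0} Qsu"
    and dim: "\<And>z. z \<in> U \<Longrightarrow> vec.dim (range ((*v) (Qc z))) = vec.dim (range ((*v) (Qc zs)))"
    and cont: "(Ainf \<longlongrightarrow> Ainf zs) (nhds zs)" and \<kappa>0: "\<kappa>0 > 0"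
  obtains d :: "'n \<Rightarrow> complex" and \<kappa> \<delta> \<beta> K :: real and S S' :: "complex^'n^'n"
  where "0 < \<kappa>" "\<kappa> \<le> \<kappa>0" "\<And>i j. Re (d i - d j) \<ge> 0 \<or> Re (d i - d j) \<le> - 2 * \<kappa>"
    "S' ** S = mat 1" "of_nat CARD('n) * (2 * \<delta>) \<le> \<kappa> / 4" "\<beta> > 0" "K \<ge> 1"
    "vec.dim (range ((*v) (Qc zs))) = 1"
    "\<And>\<omega>. \<omega> > 0 \<Longrightarrow> \<forall>\<^sub>F z in nhds zs. z \<in> U \<and>
      (\<forall>i j. norm ((S' ** Ainf z ** S) $ i $ j - (if i = j then d i else 0)) \<le> \<delta>) \<and>
      \<bar>Re (\<mu>c z)\<bar> \<le> \<omega> \<and> spectral_splitting (Ainf z) (Qsu z) (Qc z) (Qss z) \<and>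
      Ainf z ** Qc z = mat (\<mu>c z) ** Qc z \<and>
      (\<forall>t\<ge>0. norm (mexp (Ainf z) t ** Qss z) \<le> K * exp (- \<beta> * t)) \<and>
      (\<forall>t\<ge>0. norm (mexp (Ainf z) (- t) ** Qsu z) \<le> K * exp (- \<beta> * t)) \<and>
      norm (Qsu z) \<le> K \<and> norm (Qc z) \<le> K \<and> norm (Qss z) \<le> K"
proof -
  let ?n = "of_nat CARD('n) :: real"
  note arc' = arc[unfolded isolated_arc_def]
  note Pc = analytic_spectral_projectionD[OF Qc] and Ps = analytic_spectral_projectionD[OF Qss]
    and Pu = analytic_spectral_projectionD[OF Qsu]
  obtain d where nd: "\<And>\<delta>. \<delta> > 0 \<Longrightarrow> \<exists>S S' :: complex^'n^'n. S' ** S = mat 1 \<and>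
    (\<forall>j. column j S \<in> gen_eigenspace (Ainf zs) (d j)) \<and>
    (\<forall>i j. norm ((S' ** Ainf zs ** S) $ i $ j - (if i = j then d i else 0)) \<le> \<delta>)"
    using near_diagonalization[OF spectral_projection_span[OF Pc(3)]] by metis
  obtain b where b: "b > 0" "\<And>i. Re (d i) = 0 \<or> \<bar>Re (d i)\<bar> \<ge> b"
    using finite_min_nonzero_abs[of "\<lambda>i. Re (d i)"] by metis
  obtain m where m: "m > 0" "\<And>p. Re (d (fst p) - d (snd p)) = 0 \<or> \<bar>Re (d (fst p) - d (snd p))\<bar> \<ge> m"
    using finite_min_nonzero_abs[of "\<lambda>p. Re (d (fst p) - d (snd p))"] by metis
  \<comment> \<open>A negative difference of real parts is at most -m, hence at most -2\<kappa>, and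
    stays below -\<kappa> under the weight.\<close>
  define \<kappa> where "\<kappa> = min \<kappa>0 (m / 2)"
  have \<kappa>: "0 < \<kappa>" "\<kappa> \<le> \<kappa>0" "2 * \<kappa> \<le> m" using \<kappa>0 m by (auto simp: \<kappa>_def)
  have gap: "Re (d i - d j) \<ge> 0 \<or> Re (d i - d j) \<le> - 2 * \<kappa>" for i j
    using m(2)[of "(i, j)"] \<kappa> by auto
  define b' where "b' = (\<Sum>i\<in>UNIV. \<bar>Re (d i)\<bar>)"
  have b': "b' \<ge> 0" by (simp add: b'_def sum_nonneg)
  have "\<bar>Re (d i)\<bar> \<le> b'" for i unfolding b'_def by (rule member_le_sum) auto
  then have b'd: "Re (d i) \<le> b'" "- Re (d i) \<le> b'" for i by (auto simp: abs_le_iff)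
  have n: "?n > 0" by simp
  \<comment> \<open>The first bound serves the conjugation, the second the dissipativity estimate,
    where it may use b/4; the tolerance \<open>e\<close> for the projections uses the other
    b/4.\<close>
  define \<delta> where "\<delta> = min (\<kappa> / (8 * ?n)) (b / (4 * ?n\<^sup>2))"
  have \<delta>: "\<delta> > 0" using \<kappa> b n by (simp add: \<delta>_def)
  have \<delta>1: "?n * (2 * \<delta>) \<le> \<kappa> / 4"
  proof -
    have "?n * (2 * \<delta>) \<le> ?n * (2 * (\<kappa> / (8 * ?n)))" using n by (intro mult_left_mono) (auto simp: \<delta>_def)
    then show ?thesis by simp
  qed
  have \<delta>2: "?n\<^sup>2 * \<delta> \<le> b / 4"
  proof -
    have "?n\<^sup>2 * \<delta> \<le> ?n\<^sup>2 * (b / (4 * ?n\<^sup>2))" using n by (intro mult_left_mono) (auto simp: \<delta>_def)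
    then show ?thesis by simp
  qed
  define e where "e = min 1 (b / (4 * ((b + b') * ?n\<^sup>2)))"
  have bb: "(b + b') * ?n\<^sup>2 > 0" using b b' by simp
  have e: "e > 0" "e \<le> 1" using b bb by (auto simp: e_def)
  have "(b + b') * (?n\<^sup>2 * e\<^sup>2) \<le> ((b + b') * ?n\<^sup>2) * e"
    using mult_left_mono[of "e * e" e "(b + b') * ?n\<^sup>2"] e bb
    by (simp add: power2_eq_square[of e] mult.assoc)
  also have "\<dots> \<le> ((b + b') * ?n\<^sup>2) * (b / (4 * ((b + b') * ?n\<^sup>2)))"
    using bb by (intro mult_left_mono) (auto simp: e_def)
  also have "\<dots> = b / 4" using b b' by simp
  finally have small: "(b + b') * (?n\<^sup>2 * e\<^sup>2) + ?n\<^sup>2 * \<delta> \<le> b / 2" using \<delta>2 by simp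
  \<comment> \<open>Only \<delta>/2 is used at the base point, leaving \<delta>/2 for the variation
    of the limiting matrix nearby.\<close>
  obtain S S' :: "complex^'n^'n" where S: "S' ** S = mat 1" "\<And>j. column j S \<in> gen_eigenspace (Ainf zs) (d j)"
    "\<And>i j. norm ((S' ** Ainf zs ** S) $ i $ j - (if i = j then d i else 0)) \<le> \<delta> / 2"
    using nd[of "\<delta> / 2"] \<delta> by auto
  have SS': "S ** S' = mat 1" using S(1) matrix_left_right_inverse by blast
  have dim1: "vec.dim (range ((*v) (Qc zs))) = 1"
    by (rule center_dimension[OF Pc(3) nd, of "\<i> * of_real ks"]) (use arc' in auto)
  note lim = matrix_holomorphic_tendsto[OF Pu(1) U] matrix_holomorphic_tendsto[OF Pc(1) U]
    matrix_holomorphic_tendsto[OF Ps(1) U]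
  have conj_lim: "((\<lambda>z. S' ** F z ** S) \<longlongrightarrow> S' ** F zs ** S) (nhds zs)" if "(F \<longlongrightarrow> F zs) (nhds zs)" for F
    by (intro tendsto_matrix_mult tendsto_const that)
  have near_B: "\<forall>\<^sub>F z in nhds zs. \<forall>i j. norm ((S' ** Ainf z ** S) $ i $ j - (if i = j then d i else 0)) \<le> \<delta>"
    using eventually_entry_near[OF conj_lim[OF cont] half_gt_zero[OF \<delta>]]
  proof eventually_elim
    case (elim z)
    show ?case
    proof (intro allI)
      fix i j
      show "norm ((S' ** Ainf z ** S) $ i $ j - (if i = j then d i else 0)) \<le> \<delta>"
        using norm_diff_triangle_le[OF elim[rule_format, of i j] S(3)[of i j]] by simp
    qed
  qed
  have mask: "S' ** Q zs ** S = (\<chi> i j. if i = j \<and> d i \<in> \<Omega> then 1 else 0)"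
    if "analytic_spectral_projection Ainf U zs \<Omega> Q" for Q \<Omega>
    by (rule spectral_projection_diagonal[OF analytic_spectral_projectionD(3)[OF that] S(1,2)])
  have near_Q: "\<forall>\<^sub>F z in nhds zs. \<forall>i j. norm ((S' ** Q z ** S) $ i $ j - (if i = j \<and> i \<in> {i. d i \<in> \<Omega>} then 1 else 0)) \<le> e"
    if "analytic_spectral_projection Ainf U zs \<Omega> Q" for Q \<Omega>
    using eventually_entry_near[OF conj_lim[OF matrix_holomorphic_tendsto[OF analytic_spectral_projectionD(1)[OF that] U]] e(1)]
    by (simp add: mask[OF that])
  define K0 where "K0 = norm (Qsu zs) + norm (Qc zs) + norm (Qss zs) + 1"
  have near_norm: "\<forall>\<^sub>F z in nhds zs. norm (Q z) < K0"
    if "(Q \<longlongrightarrow> Q zs) (nhds zs)" "norm (Q zs) < K0" for Q :: "complex \<Rightarrow> complex^'n^'n"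
    using tendsto_norm[OF that(1)] that(2) by (rule order_tendstoD)
  have K0: "norm (Qsu zs) < K0" "norm (Qc zs) < K0" "norm (Qss zs) < K0" "K0 \<ge> 1"
    using norm_ge_zero[of "Qsu zs"] norm_ge_zero[of "Qc zs"] norm_ge_zero[of "Qss zs"]
    unfolding K0_def by linarith+
  \<comment> \<open>At the base point both projections are 0-1 diagonal matrices in the coordinates
    \<open>S\<close>, with disjoint supports, so their product vanishes there.\<close>
  have near_prod: "\<forall>\<^sub>F z in nhds zs. norm (Q z ** Q' z) < 1"
    if "analytic_spectral_projection Ainf U zs \<Omega> Q" "analytic_spectral_projection Ainf U zs \<Omega>' Q'" "\<Omega> \<inter> \<Omega>' = {}" for Q Q' \<Omega> \<Omega>'
  proof -
    have z0: "Q zs ** Q' zs = 0"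
    proof -
      have "S ** ((S' ** Q zs ** S) ** (S' ** Q' zs ** S)) ** S' = (S ** S') ** Q zs ** (S ** S') ** Q' zs ** (S ** S')"
        by (simp add: matrix_mul_assoc)
      then have "Q zs ** Q' zs = S ** ((S' ** Q zs ** S) ** (S' ** Q' zs ** S)) ** S'" by (simp add: SS')
      also have "(S' ** Q zs ** S) ** (S' ** Q' zs ** S) = 0"
        unfolding mask[OF that(1)] mask[OF that(2)]
        using that(3) by (auto simp: vec_eq_iff matrix_matrix_mult_def intro!: sum.neutral)
      finally show ?thesis by simp
    qed
    have "((\<lambda>z. norm (Q z ** Q' z)) \<longlongrightarrow> norm (Q zs ** Q' zs)) (nhds zs)"
      by (intro tendsto_norm tendsto_matrix_mult matrix_holomorphic_tendsto[OF _ U]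
          analytic_spectral_projectionD(1)[OF that(1)] analytic_spectral_projectionD(1)[OF that(2)])
    then show ?thesis by (rule order_tendstoD) (simp add: z0)
  qed
  have prods: "\<forall>\<^sub>F z in nhds zs. norm (Qsu z ** Qc z) < 1" "\<forall>\<^sub>F z in nhds zs. norm (Qsu z ** Qss z) < 1"
    "\<forall>\<^sub>F z in nhds zs. norm (Qc z ** Qss z) < 1"
    by (rule near_prod[OF Qsu Qc] near_prod[OF Qsu Qss] near_prod[OF Qc Qss]; force)+
  have near_sum: "\<forall>\<^sub>F z in nhds zs. norm (mat 1 - (Qsu z + Qc z + Qss z)) < 1"
  proof -
    have z0: "mat 1 - (Qsu zs + Qc zs + Qss zs) = 0"
    proof -
      have "mat 1 - (Qsu zs + Qc zs + Qss zs)
        = S ** (mat 1 - (S' ** Qsu zs ** S + S' ** Qc zs ** S + S' ** Qss zs ** S)) ** S'"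
        by (simp add: matrix_distribs matrix_mul_assoc SS') (simp add: SS' flip: matrix_mul_assoc)
      also have "mat 1 - (S' ** Qsu zs ** S + S' ** Qc zs ** S + S' ** Qss zs ** S) = 0"
        unfolding mask[OF Qsu] mask[OF Qc] mask[OF Qss] by (auto simp: vec_eq_iff mat_def)
      finally show ?thesis by simp
    qed
    have "((\<lambda>z. norm (mat 1 - (Qsu z + Qc z + Qss z))) \<longlongrightarrow> norm (mat 1 - (Qsu zs + Qc zs + Qss zs))) (nhds zs)"
      by (intro tendsto_norm tendsto_diff tendsto_add tendsto_const lim)
    then show ?thesis by (rule order_tendstoD) (simp add: z0)
  qed
  have near_\<mu>: "\<forall>\<^sub>F z in nhds zs. \<bar>Re (\<mu>c z)\<bar> < \<omega>" if "\<omega> > 0" for \<omega>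
  proof -
    have "continuous_on U \<mu>c" using arc' by (simp add: holomorphic_on_imp_continuous_on)
    then have "isCont \<mu>c zs" using U by (simp add: continuous_on_eq_continuous_at)
    then have "(\<mu>c \<longlongrightarrow> \<mu>c zs) (nhds zs)" unfolding isCont_def using tendsto_at_iff_tendsto_nhds by blast
    then have "((\<lambda>z. \<bar>Re (\<mu>c z)\<bar>) \<longlongrightarrow> \<bar>Re (\<mu>c zs)\<bar>) (nhds zs)" by (intro tendsto_intros)
    then show ?thesis by (rule order_tendstoD) (use arc' that in simp)
  qed
  define c where "c = (norm S * norm S')\<^sup>2"
  define K where "K = (1 + c) * K0"
  have c: "c \<ge> 0" by (simp add: c_def)
  have KK: "K \<ge> 1" "K0 \<le> K" "c * K0 \<le> K" using c K0(4) by (auto simp: K_def algebra_simps intro: add_increasing2)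
  show thesis
  proof (rule that[OF \<kappa>(1,2) gap S(1) \<delta>1 _ KK(1) dim1, of "b / 2"])
    show "b / 2 > 0" using b by simp
    fix \<omega> :: real assume \<omega>: "\<omega> > 0"
    \<comment> \<open>The decay rate is b/2, and identifying the center eigenvalue needs its real
      part to be at most half of that rate.\<close>
    have "min \<omega> (b / 4) > 0" using \<omega> b by simp
    note ev = near_\<mu>[OF this] near_B near_Q[OF Qss] near_Q[OF Qsu] near_norm[OF lim(1) K0(1)]
      near_norm[OF lim(2) K0(2)] near_norm[OF lim(3) K0(3)] prods near_sum eventually_nhds_in_open[OF U]
    from ev show "\<forall>\<^sub>F z in nhds zs. z \<in> U \<and>
      (\<forall>i j. norm ((S' ** Ainf z ** S) $ i $ j - (if i = j then d i else 0)) \<le> \<delta>) \<and>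
      \<bar>Re (\<mu>c z)\<bar> \<le> \<omega> \<and> spectral_splitting (Ainf z) (Qsu z) (Qc z) (Qss z) \<and>
      Ainf z ** Qc z = mat (\<mu>c z) ** Qc z \<and>
      (\<forall>t\<ge>0. norm (mexp (Ainf z) t ** Qss z) \<le> K * exp (- (b / 2) * t)) \<and>
      (\<forall>t\<ge>0. norm (mexp (Ainf z) (- t) ** Qsu z) \<le> K * exp (- (b / 2) * t)) \<and>
      norm (Qsu z) \<le> K \<and> norm (Qc z) \<le> K \<and> norm (Qss z) \<le> K"
    proof eventually_elim
      case (elim z)
      have zU: "z \<in> U" by (rule elim)
      obtain \<Omega>1 \<Omega>2 \<Omega>3 where "is_spectral_projection (Ainf z) \<Omega>1 (Qsu z)"
        "is_spectral_projection (Ainf z) \<Omega>2 (Qc z)" "is_spectral_projection (Ainf z) \<Omega>3 (Qss z)"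
        using Pu(2)[OF zU] Pc(2)[OF zU] Ps(2)[OF zU] by blast
      then have split: "spectral_splitting (Ainf z) (Qsu z) (Qc z) (Qss z)"
        by (rule spectral_splittingI) (use elim in auto)
      note s = split[unfolded spectral_splitting_def]
      have dec: "c * norm Q * exp (- b / 2 * t) \<le> K * exp (- (b / 2) * t)" if "norm Q < K0" for t and Q :: "complex^'n^'n"
      proof -
        have "c * norm Q \<le> c * K0" using c that by (intro mult_left_mono) auto
        also have "\<dots> \<le> K" by (rule KK)
        finally show ?thesis by (simp add: mult_right_mono)
      qed
      have d3: "norm (mexp (Ainf z) t ** Qss z) \<le> K * exp (- (b / 2) * t)" if "t \<ge> 0" for t
      proof -
        have "norm (mexp (Ainf z) t ** Qss z) \<le> (norm S * norm S')\<^sup>2 * norm (Qss z) * exp (- b / 2 * t)"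
        proof (rule mexp_decay_similar[OF S(1) _ _ _ b'd(1) small _ b' _ _ that, where I = "{i. d i \<in> {z. Re z < 0}}"])
          show "Re (d i) \<le> - b" if "i \<in> {i. d i \<in> {z. Re z < 0}}" for i using b(2)[of i] that by auto
        qed (use elim s b in auto)
        then show ?thesis by (rule order_trans[OF _ dec[unfolded c_def]]) (use elim in auto)
      qed
      have d1: "norm (mexp (Ainf z) (- t) ** Qsu z) \<le> K * exp (- (b / 2) * t)" if "t \<ge> 0" for t
      proof -
        \<comment> \<open>Backward decay on the unstable range is forward decay for the negated
          matrix, whose almost diagonal form has entries -d_i in the same coordinates.\<close>
        have "norm (mexp (- Ainf z) t ** Qsu z) \<le> (norm S * norm S')\<^sup>2 * norm (Qsu z) * exp (- b / 2 * t)"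
        proof (rule mexp_decay_similar[where d = "\<lambda>i. - d i", OF S(1) _ _ _ _ small _ b' _ _ that, where I = "{i. d i \<in> {z. Re z > 0}}"])
          show "Re (- d i) \<le> - b" if "i \<in> {i. d i \<in> {z. Re z > 0}}" for i using b(2)[of i] that by auto
          show "Re (- d i) \<le> b'" for i using b'd(2)[of i] by simp
          show "norm ((S' ** - Ainf z ** S) $ i $ j - (if i = j then - d i else 0)) \<le> \<delta>" for i j
          proof -
            have "(S' ** - Ainf z ** S) $ i $ j - (if i = j then - d i else 0)
               = - ((S' ** Ainf z ** S) $ i $ j - (if i = j then d i else 0))"
              by (simp add: matrix_minus_left matrix_minus_right)
            then show ?thesis using elim(2) by (simp only: norm_minus_cancel)
          qed
        qed (use elim s b in \<open>auto simp: matrix_minus_left matrix_minus_right\<close>)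
        then show ?thesis
          unfolding mexp_uminus by (rule order_trans[OF _ dec[unfolded c_def]]) (use elim in auto)
      qed
      have "Ainf z ** Qc z = mat (\<mu>c z) ** Qc z"
        by (rule center_eigenvalue[OF split _ d3 d1]) (use elim b arc' zU dim[OF zU] dim1 in auto)
      then show ?case using zU split d1 d3 elim KK by auto
    qed
  qed
qed

section \<open>The transition determinant\<close>

text \<open>Applied to the columns of \<open>R\<close>, the matrix gives P R_j on \<open>J1\<close>,
  -g Q R_j on \<open>J3\<close>, and (a P - a' Q) R_k in the single center column \<open>k\<close>.
  Linearity of the determinant in that one column produces the two extensions, in which the center
  column is carried by P or by Q.\<close>

lemma det_transition_columns:
  fixes P Q R :: "complex^'n^'n" and Q1 Q2 Q3 :: "complex^'n^'n"
  assumes J: "J1 \<union> J2 \<union> J3 = UNIV" "J1 \<inter> J2 = {}" "J1 \<inter> J3 = {}" "J2 \<inter> J3 = {}" "card J2 = 1"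
    and s: "spectral_splitting B Q1 Q2 Q3"
    and R: "\<And>j. j \<in> J1 \<Longrightarrow> Q1 *v column j R = column j R" "\<And>j. j \<in> J2 \<Longrightarrow> Q2 *v column j R = column j R"
      "\<And>j. j \<in> J3 \<Longrightarrow> Q3 *v column j R = column j R"
  shows "det ((P ** Q1 + (mat a ** P - mat a' ** Q) ** Q2 - mat g ** (Q ** Q3)) ** R)
    = (- g) ^ card J3 * (a * det (\<chi> i j. if j \<in> J1 \<union> J2 then (P ** R) $ i $ j else (Q ** R) $ i $ j)
      - a' * det (\<chi> i j. if j \<in> J1 then (P ** R) $ i $ j else (Q ** R) $ i $ j))"
proof -
  note s' = s[unfolded spectral_splitting_def]
  obtain k where k: "J2 = {k}" using J(5) by (rule card_1_singletonE)
  define W where "W = (\<chi> i j. if j = k then a * (P ** R) $ i $ j - a' * (Q ** R) $ i $ j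
     else if j \<in> J1 then (P ** R) $ i $ j else (Q ** R) $ i $ j)"
  define D where "D = (\<chi> i j. if i = j then if i \<in> J3 then - g else 1 else 0)"
  let ?K = "P ** Q1 + (mat a ** P - mat a' ** Q) ** Q2 - mat g ** (Q ** Q3)"
  have ann: "Qa *v v = 0" if "Qb *v v = v" "Qa ** Qb = 0" for Qa Qb :: "complex^'n^'n" and v
    using matrix_vector_mul_assoc[of Qa Qb v] that by simp
  have KR: "?K *v v = P *v (Q1 *v v) + (a *s (P *v (Q2 *v v)) - a' *s (Q *v (Q2 *v v))) - g *s (Q *v (Q3 *v v))" for v
    by (simp add: matrix_vector_mult_diff_rdistrib matrix_vector_mult_add_rdistrib mat_mult_vec flip: matrix_vector_mul_assoc)
  have "?K ** R = W ** D"
  proof (rule matrix_eq_columnsI)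
    fix j
    have WD: "column j (W ** D) $ i = W $ i $ j * (if j \<in> J3 then - g else 1)" for i
    proof -
      have "column j (W ** D) $ i = (\<Sum>l\<in>UNIV. W $ i $ l * (if l = j then if l \<in> J3 then - g else 1 else 0))"
        by (simp add: D_def column_def matrix_matrix_mult_def)
      also have "\<dots> = W $ i $ j * (if j \<in> J3 then - g else 1)"
        unfolding mult_delta_right by (subst sum.delta) simp_all
      finally show ?thesis .
    qed
    have PR: "(M *v column l R) $ i = (M ** R) $ i $ l" for i l and M :: "complex^'n^'n"
      by (simp add: column_def matrix_vector_mult_def matrix_matrix_mult_def)
    consider "j \<in> J1" "j \<notin> J2" "j \<notin> J3" | "j \<in> J2" "j \<notin> J1" "j \<notin> J3" | "j \<in> J3" "j \<notin> J1" "j \<notin> J2" using J by blast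
    then show "column j (?K ** R) = column j (W ** D)"
    proof cases
      case 1
      have "Q2 *v column j R = 0" "Q3 *v column j R = 0"
        using ann[OF R(1)[OF 1(1)]] s' by auto
      with R(1)[OF 1(1)] have e: "?K *v column j R = P *v column j R" unfolding KR by simp
      show ?thesis using 1 k unfolding vec_eq_iff WD column_mult[of j ?K R] e by (simp add: PR W_def)
    next
      case 2
      have "Q1 *v column j R = 0" "Q3 *v column j R = 0"
        using ann[OF R(2)[OF 2(1)]] s' by auto
      with R(2)[OF 2(1)] have e: "?K *v column j R = a *s (P *v column j R) - a' *s (Q *v column j R)" unfolding KR by simp
      show ?thesis using 2 k unfolding vec_eq_iff WD column_mult[of j ?K R] e by (simp add: PR W_def)
    next
      case 3
      have "Q1 *v column j R = 0" "Q2 *v column j R = 0"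
        using ann[OF R(3)[OF 3(1)]] s' by auto
      with R(3)[OF 3(1)] have e: "?K *v column j R = - (g *s (Q *v column j R))" unfolding KR by simp
      show ?thesis using 3 k unfolding vec_eq_iff WD column_mult[of j ?K R] e by (simp add: PR W_def)
    qed
  qed
  moreover have "det D = (- g) ^ card J3"
  proof -
    have "det D = (\<Prod>i\<in>UNIV. if i \<in> J3 then - g else 1)" by (subst det_diagonal) (auto simp: D_def)
    then show ?thesis by (simp add: prod.If_cases)
  qed
  moreover have "det W = a * det (\<chi> i j. if j \<in> J1 \<union> J2 then (P ** R) $ i $ j else (Q ** R) $ i $ j)
      - a' * det (\<chi> i j. if j \<in> J1 then (P ** R) $ i $ j else (Q ** R) $ i $ j)"
  proof -
    define rP where "rP j = column j (P ** R)" for j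
    define rQ where "rQ j = column j (Q ** R)" for j
    define r where "r j = (if j \<in> J1 then rP j else rQ j)" for j
    have kJ: "k \<notin> J1" using J k by auto
    have "transpose W = (\<chi> j. if j = k then a *s rP j + (- a') *s rQ j else r j)"
      by (simp add: vec_eq_iff transpose_def W_def rP_def rQ_def r_def column_def)
    then have "det W = det (\<chi> j. if j = k then a *s rP j + (- a') *s rQ j else r j)"
      by (metis det_transpose)
    also have "\<dots> = a * det (\<chi> j. if j = k then rP j else r j) + (- a') * det (\<chi> j. if j = k then rQ j else r j)"
      by (simp only: det_row_add det_row_mul)
    also have "(\<chi> j. if j = k then rP j else r j) = transpose (\<chi> i j. if j \<in> J1 \<union> J2 then (P ** R) $ i $ j else (Q ** R) $ i $ j)"
      by (simp add: vec_eq_iff transpose_def rP_def rQ_def r_def column_def k)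
    also have "(\<chi> j. if j = k then rQ j else r j) = transpose (\<chi> i j. if j \<in> J1 then (P ** R) $ i $ j else (Q ** R) $ i $ j)"
      using kJ by (simp add: vec_eq_iff transpose_def rP_def rQ_def r_def column_def)
    finally show ?thesis by simp
  qed
  ultimately show ?thesis by (simp add: det_mul)
qed

text \<open>The sum is the product of the exponentials of L B Q1 and -L B Q3, since each acts as the
  identity on the range of the other. Its determinant is inverse to the exponential prefactors of
  the periodic function.\<close>

lemma spectral_splitting_det:
  fixes B :: "complex^'n^'n"
  assumes s: "spectral_splitting B Q1 Q2 Q3"
  shows "det (mexp B L ** Q1 + Q2 + mexp B (- L) ** Q3) = exp (trace (B ** Q1) * of_real L) * exp (- trace (B ** Q3) * of_real L)"
proof -
  note s' = s[unfolded spectral_splitting_def]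
  have c: "mexp B t ** Q1 = Q1 ** mexp B t" "mexp B t ** Q3 = Q3 ** mexp B t" for t
    using s' by (auto intro: mexp_commute)
  have z: "Q1 ** (Q3 ** X) = 0" for X :: "complex^'n^'n" using s' by (simp add: matrix_mul_assoc)
  have Q2: "Q2 = mat 1 - Q1 - Q3" using s' by (simp add: algebra_simps)
  have "mexp B L ** Q1 + Q2 + mexp B (- L) ** Q3
    = (mexp B L ** Q1 + (mat 1 - Q1)) ** (mexp B (- L) ** Q3 + (mat 1 - Q3))"
  proof -
    have cX: "mexp B t ** (Q3 ** X) = Q3 ** (mexp B t ** X)" for t X
      by (simp add: matrix_mul_assoc c)
    show ?thesis
      unfolding c Q2 using s' z by (simp add: matrix_distribs cX c(2) z flip: matrix_mul_assoc)
  qed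
  also have "\<dots> = mexp (B ** Q1) L ** mexp (B ** Q3) (- L)"
    using s' mexp_mult_projection[of B Q1 L] mexp_mult_projection[of B Q3 "- L"] by simp
  finally show ?thesis by (simp add: det_mul det_mexp)
qed

text \<open>\<open>D\<close> collects the growing exponentials and \<open>D'\<close> is its inverse, which is bounded; \<open>T\<close> collects all
  terms that do not pass through \<open>D\<close>, and these are small.\<close>

lemma transition_factorization:
  fixes B Q1 Q2 Q3 Ma Mb Ga Gb :: "complex^'n^'n" and \<mu> \<gamma> :: complex and L :: real
  assumes s: "spectral_splitting B Q1 Q2 Q3" and BQ: "B ** Q2 = mat \<mu> ** Q2"
  defines "a \<equiv> exp (\<mu> * of_real L)" and "a' \<equiv> exp (- \<mu> * of_real L)"
  defines "E \<equiv> mexp B L" and "E' \<equiv> mexp B (- L)"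
  defines "D \<equiv> E ** Q1 + Q2 + E' ** Q3" and "D' \<equiv> E' ** Q1 + Q2 + E ** Q3"
  defines "G \<equiv> Q1 ** Ga + Q2 + Q3 ** Gb"
  defines "K \<equiv> Ma ** Q1 + (mat a ** Ma - mat (\<gamma> * a') ** Mb) ** Q2 - mat \<gamma> ** (Mb ** Q3)"
  defines "T \<equiv> Ma ** (mat a ** (Q2 ** (Ga - mat 1)) + (E ** Q3) ** Ga)
    - mat \<gamma> ** (Mb ** (mat a' ** (Q2 ** (Gb - mat 1)) + (E' ** Q1) ** Gb))"
  assumes G: "invertible G"
  shows "Ma ** E ** Ga - mat \<gamma> ** (Mb ** E' ** Gb) = (K + T ** matrix_inv G ** D') ** D ** G"
proof -
  note s' = s[unfolded spectral_splitting_def]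
  have c: "mexp B t ** Q1 = Q1 ** mexp B t" "mexp B t ** Q2 = Q2 ** mexp B t" "mexp B t ** Q3 = Q3 ** mexp B t" for t
    using s' by (auto intro: mexp_commute)
  have cX: "mexp B t ** (Q1 ** X) = Q1 ** (mexp B t ** X)" "mexp B t ** (Q2 ** X) = Q2 ** (mexp B t ** X)"
    "mexp B t ** (Q3 ** X) = Q3 ** (mexp B t ** X)" for t X
    by (simp_all add: matrix_mul_assoc c)
  have sX: "Q1 ** (Q1 ** X) = Q1 ** X" "Q2 ** (Q2 ** X) = Q2 ** X" "Q3 ** (Q3 ** X) = Q3 ** X"
    "Q1 ** (Q2 ** X) = 0" "Q2 ** (Q1 ** X) = 0" "Q1 ** (Q3 ** X) = 0" "Q3 ** (Q1 ** X) = 0"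
    "Q2 ** (Q3 ** X) = 0" "Q3 ** (Q2 ** X) = 0" for X :: "complex^'n^'n"
    using s' by (simp_all add: matrix_mul_assoc)
  have EX: "mexp B L ** (mexp B (- L) ** X) = X" "mexp B (- L) ** (mexp B L ** X) = X" for X :: "complex^'n^'n"
    by (simp_all add: matrix_mul_assoc mexp_mult_minus mexp_minus_mult)
  have D'D: "D' ** D = mat 1"
  proof -
    have "D' ** D = Q1 + Q2 + Q3"
      unfolding D'_def D_def E_def E'_def c
      using s' by (simp add: matrix_distribs c cX sX EX mexp_mult_minus mexp_minus_mult flip: matrix_mul_assoc)
    then show ?thesis using s' by simp
  qed
  \<comment> \<open>\<open>D ** G\<close> carries precisely the growing terms, E Ga on Q1 and E' Gb
    on Q3, and the identity on the center. \<open>K\<close> then attaches the matching left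
    factors.\<close>
  have DG: "D ** G = Q1 ** (E ** Ga) + Q2 + Q3 ** (E' ** Gb)"
    unfolding D_def G_def E_def E'_def c
    using s' by (simp add: matrix_distribs c cX sX flip: matrix_mul_assoc)
  have EQ2: "Q2 ** (E ** X) = mat a ** (Q2 ** X)" "Q2 ** (E' ** X) = mat a' ** (Q2 ** X)" for X
  proof -
    have "mexp B t ** Q2 = mat (exp (\<mu> * of_real t)) ** Q2" for t by (rule mexp_mult_eigen[OF BQ])
    from this[of L] this[of "- L"] have "Q2 ** E = mat a ** Q2" "Q2 ** E' = mat a' ** Q2"
      by (simp_all add: c(2) E_def E'_def a_def a'_def)
    then show "Q2 ** (E ** X) = mat a ** (Q2 ** X)" "Q2 ** (E' ** X) = mat a' ** (Q2 ** X)"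
      by (simp_all add: matrix_mul_assoc)
  qed
  define sm where "sm c M = mat c ** M" for c and M :: "complex^'n^'n"
  have sm: "mat c ** M = sm c M" "sm c M ** N = sm c (M ** N)" "M ** sm c N = sm c (M ** N)"
    "sm c (sm c' M) = sm (c * c') M" "sm c (M + N) = sm c M + sm c N" "sm c (M - N) = sm c M - sm c N" "sm c 0 = 0"
    for c c' and M N :: "complex^'n^'n"
    by (simp_all add: sm_def vec_eq_iff matrix_matrix_mult_def[of M] matrix_matrix_mult_def[of "mat _ ** M"]
        sum_distrib_left algebra_simps)
  have split: "M ** X = M ** (Q1 ** X) + M ** (Q2 ** X) + M ** (Q3 ** X)" for M X :: "complex^'n^'n"
  proof -
    have "M ** X = M ** ((Q1 + Q2 + Q3) ** X)" using s' by simp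
    then show ?thesis by (simp only: matrix_add_left matrix_add_right)
  qed
  \<comment> \<open>The Q1 part grows and is accounted for by \<open>D\<close>, on the center the
    exponential is the scalar \<open>a\<close>, and the Q3 part decays and goes into
    \<open>T\<close>. For E' the roles of Q1 and Q3 are exchanged.\<close>
  have Ea: "Ma ** (E ** Ga) = Ma ** (Q1 ** (E ** Ga)) + mat a ** (Ma ** (Q2 ** Ga)) + Ma ** (Q3 ** (E ** Ga))"
    by (subst split) (simp add: EQ2 sm)
  have Eb: "Mb ** (E' ** Gb) = Mb ** (Q1 ** (E' ** Gb)) + mat a' ** (Mb ** (Q2 ** Gb)) + Mb ** (Q3 ** (E' ** Gb))"
    by (subst split) (simp add: EQ2 sm)
  have "(K + T ** matrix_inv G ** D') ** D ** G = K ** (D ** G) + T ** (matrix_inv G ** ((D' ** D) ** G))"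
    by (simp add: matrix_distribs matrix_mul_assoc)
  also have "\<dots> = K ** (D ** G) + T" by (simp add: D'D invertible_matrix_inv[OF G])
  finally have sum: "(K + T ** matrix_inv G ** D') ** D ** G = K ** (D ** G) + T" .
  have KDG: "K ** (D ** G) = Ma ** (Q1 ** (E ** Ga)) + (mat a ** (Ma ** Q2) - mat \<gamma> ** (mat a' ** (Mb ** Q2)))
      - mat \<gamma> ** (Mb ** (Q3 ** (E' ** Gb)))"
    unfolding DG K_def using s'
    by (simp add: matrix_distribs sX sm mult.commute[of a'] flip: matrix_mul_assoc)
  have T: "T = mat a ** (Ma ** (Q2 ** Ga)) - mat a ** (Ma ** Q2) + Ma ** (Q3 ** (E ** Ga))
      - (mat \<gamma> ** (mat a' ** (Mb ** (Q2 ** Gb))) - mat \<gamma> ** (mat a' ** (Mb ** Q2)) + mat \<gamma> ** (Mb ** (Q1 ** (E' ** Gb))))"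
    unfolding T_def E_def E'_def c
    by (simp add: matrix_distribs sm flip: matrix_mul_assoc)
  show ?thesis
    unfolding sum KDG unfolding T using Ea Eb by (simp add: matrix_distribs sm algebra_simps flip: matrix_mul_assoc)
qed

text \<open>The determinant of \<open>D\<close> cancels against the trace exponentials, so only
  bounded quantities and powers of e^{\<omega> L} remain. The error \<tau> comes from replacing Ma,
  Mb by Pa, Pb and Ga, Gb by the identity; \<open>e\<close> comes from the decaying exponentials.
  Entries of size e^{\<omega> L} account for the power \<open>CARD('n)\<close>.\<close>

lemma transition_estimate:
  fixes B Q1 Q2 Q3 Ma Mb Ga Gb Pa Pb :: "complex^'n^'n" and \<mu> \<gamma> :: complex and L :: real
  assumes s: "spectral_splitting B Q1 Q2 Q3" and BQ: "B ** Q2 = mat \<mu> ** Q2"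
    and K: "K \<ge> 1" "norm Q1 \<le> K" "norm Q2 \<le> K" "norm Q3 \<le> K" "norm Pa \<le> K" "norm Pb \<le> K"
    and \<mu>: "\<bar>Re \<mu>\<bar> \<le> \<omega>" and L: "L \<ge> 0" and \<gamma>: "norm \<gamma> = 1"
    and \<tau>: "norm (Ma - Pa) \<le> \<tau>" "norm (Mb - Pb) \<le> \<tau>" "norm (Ga - mat 1) \<le> \<tau>" "norm (Gb - mat 1) \<le> \<tau>"
      "\<tau> \<le> 1 / (4 * K)"
    and e: "norm (mexp B L ** Q3) \<le> e" "norm (mexp B (- L) ** Q1) \<le> e" "e \<le> K"
  shows "norm (exp (- trace (B ** Q1) * of_real L) * exp (trace (B ** Q3) * of_real L)
      * det (Ma ** mexp B L ** Ga - mat \<gamma> ** (Mb ** mexp B (- L) ** Gb))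
      - det (Pa ** Q1 + (mat (exp (\<mu> * of_real L)) ** Pa - mat (\<gamma> * exp (- \<mu> * of_real L)) ** Pb) ** Q2
          - mat \<gamma> ** (Pb ** Q3)))
    \<le> fact CARD('n) * of_nat CARD('n) * (100 * K ^ 4 * (norm (mat 1 :: complex^'n^'n) + 1)\<^sup>2) ^ CARD('n)
      * exp (\<omega> * L) ^ CARD('n) * (\<tau> + e)"
proof -
  let ?n1 = "norm (mat 1 :: complex^'n^'n) + 1"
  define a where "a = exp (\<mu> * of_real L)"
  define a' where "a' = exp (- \<mu> * of_real L)"
  define w where "w = exp (\<omega> * L)"
  define G where "G = Q1 ** Ga + Q2 + Q3 ** Gb"
  define KK where "KK Ma Mb = Ma ** Q1 + (mat a ** Ma - mat (\<gamma> * a') ** Mb) ** Q2 - mat \<gamma> ** (Mb ** Q3)"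
    for Ma Mb :: "complex^'n^'n"
  define T where "T = Ma ** (mat a ** (Q2 ** (Ga - mat 1)) + (mexp B L ** Q3) ** Ga)
    - mat \<gamma> ** (Mb ** (mat a' ** (Q2 ** (Gb - mat 1)) + (mexp B (- L) ** Q1) ** Gb))"
  define D where "D = mexp B L ** Q1 + Q2 + mexp B (- L) ** Q3"
  define D' where "D' = mexp B (- L) ** Q1 + Q2 + mexp B L ** Q3"
  have \<tau>0: "\<tau> \<ge> 0" and e0: "e \<ge> 0" using \<tau>(1) e(1) norm_ge_zero order_trans by metis+
  have \<tau>1: "K * \<tau> \<le> 1/4" "\<tau> \<le> 1"
  proof -
    have "K * \<tau> \<le> K * (1 / (4 * K))" using K(1) by (intro mult_left_mono \<tau>) simp
    then show "K * \<tau> \<le> 1/4" using K(1) by simp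
    moreover have "1 * \<tau> \<le> K * \<tau>" using K(1) \<tau>0 by (intro mult_right_mono)
    ultimately show "\<tau> \<le> 1" by simp
  qed
  have n1: "?n1 \<ge> 1" by simp
  have wa: "norm a \<le> w" "norm a' \<le> w" "w \<ge> 1"
  proof -
    have "Re \<mu> * L \<le> \<omega> * L" "- Re \<mu> * L \<le> \<omega> * L" "\<omega> \<ge> 0"
      using \<mu> L mult_right_mono[of "Re \<mu>" \<omega> L] mult_right_mono[of "- Re \<mu>" \<omega> L] by auto
    then show "norm a \<le> w" "norm a' \<le> w" "w \<ge> 1" using L by (auto simp: a_def a'_def w_def)
  qed
  have nm: "norm (X ** Y) \<le> x * y" if "norm X \<le> x" "norm Y \<le> y" for X Y :: "complex^'n^'n" and x y
    using norm_matrix_mult_le[of X Y] mult_mono[OF that] order_trans[OF norm_ge_zero that(1)] by fastforce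
  have ns: "norm (mat c ** X) \<le> y * x" if "norm c \<le> y" "norm X \<le> x" for X :: "complex^'n^'n" and x c y
    unfolding norm_mat_mult using that order_trans[OF norm_ge_zero that(1)] by (intro mult_mono) auto
  have KKn: "norm (KK X Y) \<le> 4 * w * K * x" if "norm X \<le> x" "norm Y \<le> x" for X Y x
  proof -
    have x: "x \<ge> 0" using that(1) norm_ge_zero order_trans by metis
    have ga: "norm (\<gamma> * a') \<le> w" using wa \<gamma> by (simp add: norm_mult)
    have "norm (KK X Y) \<le> x * K + (w * x + w * x) * K + 1 * (x * K)"
      unfolding KK_def
      by (intro order_trans[OF norm_triangle_ineq4] order_trans[OF norm_triangle_ineq] add_mono nm ns K that wa ga) (use \<gamma> in simp)
    also have "\<dots> = 2 * (1 * (x * K)) + 2 * (w * (x * K))" by (simp add: algebra_simps)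
    also have "\<dots> \<le> 2 * (w * (x * K)) + 2 * (w * (x * K))"
      using wa x K by (intro add_right_mono mult_left_mono mult_right_mono) auto
    finally show ?thesis by (simp add: algebra_simps)
  qed
  have G1: "norm (G - mat 1) \<le> 2 * (K * \<tau>)"
  proof -
    have "G - mat 1 = Q1 ** (Ga - mat 1) + Q3 ** (Gb - mat 1)"
      using s by (simp add: G_def matrix_distribs spectral_splitting_def algebra_simps)
    also have "norm \<dots> \<le> K * \<tau> + K * \<tau>"
      by (intro order_trans[OF norm_triangle_ineq] add_mono nm K \<tau>)
    finally show ?thesis by simp
  qed
  then have G12: "norm (G - mat 1) \<le> 1/2" using \<tau>1 by simp
  have Ginv: "norm (matrix_inv G) \<le> ?n1"
  proof -
    have "norm (matrix_inv G) \<le> norm (mat 1 :: complex^'n^'n) + norm (matrix_inv G - mat 1)"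
      using norm_triangle_sub[of "matrix_inv G" "mat 1"] by simp
    also have "norm (matrix_inv G - mat 1) \<le> 1" using matrix_near_identity(2)[OF G12] G12 by linarith
    finally show ?thesis by simp
  qed
  have near1: "norm X \<le> ?n1" if "norm (X - mat 1) \<le> \<tau>" for X :: "complex^'n^'n"
    using norm_triangle_sub[of X "mat 1"] that \<tau>1 by simp
  have near2: "norm X \<le> 2 * K" if "norm (X - Y) \<le> \<tau>" "norm Y \<le> K" for X Y :: "complex^'n^'n"
    using norm_triangle_sub[of X Y] that \<tau>1 K by simp
  define r where "r = \<tau> + e"
  have r: "r \<ge> 0" using \<tau>0 e0 by (simp add: r_def)
  have Tn: "norm T \<le> 4 * K\<^sup>2 * w * ?n1 * r"
  proof -
    have "norm T \<le> 2 * K * (w * (K * \<tau>) + e * ?n1) + 1 * (2 * K * (w * (K * \<tau>) + e * ?n1))"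
      unfolding T_def
      by (intro order_trans[OF norm_triangle_ineq4] order_trans[OF norm_triangle_ineq] add_mono nm ns K \<tau>
          near1 near2[of Ma Pa] near2[of Mb Pb] wa e) (use \<gamma> in simp)
    also have "\<dots> = 4 * K * (w * (K * \<tau>) + e * ?n1)" by (simp add: algebra_simps)
    also have "\<dots> \<le> 4 * K * (w * (K * \<tau>) * ?n1 + e * ?n1 * (w * K))"
    proof (intro mult_left_mono add_mono)
      show "w * (K * \<tau>) \<le> w * (K * \<tau>) * ?n1"
        using mult_left_mono[OF n1, of "w * (K * \<tau>)"] wa(3) K(1) \<tau>0 by simp
      have "1 \<le> w * K" using wa(3) K(1) mult_mono[of 1 w 1 K] by simp
      then show "e * ?n1 \<le> e * ?n1 * (w * K)"
        using mult_left_mono[of 1 "w * K" "e * ?n1"] e0 n1 by simp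
    qed (use K in auto)
    also have "\<dots> = 4 * K\<^sup>2 * w * ?n1 * r" by (simp add: r_def power2_eq_square algebra_simps)
    finally show ?thesis .
  qed
  have D'n: "norm D' \<le> 3 * K"
  proof -
    have "norm D' \<le> e + K + e"
      unfolding D'_def by (intro order_trans[OF norm_triangle_ineq] add_mono e K)
    then show ?thesis using e by simp
  qed
  \<comment> \<open>\<open>T\<close> carries the small factor \<tau> + e, while
    \<open>matrix_inv G\<close> and \<open>D'\<close> are bounded; so pulling \<open>D ** G\<close>
    out of \<open>T\<close> does not destroy smallness.\<close>
  define S where "S = T ** matrix_inv G ** D'"
  have Sn: "norm S \<le> 12 * K ^ 3 * w * ?n1\<^sup>2 * r"
  proof -
    have "norm S \<le> (4 * K\<^sup>2 * w * ?n1 * r) * ?n1 * (3 * K)" unfolding S_def by (intro nm Tn Ginv D'n)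
    also have "\<dots> = 12 * K ^ 3 * w * ?n1\<^sup>2 * r" by (simp add: power2_eq_square power3_eq_cube algebra_simps)
    finally show ?thesis .
  qed
  define Z where "Z = (KK Ma Mb + S) ** G"
  have diff: "norm (Z - KK Pa Pb) \<le> 44 * K ^ 3 * ?n1\<^sup>2 * w * r"
  proof -
    have "Z - KK Pa Pb = (KK (Ma - Pa) (Mb - Pb) + S) + (KK Ma Mb + S) ** (G - mat 1)"
      by (simp add: Z_def KK_def matrix_distribs algebra_simps)
    also have "norm \<dots> \<le> (4 * w * K * \<tau> + 12 * K ^ 3 * w * ?n1\<^sup>2 * r)
        + (4 * w * K * (2 * K) + 12 * K ^ 3 * w * ?n1\<^sup>2 * r) * (2 * (K * \<tau>))"
      by (intro order_trans[OF norm_triangle_ineq] add_mono nm KKn \<tau> Sn G1 near2[of Ma Pa] near2[of Mb Pb] K)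
    also have "\<dots> = 4 * w * K * \<tau> + 12 * K ^ 3 * w * ?n1\<^sup>2 * r + 16 * K ^ 3 * w * \<tau>
        + 12 * K ^ 3 * w * ?n1\<^sup>2 * r * (2 * (K * \<tau>))" by (simp add: power3_eq_cube algebra_simps)
    also have "\<dots> \<le> 4 * K ^ 3 * ?n1\<^sup>2 * w * r + 12 * K ^ 3 * w * ?n1\<^sup>2 * r + 16 * K ^ 3 * ?n1\<^sup>2 * w * r
        + 12 * K ^ 3 * w * ?n1\<^sup>2 * r * 1"
    proof (intro add_mono order_refl)
      have n2: "1 \<le> ?n1\<^sup>2" using n1 by (rule one_le_power)
      have \<tau>r: "\<tau> \<le> r" using e0 by (simp add: r_def)
      have k3: "K \<le> K ^ 3" using K(1) power_increasing[of 1 3 K] by simp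
      have wr: "w * \<tau> \<le> w * r" "w * r \<ge> 0" "w * \<tau> \<ge> 0" using \<tau>r wa r \<tau>0 by auto
      have "K * 1 * (w * \<tau>) \<le> K ^ 3 * ?n1\<^sup>2 * (w * r)" "K ^ 3 * 1 * (w * \<tau>) \<le> K ^ 3 * ?n1\<^sup>2 * (w * r)"
        using K(1) by (intro mult_mono wr k3 n2 order_refl; auto)+
      then show "4 * w * K * \<tau> \<le> 4 * K ^ 3 * ?n1\<^sup>2 * w * r" "16 * K ^ 3 * w * \<tau> \<le> 16 * K ^ 3 * ?n1\<^sup>2 * w * r"
        by (simp_all add: mult_ac)
      show "12 * K ^ 3 * w * ?n1\<^sup>2 * r * (2 * (K * \<tau>)) \<le> 12 * K ^ 3 * w * ?n1\<^sup>2 * r * 1"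
        using \<tau>1 K(1) wa r by (intro mult_left_mono) auto
    qed
    also have "\<dots> = 44 * K ^ 3 * ?n1\<^sup>2 * w * r" by (simp add: algebra_simps)
    finally show ?thesis .
  qed
  \<comment> \<open>One generous constant for three bounds: 4 K^2 for the limit matrix, 92 K^4 for
    \<open>Z\<close> and 44 K^3 for their difference.\<close>
  define C where "C = 100 * K ^ 4 * ?n1\<^sup>2"
  have Kp: "K\<^sup>2 \<le> K ^ 4" "K ^ 3 \<le> K ^ 4" using K(1) by (auto intro: power_increasing)
  have n2: "1 \<le> ?n1\<^sup>2" using n1 by (rule one_le_power)
  have K4: "0 \<le> K ^ 4" "1 \<le> K ^ 4" "0 \<le> K" using K(1) by auto
  have C1: "44 * K ^ 3 * ?n1\<^sup>2 * w * r \<le> C * w * r"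
    unfolding C_def using Kp K4 n2 wa r by (intro mult_right_mono mult_mono) auto
  have rK: "r \<le> 2 * K" using \<tau>1 e K by (simp add: r_def)
  have KP: "norm (KK Pa Pb) \<le> 4 * K\<^sup>2 * w"
    using KKn[of Pa K Pb] K by (simp add: power2_eq_square mult_ac)
  have ZM: "norm Z \<le> C * w"
  proof -
    have "norm Z \<le> norm (KK Pa Pb) + norm (Z - KK Pa Pb)" by (rule norm_triangle_sub)
    also have "\<dots> \<le> 4 * K\<^sup>2 * w + 44 * K ^ 3 * ?n1\<^sup>2 * w * (2 * K)"
    proof (intro add_mono KP order_trans[OF diff])
      show "44 * K ^ 3 * ?n1\<^sup>2 * w * r \<le> 44 * K ^ 3 * ?n1\<^sup>2 * w * (2 * K)"
        using wa(3) K(1) by (intro mult_left_mono rK) auto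
    qed
    also have "\<dots> = (4 * K\<^sup>2 * 1 + 88 * K ^ 4 * ?n1\<^sup>2) * w" by (simp add: algebra_simps power_numeral_reduce)
    also have "\<dots> \<le> (4 * K ^ 4 * ?n1\<^sup>2 + 88 * K ^ 4 * ?n1\<^sup>2) * w"
      using Kp n2 wa K4 by (intro mult_right_mono add_mono mult_mono) auto
    also have "\<dots> = 92 * (K ^ 4 * ?n1\<^sup>2) * w" by simp
    also have "\<dots> \<le> 100 * (K ^ 4 * ?n1\<^sup>2) * w" using wa K4 by (intro mult_right_mono) auto
    finally show ?thesis by (simp add: C_def)
  qed
  have PM: "norm (KK Pa Pb) \<le> C * w"
  proof -
    have "4 * K\<^sup>2 * 1 * w \<le> 100 * K ^ 4 * ?n1\<^sup>2 * w"
      using Kp n2 wa K4 by (intro mult_right_mono mult_mono) auto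
    then show ?thesis unfolding C_def mult_1_right by (rule order_trans[OF KP])
  qed
  have Cw: "C * w > 0" unfolding C_def using K4 n2 wa(3) by (intro mult_pos_pos) linarith+
  have "norm (det Z - det (KK Pa Pb)) \<le> fact CARD('n) * of_nat CARD('n) * (C * w) ^ (CARD('n) - 1) * (C * w * r)"
  proof (rule det_diff_le[OF Cw])
    show "norm (Z $ i $ j) \<le> C * w" "norm (KK Pa Pb $ i $ j) \<le> C * w" for i j
      by (rule order_trans[OF norm_entry_le ZM] order_trans[OF norm_entry_le PM])+
    show "norm (Z $ i $ j - KK Pa Pb $ i $ j) \<le> C * w * r" for i j
      using norm_entry_le[of "Z - KK Pa Pb" i j] diff C1 by simp
  qed
  also have "\<dots> = fact CARD('n) * of_nat CARD('n) * (C * w) ^ CARD('n) * r"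
  proof -
    have "(C * w) ^ CARD('n) = (C * w) ^ (CARD('n) - 1) * (C * w)"
      by (metis One_nat_def Suc_pred power_Suc2 zero_less_card_finite)
    then show ?thesis by (simp add: mult_ac)
  qed
  finally have main: "norm (det Z - det (KK Pa Pb)) \<le> fact CARD('n) * of_nat CARD('n) * (C * w) ^ CARD('n) * r" .
  have "Ma ** mexp B L ** Ga - mat \<gamma> ** (Mb ** mexp B (- L) ** Gb) = (KK Ma Mb + S) ** D ** G"
    unfolding KK_def S_def T_def D_def D'_def G_def a_def a'_def
    by (rule transition_factorization[OF s BQ]) (use matrix_near_identity(1)[OF G12] in \<open>simp add: G_def\<close>)
  then have "det (Ma ** mexp B L ** Ga - mat \<gamma> ** (Mb ** mexp B (- L) ** Gb)) = det D * det Z"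
    by (simp add: det_mul Z_def mult_ac)
  moreover have "exp (- trace (B ** Q1) * of_real L) * exp (trace (B ** Q3) * of_real L) * det D = 1"
    unfolding D_def spectral_splitting_det[OF s] by (simp add: mult_ac flip: exp_add)
  ultimately have "exp (- trace (B ** Q1) * of_real L) * exp (trace (B ** Q3) * of_real L)
      * det (Ma ** mexp B L ** Ga - mat \<gamma> ** (Mb ** mexp B (- L) ** Gb)) = det Z"
    by (metis mult.assoc mult_1)
  with main show ?thesis
    unfolding KK_def a_def a'_def by (simp add: C_def w_def r_def power_mult_distrib mult_ac)
qed

section \<open>Uniform estimates\<close>

lemma eventually_exp_decay_le:
  fixes a b T :: real
  assumes "a > 0" "b > 0"
  shows "\<forall>\<^sub>F L in at_top. T * exp (- a * L) \<le> b"
proof -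
  have "filterlim (\<lambda>L. - a * L) at_bot at_top"
    using assms filterlim_tendsto_neg_mult_at_bot[OF tendsto_const[of "- a"] _ filterlim_ident] by simp
  then have "((\<lambda>L. T * exp (- a * L)) \<longlongrightarrow> T * 0) at_top"
    by (intro tendsto_mult_left filterlim_compose[OF exp_at_bot])
  then have "\<forall>\<^sub>F L in at_top. T * exp (- a * L) < b"
    using assms by (intro order_tendstoD) auto
  then show ?thesis by eventually_elim simp
qed

text \<open>The limiting matrix inherits continuity from the holomorphic A0(x, .) because (H2) makes
  the convergence as x tends to infinity locally uniform.\<close>

lemma limit_matrix_continuous:
  fixes A0 :: "real \<Rightarrow> complex \<Rightarrow> complex^'n^'n" and Ainf :: "complex \<Rightarrow> complex^'n^'n"
  assumes hol: "\<And>x. matrix_holomorphic_on (A0 x) UNIV" and \<nu>: "\<nu> > 0"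
    and H2: "\<And>M. M > 0 \<Longrightarrow> \<exists>C>0. \<forall>x z. norm z \<le> M \<longrightarrow> norm (A0 x z - Ainf z) \<le> C * exp (- \<nu> * \<bar>x\<bar>)"
  shows "(Ainf \<longlongrightarrow> Ainf zs) (nhds zs)"
proof (rule tendstoI)
  fix e :: real assume e: "e > 0"
  have "norm zs + 1 > 0" by (simp add: add_nonneg_pos)
  from H2[OF this] obtain C where C: "\<And>x z. norm z \<le> norm zs + 1 \<Longrightarrow> norm (A0 x z - Ainf z) \<le> C * exp (- \<nu> * \<bar>x\<bar>)"
    by blast
  have "\<forall>\<^sub>F x in at_top. 0 \<le> x \<and> C * exp (- \<nu> * x) \<le> e / 4"
    using eventually_exp_decay_le[OF \<nu>, of "e / 4" C] e by (intro eventually_conj eventually_ge_at_top) auto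
  then obtain x :: real where x: "0 \<le> x" "C * exp (- \<nu> * x) \<le> e / 4"
    using eventually_happens'[OF trivial_limit_at_top_linorder] by blast
  have near: "norm (A0 x z - Ainf z) \<le> e / 4" if "norm z \<le> norm zs + 1" for z
    using C[OF that, of x] x by simp
  have "\<forall>\<^sub>F z in nhds zs. dist (A0 x z) (A0 x zs) < e / 4"
    using e by (intro tendstoD matrix_holomorphic_tendsto[OF hol]) auto
  moreover have "\<forall>\<^sub>F z in nhds zs. z \<in> ball zs 1" by (intro eventually_nhds_in_open) auto
  ultimately show "\<forall>\<^sub>F z in nhds zs. dist (Ainf z) (Ainf zs) < e"
  proof eventually_elim
    case (elim z)
    have "norm z \<le> norm zs + 1"
      using elim(2) norm_triangle_sub[of z zs] by (simp add: dist_norm norm_minus_commute)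
    from near[OF this] near[of zs] elim(1)
    have "norm (Ainf z - A0 x z) \<le> e / 4" "norm (A0 x z - A0 x zs) \<le> e / 4" "norm (A0 x zs - Ainf zs) \<le> e / 4"
      by (auto simp: norm_minus_commute dist_norm)
    from norm_diff_triangle_le[OF norm_diff_triangle_le[OF this(1,2)] this(3)] e show ?case
      by (simp add: dist_norm)
  qed
qed

lemma conjugatorD:
  assumes "conjugator A0 B U S \<eta> P"
  obtains K where "K \<ge> 1"
    "\<And>x z. x \<in> S \<Longrightarrow> z \<in> U \<Longrightarrow> norm (P x z) \<le> K \<and> invertible (P x z) \<and> norm (matrix_inv (P x z)) \<le> K"
    "\<And>x z. x \<in> S \<Longrightarrow> z \<in> U \<Longrightarrow> norm (P x z - mat 1) \<le> K * exp (- \<eta> * \<bar>x\<bar>)"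
    "\<And>x z. x \<in> S \<Longrightarrow> z \<in> U \<Longrightarrow> ((\<lambda>y. P y z) has_vector_derivative (A0 x z ** P x z - P x z ** B z)) (at x within S)"
proof -
  obtain K1 K2 where K1: "\<And>x z. x \<in> S \<Longrightarrow> z \<in> U \<Longrightarrow> norm (P x z) \<le> K1 \<and> invertible (P x z) \<and> norm (matrix_inv (P x z)) \<le> K1"
    and K2: "\<And>x z. x \<in> S \<Longrightarrow> z \<in> U \<Longrightarrow> norm (P x z - mat 1) \<le> K2 * exp (- \<eta> * \<bar>x\<bar>)"
    using assms unfolding conjugator_def by blast
  show thesis
  proof (rule that[of "max 1 (max K1 K2)"])
    fix x z assume xz: "x \<in> S" "z \<in> U"
    show "norm (P x z) \<le> max 1 (max K1 K2) \<and> invertible (P x z) \<and> norm (matrix_inv (P x z)) \<le> max 1 (max K1 K2)"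
      using K1[OF xz] by auto
    have "K2 * exp (- \<eta> * \<bar>x\<bar>) \<le> max 1 (max K1 K2) * exp (- \<eta> * \<bar>x\<bar>)" by (intro mult_right_mono) auto
    with K2[OF xz] show "norm (P x z - mat 1) \<le> max 1 (max K1 K2) * exp (- \<eta> * \<bar>x\<bar>)" by linarith
    show "((\<lambda>y. P y z) has_vector_derivative (A0 x z ** P x z - P x z ** B z)) (at x within S)"
      using assms xz unfolding conjugator_def by blast
  qed simp
qed

text \<open>The bookkeeping of rates. The defect \<delta> and the perturbation each use half of the
  allowed \<kappa>/2. The amplification e^{\<kappa> L} is at most e^{\<theta> L / 2}, so half of the
  rate \<theta> survives, to be compared with the rate \<eta> at which the conjugator tends to the
  identity.\<close>

lemma conjugation_exponentially_small:
  fixes B S S' :: "complex^'n^'n" and P A0 A \<Psi> :: "real \<Rightarrow> complex^'n^'n" and d :: "'n \<Rightarrow> complex"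
  defines "n \<equiv> of_nat CARD('n) :: real" and "c \<equiv> norm S * norm S'"
  assumes SS: "S' ** S = mat 1" and \<kappa>: "\<kappa> > 0" "\<kappa> \<le> \<theta> / 2" and L: "L \<ge> 0"
    and gap: "\<And>i j. Re (d i - d j) \<ge> 0 \<or> Re (d i - d j) \<le> - 2 * \<kappa>"
    and B: "\<And>i j. norm ((S' ** B ** S) $ i $ j - (if i = j then d i else 0)) \<le> \<delta>" and \<delta>: "n * (2 * \<delta>) \<le> \<kappa> / 4"
    and P: "\<And>x. x \<in> {0..L} \<Longrightarrow> (P has_vector_derivative A0 x ** P x - P x ** B) (at x within {0..L})"
    and K: "K \<ge> 1" "\<And>x. x \<in> {0..L} \<Longrightarrow> norm (P x) \<le> K \<and> invertible (P x) \<and> norm (matrix_inv (P x)) \<le> K"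
    and p: "norm (P L - mat 1) \<le> K * exp (- \<eta> * L)"
    and C: "C \<ge> 0" and A: "\<And>x. x \<in> {0..L} \<Longrightarrow> norm (A x - A0 x) \<le> C * exp (- \<theta> * L)"
    and \<Psi>: "\<And>x. x \<in> {0..L} \<Longrightarrow> (\<Psi> has_vector_derivative A x ** \<Psi> x) (at x within {0..L})" "\<Psi> 0 = mat 1"
    and large: "(n * (c * K\<^sup>2 * C)) * exp (- \<theta> * L) \<le> \<kappa> / 4" "(2 * c\<^sup>2 * n\<^sup>2 * K\<^sup>2 * C / \<kappa>) * exp (- (\<theta> / 2) * L) \<le> 1 / 2"
    and \<sigma>: "\<sigma> \<le> \<theta> / 2" "\<sigma> \<le> \<eta>"
  obtains M G where "matrix_inv (\<Psi> L) = M ** mexp B (- L) ** G"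
    "norm (M - P 0) \<le> (K * (2 * (2 * c\<^sup>2 * n\<^sup>2 * K\<^sup>2 * C / \<kappa>) + K)) * exp (- \<sigma> * L)"
    "norm (G - mat 1) \<le> (K * (2 * (2 * c\<^sup>2 * n\<^sup>2 * K\<^sup>2 * C / \<kappa>) + K)) * exp (- \<sigma> * L)"
proof -
  define T where "T = 2 * c\<^sup>2 * n\<^sup>2 * K\<^sup>2 * C / \<kappa>"
  define \<tau> where "\<tau> = T * exp (- (\<theta> / 2) * L)"
  have c0: "c \<ge> 0" by (simp add: c_def)
  have T0: "T \<ge> 0" using C \<kappa> by (simp add: T_def)
  have small: "n * (2 * \<delta> + c * K\<^sup>2 * (C * exp (- \<theta> * L))) \<le> \<kappa> / 2"
    using \<delta> large(1) by (simp add: algebra_simps)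
  have \<tau>: "c * (of_nat (CARD('n) * CARD('n)) * (2 * (exp (\<kappa> * L) * (c * K\<^sup>2 * (C * exp (- \<theta> * L)))) / \<kappa>)) \<le> \<tau>"
  proof -
    have "c * (of_nat (CARD('n) * CARD('n)) * (2 * (exp (\<kappa> * L) * (c * K\<^sup>2 * (C * exp (- \<theta> * L)))) / \<kappa>))
       = T * (exp (\<kappa> * L) * exp (- \<theta> * L))"
      by (simp add: T_def n_def power2_eq_square)
    also have "exp (\<kappa> * L) * exp (- \<theta> * L) = exp ((\<kappa> - \<theta>) * L)" by (simp add: algebra_simps flip: exp_add)
    also have "T * \<dots> \<le> T * exp (- (\<theta> / 2) * L)"
    proof (rule mult_left_mono[OF _ T0])
      have "(\<kappa> - \<theta>) * L \<le> - (\<theta> / 2) * L" using \<kappa> L by (intro mult_right_mono) auto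
      then show "exp ((\<kappa> - \<theta>) * L) \<le> exp (- (\<theta> / 2) * L)" by simp
    qed
    finally show ?thesis by (simp add: \<tau>_def)
  qed
  have \<tau>2: "\<tau> \<le> 1/2" using large(2) by (simp add: \<tau>_def T_def)
  obtain M G where MG: "matrix_inv (\<Psi> L) = M ** mexp B (- L) ** G" "norm (M - P 0) \<le> K * \<tau>"
    "norm (G - mat 1) \<le> K * (2 * \<tau> + K * exp (- \<eta> * L))"
    by (rule conjugation_half_line[OF SS _ \<kappa>(1) L gap B P K(2) p A \<Psi> small[unfolded n_def] \<tau> \<tau>2])
      (auto simp: c_def)
  have e1: "exp (- (\<theta> / 2) * L) \<le> exp (- \<sigma> * L)" "exp (- \<eta> * L) \<le> exp (- \<sigma> * L)"
    using mult_right_mono[OF \<sigma>(1) L] mult_right_mono[OF \<sigma>(2) L] by auto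
  have "\<tau> \<le> T * exp (- \<sigma> * L)" unfolding \<tau>_def by (intro mult_left_mono e1 T0)
  then have "2 * \<tau> + K * exp (- \<eta> * L) \<le> 2 * (T * exp (- \<sigma> * L)) + K * exp (- \<sigma> * L)"
    using K(1) by (intro add_mono mult_left_mono e1) auto
  then have b: "K * (2 * \<tau> + K * exp (- \<eta> * L)) \<le> (K * (2 * T + K)) * exp (- \<sigma> * L)"
    using K(1) mult_left_mono[of "2 * \<tau> + K * exp (- \<eta> * L)" "2 * (T * exp (- \<sigma> * L)) + K * exp (- \<sigma> * L)" K]
    by (simp add: algebra_simps)
  have "K * \<tau> \<le> K * (2 * \<tau> + K * exp (- \<eta> * L))"
    using K(1) T0 by (intro mult_left_mono) (auto simp: \<tau>_def)
  with b MG show thesis using that[OF MG(1)] unfolding T_def by linarith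
qed

lemma invertible_of_basis_columns:
  fixes B R :: "complex^'n^'n"
  assumes s: "spectral_splitting B Q1 Q2 Q3"
    and R: "basis_columns R J1 (range ((*v) Q1))" "basis_columns R J2 (range ((*v) Q2))" "basis_columns R J3 (range ((*v) Q3))"
  shows "invertible R"
proof -
  have sub: "range ((*v) Q) \<subseteq> vec.span (columns R)" if "basis_columns R J (range ((*v) Q))" for Q :: "complex^'n^'n" and J
    using that vec.span_mono[of "(\<lambda>j. column j R) ` J" "columns R"] by (auto simp: basis_columns_def columns_def)
  have "v \<in> vec.span (columns R)" for v
  proof -
    have "v = (Q1 + Q2 + Q3) *v v" using s by (simp add: spectral_splitting_def)
    also have "\<dots> = Q1 *v v + Q2 *v v + Q3 *v v" by (simp add: matrix_vector_mult_add_rdistrib)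
    also have "\<dots> \<in> vec.span (columns R)"
      using sub[OF R(1)] sub[OF R(2)] sub[OF R(3)] by (intro vec.span_add) auto
    finally show ?thesis .
  qed
  then show ?thesis unfolding invertible_right_inverse matrix_right_invertible_span_columns by blast
qed

lemma basis_columns_fixed:
  fixes Q :: "complex^'n^'n"
  assumes "basis_columns R J (range ((*v) Q))" "Q ** Q = Q" "j \<in> J"
  shows "Q *v column j R = column j R"
proof -
  have "column j R \<in> vec.span ((\<lambda>j. column j R) ` J)" using assms(3) by (intro vec.span_base) auto
  then have "column j R \<in> range ((*v) Q)" using assms(1) by (simp add: basis_columns_def)
  then obtain v where "column j R = Q *v v" by auto
  then show ?thesis by (simp add: matrix_vector_mul_assoc assms(2))
qed

text \<open>Multiplication by \<open>R\<close> expresses the determinant in the chosen bases, and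
  division by \<open>det R\<close> removes their choice. With a = e^{\<mu> L}, a' = \<gamma>
  e^{-\<mu> L} and g = \<gamma> this is the transitional homoclinic function up to a power of
  -\<gamma>.\<close>

lemma det_transition_homoclinic:
  fixes P Q R Q1 Q2 Q3 :: "complex^'n^'n"
  assumes J: "J1 \<union> J2 \<union> J3 = UNIV" "J1 \<inter> J2 = {}" "J1 \<inter> J3 = {}" "J2 \<inter> J3 = {}" "card J2 = 1"
    and s: "spectral_splitting B Q1 Q2 Q3"
    and R: "basis_columns R J1 (range ((*v) Q1))" "basis_columns R J2 (range ((*v) Q2))" "basis_columns R J3 (range ((*v) Q3))"
  shows "det (P ** Q1 + (mat a ** P - mat a' ** Q) ** Q2 - mat g ** (Q ** Q3))
    = (- g) ^ card J3 * (a * homoclinic_evans P Q R (J1 \<union> J2) - a' * homoclinic_evans P Q R J1)"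
proof -
  have "det R \<noteq> 0" using invertible_of_basis_columns[OF s R] by (simp add: invertible_det_nz)
  moreover note s' = s[unfolded spectral_splitting_def]
  have "det ((P ** Q1 + (mat a ** P - mat a' ** Q) ** Q2 - mat g ** (Q ** Q3)) ** R)
    = (- g) ^ card J3 * (a * det (\<chi> i j. if j \<in> J1 \<union> J2 then (P ** R) $ i $ j else (Q ** R) $ i $ j)
      - a' * det (\<chi> i j. if j \<in> J1 then (P ** R) $ i $ j else (Q ** R) $ i $ j))"
    by (rule det_transition_columns[OF J s]) (use basis_columns_fixed R s' in auto)
  ultimately show ?thesis
    by (simp add: det_mul homoclinic_evans_def field_simps)
qed

section \<open>Choice of the constants and the final estimate\<close>

theorem proposition5p2:
  fixes E :: "real set"
    and A :: "real \<Rightarrow> real \<Rightarrow> complex \<Rightarrow> complex^'n^'n"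
    and X :: "real \<Rightarrow> real"
    and Ainf :: "complex \<Rightarrow> complex^'n^'n"
    and \<nu> \<theta> \<eta>0 :: real
    and U :: "complex set"
    and lam :: "real \<Rightarrow> complex" and ks :: real and zs :: complex
    and \<mu>c :: "complex \<Rightarrow> complex"
    and Qsu Qc Qss :: "complex \<Rightarrow> complex^'n^'n"
    and Pm Pp :: "real \<Rightarrow> complex \<Rightarrow> complex^'n^'n"
    and R :: "complex \<Rightarrow> complex^'n^'n"
    and Jsu Jc Jss :: "'n set"
    and \<Psi> :: "real \<Rightarrow> real \<Rightarrow> complex \<Rightarrow> complex^'n^'n"
  assumes params: "is_interval E" "0 \<in> E" "E \<subseteq> {0..}" "E \<noteq> {0}"
    and A_analytic: "\<And>\<epsilon> x. \<epsilon> \<in> E \<Longrightarrow> matrix_holomorphic_on (A \<epsilon> x) UNIV"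
    and A_C1: "\<And>\<epsilon> z. \<epsilon> \<in> E \<Longrightarrow> (\<lambda>x. A \<epsilon> x z) C1_differentiable_on UNIV"
    and A_cont: "\<And>x z. continuous_on (E - {0}) (\<lambda>\<epsilon>. A \<epsilon> x z)"
    and X_pos: "\<And>\<epsilon>. \<epsilon> \<in> E - {0} \<Longrightarrow> X \<epsilon> > 0"
    and A_periodic: "\<And>\<epsilon> x z. \<epsilon> \<in> E - {0} \<Longrightarrow> A \<epsilon> (x + X \<epsilon>) z = A \<epsilon> x z"
    and rates: "\<nu> > 0" "\<theta> > 0"
    and H1: "filterlim X at_top (at 0 within E)"
    and H2: "\<And>M. M > 0 \<Longrightarrow> \<exists>C>0. \<forall>x z. norm z \<le> M \<longrightarrow>
               norm (A 0 x z - Ainf z) \<le> C * exp (- \<nu> * \<bar>x\<bar>)"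
    and H3: "\<And>M. M > 0 \<Longrightarrow> \<exists>C>0. \<forall>\<epsilon>\<in>E - {0}. \<forall>x z. norm z \<le> M \<and> \<bar>x\<bar> \<le> X \<epsilon> / 2 \<longrightarrow>
               norm (A \<epsilon> x z - A 0 x z) \<le> C * exp (- \<theta> * X \<epsilon> / 2)"
    and U: "open U" "zs \<in> U"
    and arc: "isolated_arc Ainf U lam ks zs \<mu>c"
    and Qc: "analytic_spectral_projection Ainf U zs {z. Re z = 0} Qc"
    and Qss: "analytic_spectral_projection Ainf U zs {z. Re z < 0} Qss"
    and Qsu: "analytic_spectral_projection Ainf U zs {z. Re z > 0} Qsu"
    and \<eta>0: "0 < \<eta>0" "\<eta>0 < min \<theta> \<nu>"
    and Pp: "conjugator (A 0) Ainf U {0..} \<eta>0 Pp"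
    and Pm: "conjugator (A 0) Ainf U {..0} \<eta>0 Pm"
    and J: "Jsu \<union> Jc \<union> Jss = UNIV" "Jsu \<inter> Jc = {}" "Jsu \<inter> Jss = {}" "Jc \<inter> Jss = {}"
    and Rsu: "\<And>z. z \<in> U \<Longrightarrow> basis_columns (R z) Jsu (range ((*v) (Qsu z)))"
    and Rc: "\<And>z. z \<in> U \<Longrightarrow> basis_columns (R z) Jc (range ((*v) (Qc z)))"
    and Rss: "\<And>z. z \<in> U \<Longrightarrow> basis_columns (R z) Jss (range ((*v) (Qss z)))"
    and \<Psi>: "\<And>\<epsilon> z. \<epsilon> \<in> E - {0} \<Longrightarrow> solution_operator (\<lambda>x. A \<epsilon> x z) (\<lambda>x. \<Psi> \<epsilon> x z)"
  shows "let n1 = vec.dim (range ((*v) (Qss zs)));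
             D1 = (\<lambda>z. homoclinic_evans (Pm 0 z) (Pp 0 z) (R z) (Jsu \<union> Jc));
             D2 = (\<lambda>z. homoclinic_evans (Pm 0 z) (Pp 0 z) (R z) Jsu);
             Dper = (\<lambda>\<epsilon> z \<gamma>. transitional_periodic_evans (Ainf z) (Qsu z) (Qss z) n1
                       (\<lambda>x. \<Psi> \<epsilon> x z) (X \<epsilon>) \<gamma>);
             Dhom = (\<lambda>\<epsilon> z \<gamma>. transitional_homoclinic_evans (\<mu>c z) (D1 z) (D2 z) (X \<epsilon>) \<gamma>)
         in \<exists>C1>0. \<exists>\<eta>>0. \<forall>C>0. \<exists>K. \<forall>\<epsilon>\<in>E - {0}. X \<epsilon> \<ge> K \<longrightarrow>
              (\<forall>z\<in>ball zs (C / X \<epsilon>). \<forall>\<gamma>. norm \<gamma> = 1 \<longrightarrow>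
                 norm (Dper \<epsilon> z \<gamma> - Dhom \<epsilon> z \<gamma>) \<le> C1 * exp (- \<eta> * X \<epsilon> / 2))"
proof -
  let ?n = "of_nat CARD('n) :: real"
  have cont: "(Ainf \<longlongrightarrow> Ainf zs) (nhds zs)"
    by (rule limit_matrix_continuous[OF A_analytic[OF params(2)] rates(1) H2])
  \<comment> \<open>At every point of \<open>U\<close> this rank is the number of columns in
    \<open>Jc\<close>.\<close>
  have dimc: "vec.dim (range ((*v) (Qc z))) = vec.dim (range ((*v) (Qc zs)))" if "z \<in> U" for z
    using card_basis_columns[OF Rc[OF that]] card_basis_columns[OF Rc[OF U(2)]] by simp
  obtain Kp where Kp: "Kp \<ge> 1"
    "\<And>x z. x \<in> {0..} \<Longrightarrow> z \<in> U \<Longrightarrow> norm (Pp x z) \<le> Kp \<and> invertible (Pp x z) \<and> norm (matrix_inv (Pp x z)) \<le> Kp"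
    "\<And>x z. x \<in> {0..} \<Longrightarrow> z \<in> U \<Longrightarrow> norm (Pp x z - mat 1) \<le> Kp * exp (- \<eta>0 * \<bar>x\<bar>)"
    "\<And>x z. x \<in> {0..} \<Longrightarrow> z \<in> U \<Longrightarrow> ((\<lambda>y. Pp y z) has_vector_derivative (A 0 x z ** Pp x z - Pp x z ** Ainf z)) (at x within {0..})"
    using conjugatorD[OF Pp] by metis
  obtain Km where Km: "Km \<ge> 1"
    "\<And>x z. x \<in> {..0} \<Longrightarrow> z \<in> U \<Longrightarrow> norm (Pm x z) \<le> Km \<and> invertible (Pm x z) \<and> norm (matrix_inv (Pm x z)) \<le> Km"
    "\<And>x z. x \<in> {..0} \<Longrightarrow> z \<in> U \<Longrightarrow> norm (Pm x z - mat 1) \<le> Km * exp (- \<eta>0 * \<bar>x\<bar>)"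
    "\<And>x z. x \<in> {..0} \<Longrightarrow> z \<in> U \<Longrightarrow> ((\<lambda>y. Pm y z) has_vector_derivative (A 0 x z ** Pm x z - Pm x z ** Ainf z)) (at x within {..0})"
    using conjugatorD[OF Pm] by metis
  have "\<theta> / 2 > 0" using rates by simp
  obtain d :: "'n \<Rightarrow> complex" and \<kappa> \<delta> \<beta> K0 :: real and S S' :: "complex^'n^'n" where \<kappa>: "0 < \<kappa>" "\<kappa> \<le> \<theta> / 2"
    and gap: "\<And>i j. Re (d i - d j) \<ge> 0 \<or> Re (d i - d j) \<le> - 2 * \<kappa>"
    and SS: "S' ** S = mat 1" and \<delta>: "?n * (2 * \<delta>) \<le> \<kappa> / 4" and \<beta>: "\<beta> > 0" and K0: "K0 \<ge> 1"
    and dim1: "vec.dim (range ((*v) (Qc zs))) = 1"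
    and near: "\<And>\<omega>. \<omega> > 0 \<Longrightarrow> \<forall>\<^sub>F z in nhds zs. z \<in> U \<and>
      (\<forall>i j. norm ((S' ** Ainf z ** S) $ i $ j - (if i = j then d i else 0)) \<le> \<delta>) \<and>
      \<bar>Re (\<mu>c z)\<bar> \<le> \<omega> \<and> spectral_splitting (Ainf z) (Qsu z) (Qc z) (Qss z) \<and>
      Ainf z ** Qc z = mat (\<mu>c z) ** Qc z \<and>
      (\<forall>t\<ge>0. norm (mexp (Ainf z) t ** Qss z) \<le> K0 * exp (- \<beta> * t)) \<and>
      (\<forall>t\<ge>0. norm (mexp (Ainf z) (- t) ** Qsu z) \<le> K0 * exp (- \<beta> * t)) \<and>
      norm (Qsu z) \<le> K0 \<and> norm (Qc z) \<le> K0 \<and> norm (Qss z) \<le> K0"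
  proof (rule isolated_arc_local_structure[OF U arc Qc Qss Qsu _ cont \<open>\<theta> / 2 > 0\<close>], goal_cases)
    case (1 z)
    show ?case by (rule dimc[OF 1(2)])
  next
    case (2 d \<kappa> \<delta> \<beta> K0 S S')
    show ?case by (rule 2(1)[OF 2(2-)])
  qed
  have "norm zs + 1 > 0" by (simp add: add_nonneg_pos)
  from H3[OF this] obtain C3 where C3: "C3 > 0"
    "\<And>\<epsilon> x z. \<epsilon> \<in> E - {0} \<Longrightarrow> norm z \<le> norm zs + 1 \<Longrightarrow> \<bar>x\<bar> \<le> X \<epsilon> / 2 \<Longrightarrow>
       norm (A \<epsilon> x z - A 0 x z) \<le> C3 * exp (- \<theta> * X \<epsilon> / 2)" by blast
  define KA where "KA = max K0 (max Kp Km)"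
  have KA: "KA \<ge> 1" "K0 \<le> KA" "Kp \<le> KA" "Km \<le> KA" using K0 by (auto simp: KA_def)
  define c where "c = norm S * norm S'"
  define T1 where "T1 = 2 * c\<^sup>2 * ?n\<^sup>2 * KA\<^sup>2 * C3 / \<kappa>"
  define T2 where "T2 = KA * (2 * T1 + KA)"
  have T1: "T1 \<ge> 0" using C3 \<kappa> by (simp add: T1_def)
  have T2: "T2 \<ge> 0" using KA T1 by (simp add: T2_def)
  \<comment> \<open>The slowest of three rates: the second conjugation, the convergence of the given
    conjugators, and the exponential dichotomy.\<close>
  define \<sigma> where "\<sigma> = min (min (\<theta> / 2) \<eta>0) \<beta>"
  have \<sigma>: "\<sigma> > 0" "\<sigma> \<le> \<theta> / 2" "\<sigma> \<le> \<eta>0" "\<sigma> \<le> \<beta>" using rates \<eta>0 \<beta> by (auto simp: \<sigma>_def)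
  \<comment> \<open>The determinant raises e^{\<omega> L} to the n-th power; this choice makes that
    e^{\<sigma> L / 2} and leaves the rate \<sigma>/2.\<close>
  define \<omega> where "\<omega> = \<sigma> / (2 * ?n)"
  have \<omega>: "\<omega> > 0" using \<sigma> by (simp add: \<omega>_def)
  \<comment> \<open>Keeps \<open>norm z\<close> below \<open>norm zs + 1\<close>, the radius for
    which \<open>C3\<close> was obtained.\<close>
  have "\<forall>\<^sub>F z in nhds zs. z \<in> ball zs 1" by (intro eventually_nhds_in_open) auto
  from eventually_conj[OF near[OF \<omega>] this] obtain r where r: "r > 0"
    and local: "\<And>z. dist z zs < r \<Longrightarrow> (z \<in> U \<and>
      (\<forall>i j. norm ((S' ** Ainf z ** S) $ i $ j - (if i = j then d i else 0)) \<le> \<delta>) \<and>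
      \<bar>Re (\<mu>c z)\<bar> \<le> \<omega> \<and> spectral_splitting (Ainf z) (Qsu z) (Qc z) (Qss z) \<and>
      Ainf z ** Qc z = mat (\<mu>c z) ** Qc z \<and>
      (\<forall>t\<ge>0. norm (mexp (Ainf z) t ** Qss z) \<le> K0 * exp (- \<beta> * t)) \<and>
      (\<forall>t\<ge>0. norm (mexp (Ainf z) (- t) ** Qsu z) \<le> K0 * exp (- \<beta> * t)) \<and>
      norm (Qsu z) \<le> K0 \<and> norm (Qc z) \<le> K0 \<and> norm (Qss z) \<le> K0) \<and> z \<in> ball zs 1"
    unfolding eventually_nhds_metric by blast
  \<comment> \<open>The first two conditions are the smallness required by the second conjugation;
    the third makes the matrix \<open>G\<close> of the transition estimate invertible.\<close>
  have "\<forall>\<^sub>F L in at_top. (?n * (c * KA\<^sup>2 * C3)) * exp (- \<theta> * L) \<le> \<kappa> / 4 \<and> T1 * exp (- (\<theta> / 2) * L) \<le> 1 / 2 \<and>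
      T2 * exp (- \<sigma> * L) \<le> 1 / (4 * KA) \<and> 0 \<le> L"
    using rates \<kappa> \<sigma> KA by (intro eventually_conj eventually_exp_decay_le eventually_ge_at_top) auto
  then obtain L0 where L0: "\<And>L. L \<ge> L0 \<Longrightarrow> (?n * (c * KA\<^sup>2 * C3)) * exp (- \<theta> * L) \<le> \<kappa> / 4 \<and>
      T1 * exp (- (\<theta> / 2) * L) \<le> 1 / 2 \<and> T2 * exp (- \<sigma> * L) \<le> 1 / (4 * KA) \<and> 0 \<le> L"
    unfolding eventually_at_top_linorder by blast
  define F where "F = fact CARD('n) * ?n * (100 * KA ^ 4 * (norm (mat 1 :: complex^'n^'n) + 1)\<^sup>2) ^ CARD('n)"
  have F: "F > 0"
  proof -
    have "100 * KA ^ 4 * (norm (mat 1 :: complex^'n^'n) + 1)\<^sup>2 > 0"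
      using KA by (intro mult_pos_pos zero_less_power add_nonneg_pos) auto
    then show ?thesis by (simp add: F_def)
  qed
  define n1 where "n1 = vec.dim (range ((*v) (Qss zs)))"
  have n1: "n1 = card Jss" using card_basis_columns[OF Rss[OF U(2)]] by (simp add: n1_def)
  have Jc1: "card Jc = 1" using card_basis_columns[OF Rc[OF U(2)]] dim1 by simp
  have main: "norm (transitional_periodic_evans (Ainf z) (Qsu z) (Qss z) n1 (\<lambda>x. \<Psi> \<epsilon> x z) (X \<epsilon>) \<gamma>
       - transitional_homoclinic_evans (\<mu>c z) (homoclinic_evans (Pm 0 z) (Pp 0 z) (R z) (Jsu \<union> Jc))
          (homoclinic_evans (Pm 0 z) (Pp 0 z) (R z) Jsu) (X \<epsilon>) \<gamma>)
      \<le> (F * (T2 + K0)) * exp (- (\<sigma> / 2) * X \<epsilon> / 2)"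
    if \<epsilon>: "\<epsilon> \<in> E - {0}" and XL: "X \<epsilon> \<ge> 2 * L0" and z: "dist z zs < r" and \<gamma>: "norm \<gamma> = 1" for \<epsilon> z \<gamma>
  proof -
    define L where "L = X \<epsilon> / 2"
    have "L \<ge> L0" using XL by (simp add: L_def)
    note L = L0[OF this]
    have L': "L \<ge> 0" using L by blast
    have XL': "X \<epsilon> = 2 * L" by (simp add: L_def)
    let ?B = "Ainf z"
    have zU: "z \<in> U" and zB: "\<And>i j. norm ((S' ** ?B ** S) $ i $ j - (if i = j then d i else 0)) \<le> \<delta>"
      and z\<mu>: "\<bar>Re (\<mu>c z)\<bar> \<le> \<omega>" and zs: "spectral_splitting ?B (Qsu z) (Qc z) (Qss z)"
      and zQ: "?B ** Qc z = mat (\<mu>c z) ** Qc z"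
      and zd: "norm (mexp ?B L ** Qss z) \<le> K0 * exp (- \<beta> * L)" "norm (mexp ?B (- L) ** Qsu z) \<le> K0 * exp (- \<beta> * L)"
      and zn: "norm (Qsu z) \<le> K0" "norm (Qc z) \<le> K0" "norm (Qss z) \<le> K0" and z1: "z \<in> ball zs 1"
      using local[OF z] L' by auto
    have zM: "norm z \<le> norm zs + 1"
      using z1 norm_triangle_sub[of z zs] by (simp add: dist_norm norm_minus_commute)
    have A\<epsilon>: "norm (A \<epsilon> x z - A 0 x z) \<le> C3 * exp (- \<theta> * L)" if "\<bar>x\<bar> \<le> L" for x
      using C3(2)[OF \<epsilon> zM, of x] that by (simp add: XL')
    have \<Psi>0: "\<Psi> \<epsilon> 0 z = mat 1" and \<Psi>': "\<And>x T. ((\<lambda>x. \<Psi> \<epsilon> x z) has_vector_derivative A \<epsilon> x z ** \<Psi> \<epsilon> x z) (at x within T)"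
      using \<Psi>[OF \<epsilon>, of z] by (auto simp: solution_operator_def intro: has_vector_derivative_at_within)
    have large: "(?n * (norm S * norm S' * KA\<^sup>2 * C3)) * exp (- \<theta> * L) \<le> \<kappa> / 4"
      "(2 * (norm S * norm S')\<^sup>2 * ?n\<^sup>2 * KA\<^sup>2 * C3 / \<kappa>) * exp (- (\<theta> / 2) * L) \<le> 1 / 2"
      using L by (auto simp: c_def T1_def)
    have C30: "C3 \<ge> 0" using C3 by simp
    obtain Mb Gb where b: "matrix_inv (\<Psi> \<epsilon> L z) = Mb ** mexp ?B (- L) ** Gb"
      "norm (Mb - Pp 0 z) \<le> T2 * exp (- \<sigma> * L)" "norm (Gb - mat 1) \<le> T2 * exp (- \<sigma> * L)"
    proof (rule conjugation_exponentially_small[where P = "\<lambda>x. Pp x z" and \<Psi> = "\<lambda>x. \<Psi> \<epsilon> x z" and A = "\<lambda>x. A \<epsilon> x z"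
          and ?A0.0 = "\<lambda>x. A 0 x z" and K = KA and C = C3 and \<eta> = \<eta>0,
          OF SS \<kappa> L' gap zB \<delta> _ KA(1) _ _ C30 _ _ \<Psi>0 large \<sigma>(2,3)])
      show "((\<lambda>x. Pp x z) has_vector_derivative A 0 x z ** Pp x z - Pp x z ** ?B) (at x within {0..L})"
        if "x \<in> {0..L}" for x
        using that by (intro has_vector_derivative_within_subset[OF Kp(4)[OF _ zU]]) auto
      show "norm (Pp x z) \<le> KA \<and> invertible (Pp x z) \<and> norm (matrix_inv (Pp x z)) \<le> KA" if "x \<in> {0..L}" for x
        using Kp(2)[OF _ zU, of x] that KA by auto
      show "norm (Pp L z - mat 1) \<le> KA * exp (- \<eta>0 * L)"
        by (rule order_trans[OF _ mult_right_mono[OF KA(3)]]) (use Kp(3)[OF _ zU, of L] L' in auto)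
    qed (use A\<epsilon> \<Psi>' in \<open>auto simp: T2_def T1_def c_def\<close>)
    \<comment> \<open>The left half-line is reflected to the right one, which negates A, the
      limiting matrix and the diagonal \<open>d\<close>. The gap condition survives with i and j
      exchanged, and the exponential at the left end becomes that of +L B.\<close>
    obtain Ma Ga where a: "matrix_inv (\<Psi> \<epsilon> (- L) z) = Ma ** mexp (- ?B) (- L) ** Ga"
      "norm (Ma - Pm 0 z) \<le> T2 * exp (- \<sigma> * L)" "norm (Ga - mat 1) \<le> T2 * exp (- \<sigma> * L)"
    proof (rule conjugation_exponentially_small[where P = "\<lambda>x. Pm (- x) z" and \<Psi> = "\<lambda>x. \<Psi> \<epsilon> (- x) z"
          and A = "\<lambda>x. - A \<epsilon> (- x) z" and ?A0.0 = "\<lambda>x. - A 0 (- x) z" and B = "- ?B" and d = "\<lambda>i. - d i"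
          and K = KA and C = C3 and \<eta> = \<eta>0, OF SS \<kappa> L' _ _ \<delta> _ KA(1) _ _ C30 _ _ _ large \<sigma>(2,3)])
      have neg: "((\<lambda>x. F (- x)) has_vector_derivative - D) (at x within {0..L})"
        if "(F has_vector_derivative D) (at (- x) within {..0})" for F :: "real \<Rightarrow> complex^'n^'n" and D x
      proof -
        have "uminus ` {0..L} \<subseteq> {..0}" by auto
        from has_vector_derivative_within_subset[OF that this]
        show ?thesis
          using vector_diff_chain_within[OF has_vector_derivative_minus[OF has_vector_derivative_id], of F D x "{0..L}"]
          by (simp add: o_def)
      qed
      show "((\<lambda>x. Pm (- x) z) has_vector_derivative - A 0 (- x) z ** Pm (- x) z - Pm (- x) z ** - ?B) (at x within {0..L})"
        if "x \<in> {0..L}" for x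
        using neg[OF Km(4)[OF _ zU, of "- x"]] that by (simp add: matrix_minus_left matrix_minus_right)
      show "((\<lambda>x. \<Psi> \<epsilon> (- x) z) has_vector_derivative - A \<epsilon> (- x) z ** \<Psi> \<epsilon> (- x) z) (at x within {0..L})" for x
        using neg[OF \<Psi>', of x] by (simp add: matrix_minus_left)
      show "norm (Pm (- x) z) \<le> KA \<and> invertible (Pm (- x) z) \<and> norm (matrix_inv (Pm (- x) z)) \<le> KA" if "x \<in> {0..L}" for x
        using Km(2)[OF _ zU, of "- x"] that KA by auto
      show "norm (Pm (- L) z - mat 1) \<le> KA * exp (- \<eta>0 * L)"
        by (rule order_trans[OF _ mult_right_mono[OF KA(4)]]) (use Km(3)[OF _ zU, of "- L"] L' in auto)
      show "Re (- d i - - d j) \<ge> 0 \<or> Re (- d i - - d j) \<le> - 2 * \<kappa>" for i j using gap[of j i] by auto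
      show "norm ((S' ** - ?B ** S) $ i $ j - (if i = j then - d i else 0)) \<le> \<delta>" for i j
      proof -
        have "(S' ** - ?B ** S) $ i $ j - (if i = j then - d i else 0) = - ((S' ** ?B ** S) $ i $ j - (if i = j then d i else 0))"
          by (simp add: matrix_minus_left matrix_minus_right)
        then show ?thesis using zB[of i j] by (simp only: norm_minus_cancel)
      qed
      show "norm (- A \<epsilon> (- x) z - - A 0 (- x) z) \<le> C3 * exp (- \<theta> * L)" if "x \<in> {0..L}" for x
        using A\<epsilon>[of "- x"] that by (simp add: norm_minus_commute)
    qed (use \<Psi>0 in \<open>auto simp: T2_def T1_def c_def\<close>)
    define tot where "tot = det (Ma ** mexp ?B L ** Ga - mat \<gamma> ** (Mb ** mexp ?B (- L) ** Gb))"
    define hom where "hom = det (Pm 0 z ** Qsu z + (mat (exp (\<mu>c z * of_real L)) ** Pm 0 z - mat (\<gamma> * exp (- \<mu>c z * of_real L)) ** Pp 0 z) ** Qc z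
          - mat \<gamma> ** (Pp 0 z ** Qss z))"
    define N where "N = exp (- trace (?B ** Qsu z) * of_real L) * exp (trace (?B ** Qss z) * of_real L)"
    have exp_mono: "exp (- \<beta> * L) \<le> exp (- \<sigma> * L)" "exp (- \<beta> * L) \<le> 1"
      using mult_right_mono[OF \<sigma>(4) L'] mult_nonneg_nonneg[of \<beta> L] \<beta> L' by auto
    have KS: "K0 * exp (- \<beta> * L) \<le> KA" using mult_mono[OF KA(2) exp_mono(2)] K0 KA(1) by simp
    have est: "norm (N * tot - hom) \<le> F * exp (\<omega> * L) ^ CARD('n) * (T2 * exp (- \<sigma> * L) + K0 * exp (- \<beta> * L))"
      unfolding N_def tot_def hom_def F_def
    proof (rule transition_estimate[OF zs zQ KA(1) _ _ _ _ _ z\<mu> L' \<gamma> a(2) b(2) a(3) b(3) _ zd KS])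
      show "norm (Qsu z) \<le> KA" "norm (Qc z) \<le> KA" "norm (Qss z) \<le> KA" using zn KA by auto
      show "norm (Pm 0 z) \<le> KA" "norm (Pp 0 z) \<le> KA"
        using Km(2)[OF _ zU, of 0] Kp(2)[OF _ zU, of 0] KA by auto
      show "T2 * exp (- \<sigma> * L) \<le> 1 / (4 * KA)" using L by blast
    qed
    also have "\<dots> \<le> F * exp (\<omega> * L) ^ CARD('n) * (T2 * exp (- \<sigma> * L) + K0 * exp (- \<sigma> * L))"
      using F K0 by (intro mult_left_mono add_left_mono exp_mono) auto
    also have "\<dots> = (F * (T2 + K0)) * (exp (\<omega> * L) ^ CARD('n) * exp (- \<sigma> * L))" by (simp add: algebra_simps)
    also have "exp (\<omega> * L) ^ CARD('n) * exp (- \<sigma> * L) = exp (- (\<sigma> / 2) * X \<epsilon> / 2)"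
    proof -
      have "?n * (\<omega> * L) = \<sigma> / 2 * L" by (simp add: \<omega>_def)
      then have "exp (\<omega> * L) ^ CARD('n) = exp (\<sigma> / 2 * L)" by (metis exp_of_nat_mult)
      then show ?thesis by (simp add: XL' algebra_simps flip: exp_add)
    qed
    finally have est': "norm (N * tot - hom) \<le> (F * (T2 + K0)) * exp (- (\<sigma> / 2) * X \<epsilon> / 2)" .
    have per: "periodic_evans (\<lambda>x. \<Psi> \<epsilon> x z) (X \<epsilon>) \<gamma> = tot"
      using a(1) b(1) by (simp add: periodic_evans_def tot_def XL' \<Psi>0 mexp_uminus)
    have hom: "hom = (- \<gamma>) ^ n1 * transitional_homoclinic_evans (\<mu>c z) (homoclinic_evans (Pm 0 z) (Pp 0 z) (R z) (Jsu \<union> Jc))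
          (homoclinic_evans (Pm 0 z) (Pp 0 z) (R z) Jsu) (X \<epsilon>) \<gamma>"
      unfolding hom_def n1 det_transition_homoclinic[OF J Jc1 zs Rsu[OF zU] Rc[OF zU] Rss[OF zU]]
      by (simp add: transitional_homoclinic_evans_def XL')
    \<comment> \<open>The power of -\<gamma> from the columns in \<open>Jss\<close> cancels the
      normalizing one, as n1 is the number of these columns; being unimodular, the factor does not
      affect the estimate.\<close>
    have \<gamma>n: "(- \<gamma>) powi (- int n1) * (- \<gamma>) ^ n1 = 1" "norm ((- \<gamma>) powi (- int n1)) = 1"
      using \<gamma> norm_zero[where 'a = complex]
      by (auto simp: power_int_minus norm_inverse norm_power intro!: left_inverse)
    have "transitional_periodic_evans ?B (Qsu z) (Qss z) n1 (\<lambda>x. \<Psi> \<epsilon> x z) (X \<epsilon>) \<gamma> = (- \<gamma>) powi (- int n1) * (N * tot)"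
      unfolding transitional_periodic_evans_def per N_def by (simp add: XL' mult_ac)
    moreover have "transitional_homoclinic_evans (\<mu>c z) (homoclinic_evans (Pm 0 z) (Pp 0 z) (R z) (Jsu \<union> Jc))
          (homoclinic_evans (Pm 0 z) (Pp 0 z) (R z) Jsu) (X \<epsilon>) \<gamma> = (- \<gamma>) powi (- int n1) * hom"
      unfolding hom mult.assoc[symmetric] \<gamma>n by simp
    ultimately show ?thesis
      using est' by (simp add: norm_mult \<gamma>n(2) flip: right_diff_distrib)
  qed
  have pos: "F * (T2 + K0) > 0" "\<sigma> / 2 > 0" using F T2 K0 \<sigma> by simp_all
  show ?thesis
    unfolding Let_def n1_def[symmetric]
  proof (rule exI, rule conjI[OF pos(1)], rule exI, rule conjI[OF pos(2)], intro allI impI)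
    fix C :: real assume C: "C > 0"
    show "\<exists>K. \<forall>\<epsilon>\<in>E - {0}. K \<le> X \<epsilon> \<longrightarrow> (\<forall>z\<in>ball zs (C / X \<epsilon>). \<forall>\<gamma>. norm \<gamma> = 1 \<longrightarrow>
      norm (transitional_periodic_evans (Ainf z) (Qsu z) (Qss z) n1 (\<lambda>x. \<Psi> \<epsilon> x z) (X \<epsilon>) \<gamma>
       - transitional_homoclinic_evans (\<mu>c z) (homoclinic_evans (Pm 0 z) (Pp 0 z) (R z) (Jsu \<union> Jc))
          (homoclinic_evans (Pm 0 z) (Pp 0 z) (R z) Jsu) (X \<epsilon>) \<gamma>) \<le> F * (T2 + K0) * exp (- (\<sigma> / 2) * X \<epsilon> / 2))"
    \<comment> \<open>The first threshold ensures X/2 \<ge> L0; the second puts the disk of radius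
      C/X inside the fixed disk of radius \<open>r\<close>.\<close>
    proof (intro exI[of _ "max (2 * L0) (C / r)"] ballI impI allI)
      fix \<epsilon> :: real and z \<gamma> :: complex
      assume \<epsilon>: "\<epsilon> \<in> E - {0}" and K: "max (2 * L0) (C / r) \<le> X \<epsilon>" and z: "z \<in> ball zs (C / X \<epsilon>)" and \<gamma>: "norm \<gamma> = 1"
      have "C / X \<epsilon> \<le> r" using K r X_pos[OF \<epsilon>] by (simp add: field_simps)
      then have "dist z zs < r" using z by (simp add: dist_commute)
      from main[OF \<epsilon> _ this \<gamma>] K show "norm (transitional_periodic_evans (Ainf z) (Qsu z) (Qss z) n1 (\<lambda>x. \<Psi> \<epsilon> x z) (X \<epsilon>) \<gamma>
       - transitional_homoclinic_evans (\<mu>c z) (homoclinic_evans (Pm 0 z) (Pp 0 z) (R z) (Jsu \<union> Jc))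
          (homoclinic_evans (Pm 0 z) (Pp 0 z) (R z) Jsu) (X \<epsilon>) \<gamma>) \<le> F * (T2 + K0) * exp (- (\<sigma> / 2) * X \<epsilon> / 2)"
        by simp
    qed
  qed
qed

end
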